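(* Let $G$ be a non-elementary convergence group acting on a compact metrizable topological space $M$. Then $G$ is acylindrically hyperbolic.
   Context: **Convergence groups.** $G$ is an infinite group acting by homeomorphisms on an infinite compact metrizable topological space $M$. The action is a convergence action (and $G$ is a convergence group acting on $M$) if for every infinite sequence $\{g_n\}_{n\ge1}$ of distinct elements of $G$ there exist a subsequence $\{g_{n_k}\}$ and points $a,b\in M$ such that $g_{n_k}|_{M\setminus\{a\}}$ converges to $b$ locally uniformly, i.e. for every compact $K\subset M\setminus\{a\}$ and every open neighbourhood $U$ of $b$ there is $N\in\mathbb N$ with $g_{n_k}(K)\subset U$ whenever $n_k>N$. The convergence group $G$ is elementary if it preserves setwise a nonempty subset of $M$ with at most two elements, and non-elementary otherwise. **Hyperbolic spaces.** A geodesic metric space $(S,d)$ is $\delta$-hyperbolic ($\delta\geqslant 0$) if every geodesic triangle is $\delta$-slim: each point of any side is at distance less than $\delta$ from the union of the other two sides. $S$ is Gromov hyperbolic if it is $\delta$-hyperbolic for some $\delta\ge 0$. Properness of $S$ is not assumed. Gromov product: $(x\cdot y)_z=(d(x,z)+d(y,z)-d(x,y))/2$. Fix $e\in S$. A sequence $\{s_n\}$ in $S$ converges to $\infty$ if $(s_i\cdot s_j)_e\to\infty$ as $i,j\to\infty$; two such sequences $\{x_n\},\{y_n\}$ are equivalent if $(x_n\cdot y_n)_e\to\infty$. The Gromov boundary $\partial S$ is the set of equivalence classes; a sequence tends to $x\in\partial S$ if it belongs to the class $x$. (This does not depend on $e$.) **Acylindrically hyperbolic groups.** An isometric action of $G$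 on a Gromov hyperbolic space $S$ is acylindrical if for every $\epsilon>0$ there exist $R,N>0$ such that for all $x,y\in S$ with $d(x,y)\geqslant R$ there are at most $N$ elements $g\in G$ with $d(x,gx)\leqslant\epsilon$ and $d(y,gy)\leqslant\epsilon$. The limit set is $\Lambda(G)=\{x\in\partial S\mid \text{some sequence in } Gs \text{ tends to } x, \text{ for some } s\in S\}$. The action is non-elementary if $\Lambda(G)$ contains at least three points. $G$ is acylindrically hyperbolic if it admits a non-elementary acylindrical isometric action on a Gromov hyperbolic space. *)

theory Defs
  imports "HOL-Analysis.Analysis" "HOL-Algebra.Group_Action"
begin

section \<open>Convergence groups\<close>

(* The action need not be faithful: "phi" is any homomorphism from G to the bijections of the space. *)
locale convergence_group = group_action G "topspace X" \<phi>
  for G :: "('g, 'b) monoid_scheme" (structure)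
    and X :: "'m topology"
    and \<phi> :: "'g \<Rightarrow> 'm \<Rightarrow> 'm" +
  assumes infinite_group: "infinite (carrier G)"
    and infinite_space: "infinite (topspace X)"
    and compact: "compact_space X"
    and metrizable: "metrizable_space X"
    and homeomorphism: "\<And>g. g \<in> carrier G \<Longrightarrow> homeomorphic_map X X (\<phi> g)"
    and convergence:
      "\<And>g :: nat \<Rightarrow> 'g. \<lbrakk>range g \<subseteq> carrier G; inj g\<rbrakk> \<Longrightarrow>
         \<exists>r a b. strict_mono (r :: nat \<Rightarrow> nat) \<and> a \<in> topspace X \<and> b \<in> topspace X \<and>
           (\<forall>K U. compactin X K \<and> K \<subseteq> topspace X - {a} \<and> openin X U \<and> b \<in> U \<longrightarrow>
              (\<exists>N. \<forall>k. r k > N \<longrightarrow> \<phi> (g (r k)) ` K \<subseteq> U))"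

definition elementary_action ::
  "('g, 'b) monoid_scheme \<Rightarrow> 'm topology \<Rightarrow> ('g \<Rightarrow> 'm \<Rightarrow> 'm) \<Rightarrow> bool" where
  "elementary_action G X \<phi> \<longleftrightarrow>
     (\<exists>A \<subseteq> topspace X. A \<noteq> {} \<and> finite A \<and> card A \<le> 2 \<and> (\<forall>g \<in> carrier G. \<phi> g ` A = A))"


section \<open>Gromov hyperbolic spaces\<close>

definition geodesic_between ::
  "'s set \<Rightarrow> ('s \<Rightarrow> 's \<Rightarrow> real) \<Rightarrow> 's set \<Rightarrow> 's \<Rightarrow> 's \<Rightarrow> bool" where
  "geodesic_between S d A x y \<longleftrightarrow>
     (\<exists>\<gamma> :: real \<Rightarrow> 's. A = \<gamma> ` {0..d x y} \<and> A \<subseteq> S \<and> \<gamma> 0 = x \<and> \<gamma> (d x y) = y \<and>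
        (\<forall>s \<in> {0..d x y}. \<forall>t \<in> {0..d x y}. d (\<gamma> s) (\<gamma> t) = \<bar>s - t\<bar>))"

definition geodesic_space :: "'s set \<Rightarrow> ('s \<Rightarrow> 's \<Rightarrow> real) \<Rightarrow> bool" where
  "geodesic_space S d \<longleftrightarrow>
     Metric_space S d \<and> (\<forall>x \<in> S. \<forall>y \<in> S. \<exists>A. geodesic_between S d A x y)"

(* For nonempty B, "p is at distance less than delta from B" (an infimum) says exactly that some
   point of B is at distance less than delta from p. *)
definition slim_sides ::
  "('s \<Rightarrow> 's \<Rightarrow> real) \<Rightarrow> real \<Rightarrow> 's set \<Rightarrow> 's set \<Rightarrow> 's set \<Rightarrow> bool" where
  "slim_sides d \<delta> A B C \<longleftrightarrow>
     (\<forall>p \<in> A. \<exists>q \<in> B \<union> C. d p q < \<delta>) \<and>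
     (\<forall>p \<in> B. \<exists>q \<in> A \<union> C. d p q < \<delta>) \<and>
     (\<forall>p \<in> C. \<exists>q \<in> A \<union> B. d p q < \<delta>)"

definition delta_hyperbolic :: "'s set \<Rightarrow> ('s \<Rightarrow> 's \<Rightarrow> real) \<Rightarrow> real \<Rightarrow> bool" where
  "delta_hyperbolic S d \<delta> \<longleftrightarrow>
     (\<forall>x \<in> S. \<forall>y \<in> S. \<forall>z \<in> S. \<forall>A B C.
        geodesic_between S d A x y \<and> geodesic_between S d B y z \<and> geodesic_between S d C z x
        \<longrightarrow> slim_sides d \<delta> A B C)"

definition Gromov_hyperbolic :: "'s set \<Rightarrow> ('s \<Rightarrow> 's \<Rightarrow> real) \<Rightarrow> bool" where
  "Gromov_hyperbolic S d \<longleftrightarrow> geodesic_space S d \<and> (\<exists>\<delta> \<ge> 0. delta_hyperbolic S d \<delta>)"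

definition Gromov_product :: "('s \<Rightarrow> 's \<Rightarrow> real) \<Rightarrow> 's \<Rightarrow> 's \<Rightarrow> 's \<Rightarrow> real" where
  "Gromov_product d z x y = (d x z + d y z - d x y) / 2"

definition converges_to_infinity ::
  "'s set \<Rightarrow> ('s \<Rightarrow> 's \<Rightarrow> real) \<Rightarrow> 's \<Rightarrow> (nat \<Rightarrow> 's) \<Rightarrow> bool" where
  "converges_to_infinity S d e s \<longleftrightarrow>
     range s \<subseteq> S \<and>
     filterlim (\<lambda>(i, j). Gromov_product d e (s i) (s j)) at_top (sequentially \<times>\<^sub>F sequentially)"

definition Gromov_equivalence ::
  "'s set \<Rightarrow> ('s \<Rightarrow> 's \<Rightarrow> real) \<Rightarrow> 's \<Rightarrow> (nat \<Rightarrow> 's) rel" where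
  "Gromov_equivalence S d e =
     {(s, t). converges_to_infinity S d e s \<and> converges_to_infinity S d e t \<and>
        filterlim (\<lambda>n. Gromov_product d e (s n) (t n)) at_top sequentially}"

(* A boundary point is the class, i.e. the set, of all sequences tending to it. *)
definition Gromov_boundary ::
  "'s set \<Rightarrow> ('s \<Rightarrow> 's \<Rightarrow> real) \<Rightarrow> 's \<Rightarrow> (nat \<Rightarrow> 's) set set" where
  "Gromov_boundary S d e = {s. converges_to_infinity S d e s} // Gromov_equivalence S d e"


section \<open>Acylindrically hyperbolic groups\<close>

definition isometric_action ::
  "('g, 'b) monoid_scheme \<Rightarrow> 's set \<Rightarrow> ('s \<Rightarrow> 's \<Rightarrow> real) \<Rightarrow> ('g \<Rightarrow> 's \<Rightarrow> 's) \<Rightarrow> bool" where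
  "isometric_action G S d \<psi> \<longleftrightarrow>
     group_action G S \<psi> \<and>
     (\<forall>g \<in> carrier G. \<forall>x \<in> S. \<forall>y \<in> S. d (\<psi> g x) (\<psi> g y) = d x y)"

definition acylindrical ::
  "('g, 'b) monoid_scheme \<Rightarrow> 's set \<Rightarrow> ('s \<Rightarrow> 's \<Rightarrow> real) \<Rightarrow> ('g \<Rightarrow> 's \<Rightarrow> 's) \<Rightarrow> bool" where
  "acylindrical G S d \<psi> \<longleftrightarrow>
     (\<forall>\<epsilon> > 0. \<exists>R > 0. \<exists>N :: nat. N > 0 \<and>
        (\<forall>x \<in> S. \<forall>y \<in> S. d x y \<ge> R \<longrightarrow>
           finite {g \<in> carrier G. d x (\<psi> g x) \<le> \<epsilon> \<and> d y (\<psi> g y) \<le> \<epsilon>} \<and>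
           card {g \<in> carrier G. d x (\<psi> g x) \<le> \<epsilon> \<and> d y (\<psi> g y) \<le> \<epsilon>} \<le> N))"

definition limit_set ::
  "('g, 'b) monoid_scheme \<Rightarrow> 's set \<Rightarrow> ('s \<Rightarrow> 's \<Rightarrow> real) \<Rightarrow> 's \<Rightarrow> ('g \<Rightarrow> 's \<Rightarrow> 's) \<Rightarrow>
     (nat \<Rightarrow> 's) set set" where
  "limit_set G S d e \<psi> =
     {\<xi> \<in> Gromov_boundary S d e. \<exists>s \<in> S. \<exists>\<sigma> \<in> \<xi>. range \<sigma> \<subseteq> orbit G \<psi> s}"

definition non_elementary ::
  "('g, 'b) monoid_scheme \<Rightarrow> 's set \<Rightarrow> ('s \<Rightarrow> 's \<Rightarrow> real) \<Rightarrow> 's \<Rightarrow> ('g \<Rightarrow> 's \<Rightarrow> 's) \<Rightarrow> bool" where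
  "non_elementary G S d e \<psi> \<longleftrightarrow>
     (\<exists>\<xi> \<eta> \<zeta>. {\<xi>, \<eta>, \<zeta>} \<subseteq> limit_set G S d e \<psi> \<and> \<xi> \<noteq> \<eta> \<and> \<xi> \<noteq> \<zeta> \<and> \<eta> \<noteq> \<zeta>)"

(* HOL cannot quantify over types inside a formula, so the space S ranges over the subsets of the
   single type "'g * real", with arbitrary metrics. This loses nothing. Suppose G acts as required
   on a hyperbolic space T over any type. Choose the base point, one point in each of three orbits
   witnessing three limit points, and one geodesic for every pair of points of T. Let T' be the
   least subset of T that contains the chosen points and is closed under G and under passing from
   a pair of points to all points of its chosen geodesic. It arises in countably many steps, so it
   has cardinality at most max(|G|, 2^aleph_0), hence embeds in "'g * real". It is geodesic, and
   hyperbolicity, acylindricity and the three limit points are inherited, because geodesics of T'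
   are geodesics of T and Gromov products are the same in T' and in T. *)
definition acylindrically_hyperbolic :: "('g, 'b) monoid_scheme \<Rightarrow> bool" where
  "acylindrically_hyperbolic G \<longleftrightarrow>
     (\<exists>(S :: ('g \<times> real) set) d \<psi>.
        Gromov_hyperbolic S d \<and> isometric_action G S d \<psi> \<and> acylindrical G S d \<psi> \<and>
        (\<exists>e \<in> S. non_elementary G S d e \<psi>))"

end

theory Submission
  imports Defs
begin

text \<open>
  A non-elementary convergence group contains an element \<open>h\<close> with an attracting fixed point \<open>q\<close> and a
  repelling fixed point \<open>p\<close>. The pair \<open>{p, q}\<close> plays the role of the axis of \<open>h\<close>, and the group acts
  on the set of all its translates. The proof turns this set into a hyperbolic space, namely the
  projection complex of Bestvina, Bromberg and Fujiwara, and shows that the action on it is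
  acylindrical by the argument of Bestvina, Bromberg, Fujiwara and Sisto.

  \<^bold>\<open>Dynamics.\<close> Disjoint closed neighbourhoods \<open>P\<close> of \<open>p\<close> and \<open>Q\<close> of \<open>q\<close> form an annulus, with translates
  \<open>(gP, gQ)\<close>. The distance between the projections of two pairs \<open>A\<close> and \<open>B\<close> to a third pair \<open>Y\<close> is
  measured by the number of annuli around \<open>Y\<close> that have \<open>A\<close> on one side and \<open>B\<close> on the other. The
  crucial choice is that \<open>P\<close> and \<open>Q\<close> are so small that no two annuli cross, that is, never do all four
  intersections of their sides occur (\<open>noncrossing_nbhds\<close>). Then the Behrstock inequality
  (\<open>separation_behrstock\<close>) is an exact statement: if an annulus around \<open>A\<close> separates \<open>Y\<close> from \<open>B\<close> and
  one around \<open>B\<close> separates \<open>Y\<close> from \<open>A\<close>, these two annuli cross. The convergence property supplies the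
  finiteness statements; the main one is that a pair fails to lie on one side of only boundedly many
  annuli around another pair (\<open>unsided_bounded\<close>).

  \<^bold>\<open>Rigidity.\<close> The Behrstock inequality says that if \<open>W\<close> lies between \<open>Y\<close> and \<open>X\<close>, then \<open>W\<close> and \<open>X\<close> have
  nearly the same projection to \<open>Y\<close>. Along a chain of such replacements the errors do not add up
  (\<open>no_drift\<close>). Hence all elements linked to \<open>X\<close> by such a chain can be projected together, at bounded
  cost, and the projections of \<open>W\<close> and \<open>X\<close> become exactly equal (\<open>rigid_transparent\<close>).

  \<^bold>\<open>The projection complex.\<close> Join two pairs by an edge if no pair lies between them. A pair \<open>Y\<close> cannot
  distinguish neighbours that are far from it (\<open>far_view\<close>), so every path between two vertices must pass
  close to every element between them (\<open>barrier\<close>). This bottleneck property makes triangles thin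
  (\<open>thin_triangles\<close>). It also gives acylindricity: an element that moves two distant vertices only a
  little permutes, up to a bounded ambiguity, the elements between them, and two distinct pairs have
  a common stabilizer of bounded size (\<open>few_elements_moving_two_vertices_little\<close>). Three rays that start
  at one vertex in directions far apart yield three limit points.
\<close>

section \<open>Graph distance\<close>

locale connected_graph =
  fixes V :: "'v set" and adj :: "'v \<Rightarrow> 'v \<Rightarrow> bool"
  assumes adj_in: "adj x y \<Longrightarrow> x \<in> V \<and> y \<in> V \<and> x \<noteq> y"
    and adj_sym: "adj x y \<Longrightarrow> adj y x"
    and connected: "\<lbrakk>x \<in> V; y \<in> V\<rbrakk> \<Longrightarrow> adj\<^sup>*\<^sup>* x y"
begin

definition gd :: "'v \<Rightarrow> 'v \<Rightarrow> nat" where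
  "gd x y = (LEAST n. (adj ^^ n) x y)"

lemma gd_path: "\<lbrakk>x \<in> V; y \<in> V\<rbrakk> \<Longrightarrow> (adj ^^ gd x y) x y"
  unfolding gd_def using connected[of x y] by (metis LeastI_ex rtranclp_imp_relpowp)

lemma gd_le: "(adj ^^ n) x y \<Longrightarrow> gd x y \<le> n"
  unfolding gd_def by (rule Least_le)

lemma gd_refl [simp]: "gd x x = 0"
  using gd_le[of 0 x x] by simp

lemma gd_eq_0: "\<lbrakk>x \<in> V; y \<in> V\<rbrakk> \<Longrightarrow> gd x y = 0 \<longleftrightarrow> x = y"
  using gd_path[of x y] by auto

lemma path_reverse: "(adj ^^ n) x y \<Longrightarrow> (adj ^^ n) y x"
proof (induction n arbitrary: y)
  case (Suc n)
  then obtain z where "(adj ^^ n) x z" "adj z y" by auto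
  then show ?case using Suc.IH adj_sym by (metis relpowp_Suc_I2)
qed auto

lemma gd_sym: "\<lbrakk>x \<in> V; y \<in> V\<rbrakk> \<Longrightarrow> gd x y = gd y x"
  using gd_le path_reverse gd_path by (metis antisym)

lemma gd_triangle: "\<lbrakk>x \<in> V; y \<in> V; z \<in> V\<rbrakk> \<Longrightarrow> gd x z \<le> gd x y + gd y z"
  using gd_path[of x y] gd_path[of y z] gd_le[of "gd x y + gd y z" x z] by (auto simp: relpowp_add)

lemma gd_adj: "adj x y \<Longrightarrow> gd x y = 1"
  using gd_le[of 1 x y] gd_eq_0[of x y] adj_in[of x y] by (force simp: relpowp_1)

lemma gd_eq_1: "\<lbrakk>x \<in> V; y \<in> V\<rbrakk> \<Longrightarrow> gd x y = 1 \<longleftrightarrow> adj x y"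
  using gd_path[of x y] gd_adj by auto

lemma path_in: "(adj ^^ n) x y \<Longrightarrow> x \<in> V \<Longrightarrow> y \<in> V"
  by (cases n) (auto dest: adj_in)

lemma gd_split:
  assumes "x \<in> V" "y \<in> V" "k \<le> gd x y"
  obtains z where "z \<in> V" "gd x z = k" "gd z y = gd x y - k"
proof -
  have "(adj ^^ (k + (gd x y - k))) x y" using gd_path assms by simp
  then obtain z where z: "(adj ^^ k) x z" "(adj ^^ (gd x y - k)) z y"
    by (auto simp: relpowp_add)
  then have "z \<in> V" using path_in assms by blast
  moreover have "gd x z \<le> k" "gd z y \<le> gd x y - k" using gd_le z by blast+
  ultimately show ?thesis using that gd_triangle[of x z y] assms by force
qed

end

section \<open>Projection systems and the absence of drift\<close>

text \<open>
  The projection axioms of Bestvina, Bromberg and Fujiwara. The number \<open>d Y X Z\<close> stands for the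
  distance between the projections of \<open>X\<close> and \<open>Z\<close> to \<open>Y\<close>; when it exceeds \<open>\<theta>\<close>, think of \<open>Y\<close> as lying
  between \<open>X\<close> and \<open>Z\<close>.
\<close>

locale projection_system =
  fixes V :: "'v set" and d :: "'v \<Rightarrow> 'v \<Rightarrow> 'v \<Rightarrow> nat" and \<theta> :: nat
  assumes d_sym: "d Y X Z = d Y Z X"
    and d_triangle: "\<lbrakk>Y \<in> V; X \<in> V - {Y}; Z \<in> V - {Y}; W \<in> V - {Y}\<rbrakk> \<Longrightarrow> d Y X W \<le> d Y X Z + d Y Z W"
    and d_refl: "\<lbrakk>Y \<in> V; X \<in> V - {Y}\<rbrakk> \<Longrightarrow> d Y X X \<le> \<theta>"
    and behrstock: "\<lbrakk>Y \<in> V; X \<in> V - {Y}; Z \<in> V - {X, Y}; \<theta> < d Y X Z\<rbrakk> \<Longrightarrow> d Z X Y \<le> \<theta>"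
    and finite_large: "\<lbrakk>X \<in> V; Z \<in> V\<rbrakk> \<Longrightarrow> finite {Y \<in> V - {X, Z}. \<theta> < d Y X Z}"
begin

text \<open>
  If \<open>W\<close> lies between \<open>B\<close> and \<open>Z\<close>, it hides each of them from the other.
\<close>

lemma between_excludes:
  assumes "W \<in> V" "B \<in> V - {W}" "Z \<in> V - {W}" "Z \<noteq> B" "\<theta> < d W B Z"
  shows "d Z B W \<le> \<theta>" "d B W Z \<le> \<theta>"
proof -
  show "d Z B W \<le> \<theta>" using behrstock[of W B Z] assms by auto
  show "d B W Z \<le> \<theta>" using behrstock[of W Z B] assms d_sym by auto
qed

text \<open>
  One of the two elements hides the other from \<open>Y\<close>. The threshold must survive the loss of a few
  multiples of \<open>\<theta>\<close> in the comparisons below, and a factor of six is enough.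
\<close>

definition step :: "'v \<Rightarrow> 'v \<Rightarrow> 'v \<Rightarrow> bool" where
  "step Y X Z \<longleftrightarrow> X \<in> V - {Y} \<and> Z \<in> V - {Y} \<and> X \<noteq> Z \<and> (6 * \<theta> < d X Y Z \<or> 6 * \<theta> < d Z Y X)"

lemma step_sym: "step Y X Z \<Longrightarrow> step Y Z X"
  by (auto simp: step_def)

text \<open>
  In the induction on chains the point of view moves from \<open>Y\<close> to elements of the chain. The condition
  compares every new base with \<open>Y\<close> and not with its predecessor. Therefore a single \<open>\<theta>\<close> is lost, however
  often the base changes.
\<close>

definition admissible_base :: "'v \<Rightarrow> 'v list \<Rightarrow> 'v \<Rightarrow> bool" where
  "admissible_base Y zs B \<longleftrightarrow> B \<in> V \<and> B \<notin> set zs \<and> (B = Y \<or> (\<forall>Z\<in>set zs. \<theta> < d B Y Z))"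

lemma step_from_admissible_base:
  assumes "Y \<in> V" "admissible_base Y zs B" "step Y X Z" "X \<in> set zs" "Z \<in> set zs"
  shows "5 * \<theta> < d X B Z \<or> 5 * \<theta> < d Z B X"
proof (cases "B = Y")
  case True
  then show ?thesis using assms(3) by (auto simp: step_def)
next
  case False
  have far: "5 * \<theta> < d X' B Z'" if "6 * \<theta> < d X' Y Z'" "X' \<in> set zs" "X' \<in> V - {Y}" "Z' \<in> V - {Y}" "Z' \<in> set zs" "X' \<noteq> Z'" for X' Z'
  proof -
    have "d X' Y B \<le> \<theta>"
      using between_excludes(1)[of B Y X'] False that assms(1,2) by (auto simp: admissible_base_def)
    moreover have "d X' Y Z' \<le> d X' Y B + d X' B Z'"
      using d_triangle[of X' Y B Z'] that assms(1,2) by (auto simp: admissible_base_def)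
    ultimately show ?thesis using that by linarith
  qed
  show ?thesis using far[of X Z] far[of Z X] assms by (auto simp: step_def)
qed

text \<open>
  Some element of a chain lies between the base and all other elements. Read the chain from left to
  right, and let \<open>W\<close> be the nearest element so far. Since its last visit to \<open>W\<close>, the chain has stayed
  behind \<open>W\<close>, and \<open>W\<close> is an admissible base for this shorter piece of the chain. By induction the piece
  does not drift as seen from \<open>W\<close>, so it is still far behind \<open>W\<close>. The next element is then behind \<open>W\<close> as
  well, unless it lies in front of \<open>W\<close> and takes over as the nearest element.
\<close>

lemma chain_has_nearest_vertex:
  assumes "Y \<in> V"
  shows "\<lbrakk>successively (step Y) zs; zs \<noteq> []; set zs \<subseteq> V - {Y}; admissible_base Y zs B\<rbrakk> \<Longrightarrow>
    \<exists>W\<in>set zs. \<forall>Z\<in>set zs. Z = W \<or> 2 * \<theta> < d W B Z"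
proof (induction "length zs" arbitrary: zs B rule: less_induct)
  case less
  have drift: "d B' X Z \<le> 2 * \<theta>"
    if ws: "length ws < length zs" "successively (step Y) ws" "set ws \<subseteq> V - {Y}" "admissible_base Y ws B'"
      "X \<in> set ws" "Z \<in> set ws" for ws B' X Z
  proof -
    have "ws \<noteq> []" using ws by auto
    then obtain W where W: "W \<in> set ws" "\<And>Z. Z \<in> set ws \<Longrightarrow> Z = W \<or> 2 * \<theta> < d W B' Z"
      using less.hyps[OF ws(1,2) _ ws(3,4)] by auto
    have B': "B' \<in> V" "B' \<notin> set ws" using ws by (auto simp: admissible_base_def)
    have near: "d B' W Z \<le> \<theta>" if "Z \<in> set ws" for Z
    proof (cases "Z = W")
      case True
      then show ?thesis using d_refl[of B' W] B' W(1) \<open>set ws \<subseteq> V - {Y}\<close> by auto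
    next
      case False
      then have "\<theta> < d W B' Z" using W(2)[OF that] by auto
      then show ?thesis
        using between_excludes(2)[of W B' Z] False B' W(1) that \<open>set ws \<subseteq> V - {Y}\<close> by auto
    qed
    have "d B' X Z \<le> d B' X W + d B' W Z"
      using d_triangle[of B' X W Z] B' W(1) ws by auto
    also have "d B' X W = d B' W X" by (rule d_sym)
    finally show ?thesis using near[of X] near[of Z] ws by linarith
  qed
  obtain ys z where zs: "zs = ys @ [z]" using less.prems(2) by (metis rev_exhaust)
  show ?case
  proof (cases "ys = []")
    case True
    then show ?thesis using zs by auto
  next
    case False
    have ys: "successively (step Y) ys" "step Y (last ys) z"
      using less.prems(1) False by (auto simp: zs successively_append_iff)
    have ysV: "set ys \<subseteq> V - {Y}" "z \<in> V" "z \<noteq> Y" using less.prems(3) by (auto simp: zs)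
    have B: "B \<in> V" "B \<notin> set ys" "B \<noteq> z" "admissible_base Y ys B"
      using less.prems(4) by (auto simp: zs admissible_base_def)
    obtain W where W: "W \<in> set ys" "\<And>Z. Z \<in> set ys \<Longrightarrow> Z = W \<or> 2 * \<theta> < d W B Z"
      using less.hyps[of ys B] ys(1) False ysV(1) B(4) by (auto simp: zs)
    have WV: "W \<in> V" "W \<noteq> Y" "W \<noteq> B" using W(1) ysV B by auto
    \<comment> \<open>The case in which the next element lies in front of \<open>W\<close>.\<close>
    have new: ?thesis if zW: "3 * \<theta> < d z B W" "z \<noteq> W"
    proof (intro bexI[of _ z] ballI)
      fix Z assume "Z \<in> set zs"
      then consider "Z = z" | "Z = W" | "Z \<noteq> z" "Z \<noteq> W" "Z \<in> set ys" "2 * \<theta> < d W B Z"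
        using W by (auto simp: zs)
      then show "Z = z \<or> 2 * \<theta> < d z B Z"
      proof cases
        case 3
        have ZV: "Z \<in> V" "Z \<noteq> B" using 3 ysV B by auto
        have "d W B z \<le> \<theta>" using between_excludes(1)[of z B W] zW WV ysV B by auto
        moreover have "d W B Z \<le> d W B z + d W z Z"
          using d_triangle[of W B z Z] WV ZV 3 ysV B zW by auto
        ultimately have "\<theta> < d W z Z" using 3 by linarith
        then have "d z W Z \<le> \<theta>"
          using between_excludes(2)[of W z Z] WV ZV 3 ysV B zW by auto
        moreover have "d z B W \<le> d z B Z + d z Z W"
          using d_triangle[of z B Z W] WV ZV 3 ysV B zW by auto
        ultimately show ?thesis using zW d_sym[of z W Z] by linarith
      qed (use zW in auto)
    qed (simp add: zs)
    \<comment> \<open>The case in which the next element lies behind \<open>W\<close>.\<close>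
    have old: ?thesis if "z = W \<or> 2 * \<theta> < d W B z"
      using that W by (intro bexI[of _ W]) (auto simp: zs)
    have adm: "admissible_base Y zs B" by fact
    obtain ys1 ys2 where ys12: "ys = ys1 @ W # ys2" "W \<notin> set ys2"
      using W(1) by (metis split_list_last)
    show ?thesis
    proof (cases "z = W")
      case True
      then show ?thesis using old by simp
    next
      case zW: False
      show ?thesis
      proof (cases "ys2 = []")
        case True
        have "5 * \<theta> < d W B z \<or> 5 * \<theta> < d z B W"
          using step_from_admissible_base[OF assms adm, of W z] ys(2) True ys12 by (simp add: zs)
        then show ?thesis using new old zW by fastforce
      next
        case ne: False
        \<comment> \<open>The piece \<open>ys2\<close> after the last visit to \<open>W\<close> has base \<open>W\<close>.\<close>
        have s2: "successively (step Y) ys2" "step Y W (hd ys2)"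
          using ys(1) ne by (auto simp: ys12 successively_append_iff successively_Cons)
        have "\<theta> < d W Y Z" if "Z \<in> set ys2" for Z
        proof -
          have Z: "Z \<in> V" "Z \<noteq> Y" "Z \<noteq> W" "Z \<noteq> B" "2 * \<theta> < d W B Z"
            using that ysV ys12 W(2)[of Z] B by auto
          show ?thesis
          proof (cases "B = Y")
            case True then show ?thesis using Z by auto
          next
            case False
            then have "\<theta> < d B Y W" using B(4) W(1) by (auto simp: admissible_base_def)
            then have "d W Y B \<le> \<theta>"
              using between_excludes(1)[of B Y W] assms WV B False by auto
            moreover have "d W B Z \<le> d W B Y + d W Y Z"
              using d_triangle[of W B Y Z] WV B Z assms by auto
            ultimately show ?thesis using Z d_sym[of W B Y] by linarith
          qed
        qed
        then have admW: "admissible_base Y ys2 W" using WV ys12 by (auto simp: admissible_base_def)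
        let ?u = "hd ys2" and ?y = "last ys"
        have u: "?u \<in> set ys2" "?u \<in> V" "?u \<noteq> W" "?u \<noteq> B" "?y \<in> set ys2" "?y \<in> V" "?y \<noteq> W" "?y \<noteq> B"
          and uW: "2 * \<theta> < d W B ?u"
          using ne ysV ys12 B W(2)[of ?u] by (auto dest: last_in_set hd_in_set)
        have "5 * \<theta> < d W B ?u \<or> 5 * \<theta> < d ?u B W"
          using step_from_admissible_base[OF assms adm s2(2)] u ys12 by (simp add: zs)
        moreover have "d ?u B W \<le> \<theta>"
          using between_excludes(1)[of W B ?u] WV B u uW by auto
        ultimately have "5 * \<theta> < d W B ?u" by linarith
        moreover have "d W ?u ?y \<le> 2 * \<theta>"
          using drift[of ys2 W ?u ?y] s2(1) admW u ysV ys12 by (auto simp: zs)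
        moreover have "d W B ?u \<le> d W B ?y + d W ?y ?u"
          using d_triangle[of W B ?y ?u] WV B u by auto
        ultimately have Wy: "3 * \<theta> < d W B ?y" using d_sym[of W ?y ?u] by linarith
        have yz: "?y \<noteq> z" using ys(2) by (simp add: step_def)
        have tri: "d W B ?y \<le> d W B z + d W z ?y"
          using d_triangle[of W B z ?y] WV B u ysV zW by auto
        have "5 * \<theta> < d ?y B z \<or> 5 * \<theta> < d z B ?y"
          using step_from_admissible_base[OF assms adm ys(2)] u ys12 by (simp add: zs)
        then show ?thesis
        proof
          assume yBz: "5 * \<theta> < d ?y B z"
          have "d ?y B W \<le> \<theta>" using between_excludes(1)[of W B ?y] WV B u Wy by auto
          moreover have "d ?y B z \<le> d ?y B W + d ?y W z"
            using d_triangle[of ?y B W z] WV B u ysV yz by auto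
          ultimately have "\<theta> < d ?y W z" using yBz by linarith
          then have "d W ?y z \<le> \<theta>" using between_excludes(2)[of ?y W z] WV u ysV yz zW by auto
          then have "2 * \<theta> < d W B z" using tri Wy d_sym[of W z ?y] by linarith
          then show ?thesis using old by auto
        next
          assume zBy: "5 * \<theta> < d z B ?y"
          show ?thesis
          proof (cases "d z W ?y \<le> \<theta>")
            case True
            moreover have "d z B ?y \<le> d z B W + d z W ?y"
              using d_triangle[of z B W ?y] WV B u ysV yz zW by auto
            ultimately have "3 * \<theta> < d z B W" using zBy by linarith
            then show ?thesis using new zW by auto
          next
            case False
            then have "d W z ?y \<le> \<theta>" using between_excludes(2)[of z W ?y] WV u ysV yz zW by auto
            then have "2 * \<theta> < d W B z" using tri Wy by linarith
            then show ?thesis using old by auto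
          qed
        qed
      qed
    qed
  qed
qed

text \<open>
  The nearest element hides the whole chain from \<open>Y\<close>. The bound does not depend on the length of the
  chain.
\<close>

lemma no_drift:
  assumes "Y \<in> V" "successively (step Y) zs" "set zs \<subseteq> V - {Y}" "X \<in> set zs" "Z \<in> set zs"
  shows "d Y X Z \<le> 2 * \<theta>"
proof -
  have "zs \<noteq> []" using assms by auto
  moreover have "admissible_base Y zs Y" using assms by (auto simp: admissible_base_def)
  ultimately obtain W where W: "W \<in> set zs" "\<And>Z. Z \<in> set zs \<Longrightarrow> Z = W \<or> 2 * \<theta> < d W Y Z"
    using chain_has_nearest_vertex[OF assms(1,2) _ assms(3)] by blast
  have near: "d Y W Z \<le> \<theta>" if "Z \<in> set zs" for Z
  proof (cases "Z = W")
    case True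
    then show ?thesis using d_refl[of Y W] W(1) assms(1,3) by auto
  next
    case False
    then have "\<theta> < d W Y Z" using W(2)[OF that] by auto
    then show ?thesis using between_excludes(2)[of W Y Z] False W(1) that assms(1,3) by auto
  qed
  have "d Y X Z \<le> d Y X W + d Y W Z" using d_triangle[of Y X W Z] W(1) assms by auto
  then show ?thesis using near[of X] near[of Z] assms(4,5) d_sym[of Y X W] by linarith
qed

section \<open>Rigid distances\<close>

definition linked :: "'v \<Rightarrow> 'v \<Rightarrow> 'v \<Rightarrow> bool" where
  "linked Y = (step Y)\<^sup>*\<^sup>*"

lemma linked_refl [simp]: "linked Y X X" by (simp add: linked_def)

lemma linked_trans: "linked Y X Z \<Longrightarrow> linked Y Z W \<Longrightarrow> linked Y X W"
  by (simp add: linked_def)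

lemma linked_sym: "linked Y X Z \<Longrightarrow> linked Y Z X"
  unfolding linked_def by (metis step_sym sympD sympI symp_rtranclp)

lemma linked_in: "linked Y X Z \<Longrightarrow> X \<in> V - {Y} \<Longrightarrow> Z \<in> V - {Y}"
  unfolding linked_def by (induction rule: rtranclp_induct) (auto simp: step_def)

lemma linked_chain:
  assumes "linked Y X Z" "X \<in> V - {Y}"
  shows "\<exists>zs. successively (step Y) zs \<and> set zs \<subseteq> V - {Y} \<and> X \<in> set zs \<and> zs \<noteq> [] \<and> last zs = Z"
  using assms unfolding linked_def
proof (induction rule: rtranclp_induct)
  case base
  then show ?case by (intro exI[of _ "[X]"]) auto
next
  case (step Z W)
  then obtain zs where "successively (projection_system.step V d \<theta> Y) zs" "set zs \<subseteq> V - {Y}" "X \<in> set zs" "zs \<noteq> []" "last zs = Z"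
    by auto
  then show ?case using step
    by (intro exI[of _ "zs @ [W]"]) (auto simp: successively_append_iff step_def)
qed

lemma linked_close:
  assumes "Y \<in> V" "linked Y X Z" "X \<in> V - {Y}"
  shows "d Y X Z \<le> 2 * \<theta>"
proof -
  obtain zs where "successively (step Y) zs" "set zs \<subseteq> V - {Y}" "X \<in> set zs" "zs \<noteq> []" "last zs = Z"
    using linked_chain[OF assms(2,3)] by auto
  then show ?thesis using no_drift[OF assms(1), of zs X Z] by auto
qed

definition rigid_values :: "'v \<Rightarrow> 'v \<Rightarrow> 'v \<Rightarrow> nat set" where
  "rigid_values Y X Z = {d Y X' Z' | X' Z'. linked Y X X' \<and> linked Y Z Z'}"

text \<open>
  The view from \<open>Y\<close> becomes exactly constant on linked elements when their projections are taken
  together. The absence of drift makes this a bounded change of \<open>d\<close>.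
\<close>

definition rigid :: "'v \<Rightarrow> 'v \<Rightarrow> 'v \<Rightarrow> nat" where
  "rigid Y X Z = Max (rigid_values Y X Z)"

lemma rigid_values_bounded:
  assumes "Y \<in> V" "X \<in> V - {Y}" "Z \<in> V - {Y}" "n \<in> rigid_values Y X Z"
  shows "n \<le> d Y X Z + 4 * \<theta>"
proof -
  obtain X' Z' where n: "n = d Y X' Z'" "linked Y X X'" "linked Y Z Z'"
    using assms(4) by (auto simp: rigid_values_def)
  have in': "X' \<in> V - {Y}" "Z' \<in> V - {Y}" using linked_in n assms by blast+
  have "d Y X' Z' \<le> d Y X' X + d Y X Z'" "d Y X Z' \<le> d Y X Z + d Y Z Z'"
    using d_triangle assms in' by blast+
  moreover have "d Y X X' \<le> 2 * \<theta>" "d Y Z Z' \<le> 2 * \<theta>" using linked_close n assms by blast+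
  ultimately show ?thesis using n d_sym[of Y X X'] by linarith
qed

lemma rigid_values_finite:
  assumes "Y \<in> V" "X \<in> V - {Y}" "Z \<in> V - {Y}"
  shows "finite (rigid_values Y X Z)" "rigid_values Y X Z \<noteq> {}"
proof -
  have "rigid_values Y X Z \<subseteq> {..d Y X Z + 4 * \<theta>}"
    using rigid_values_bounded[OF assms] by auto
  then show "finite (rigid_values Y X Z)" using finite_subset by blast
  have "d Y X Z \<in> rigid_values Y X Z"
    unfolding rigid_values_def using linked_refl by blast
  then show "rigid_values Y X Z \<noteq> {}" by auto
qed

lemma rigid_upper:
  assumes "Y \<in> V" "X \<in> V - {Y}" "Z \<in> V - {Y}"
  shows "rigid Y X Z \<le> d Y X Z + 4 * \<theta>"
  unfolding rigid_def
  using rigid_values_bounded[OF assms] Max_in[OF rigid_values_finite[OF assms]] by auto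

lemma rigid_ge:
  assumes "Y \<in> V" "X \<in> V - {Y}" "Z \<in> V - {Y}" "linked Y X X'" "linked Y Z Z'"
  shows "d Y X' Z' \<le> rigid Y X Z"
  unfolding rigid_def
  by (rule Max_ge[OF rigid_values_finite(1)[OF assms(1-3)]]) (use assms in \<open>auto simp: rigid_values_def\<close>)

lemma rigid_attained:
  assumes "Y \<in> V" "X \<in> V - {Y}" "Z \<in> V - {Y}"
  obtains X' Z' where "linked Y X X'" "linked Y Z Z'" "rigid Y X Z = d Y X' Z'"
  using Max_in[OF rigid_values_finite[OF assms]] unfolding rigid_def rigid_values_def by auto

lemma rigid_linked:
  assumes "linked Y X X'"
  shows "rigid Y X Z = rigid Y X' Z"
proof -
  have "linked Y X W \<longleftrightarrow> linked Y X' W" for W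
    using assms linked_sym linked_trans by blast
  then show ?thesis by (simp add: rigid_def rigid_values_def)
qed

lemma rigid_sym: "rigid Y X Z = rigid Y Z X"
proof -
  have "rigid_values Y X Z \<subseteq> rigid_values Y Z X" for X Z
    unfolding rigid_values_def using d_sym[of Y] by blast
  then have "rigid_values Y X Z = rigid_values Y Z X" by blast
  then show ?thesis by (simp add: rigid_def)
qed

lemma rigid_triangle:
  assumes "Y \<in> V" "X \<in> V - {Y}" "Z \<in> V - {Y}" "W \<in> V - {Y}"
  shows "rigid Y X W \<le> rigid Y X Z + rigid Y Z W"
proof -
  obtain X' W' where XW: "linked Y X X'" "linked Y W W'" "rigid Y X W = d Y X' W'"
    using rigid_attained[OF assms(1,2,4)] by blast
  have "d Y X' W' \<le> d Y X' Z + d Y Z W'"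
    using d_triangle assms linked_in XW by blast
  also have "\<dots> \<le> rigid Y X Z + rigid Y Z W"
    using rigid_ge[OF assms(1,2,3) XW(1) linked_refl] rigid_ge[OF assms(1,3,4) linked_refl XW(2)]
    by linarith
  finally show ?thesis using XW by simp
qed

text \<open>
  The assumption makes \<open>X\<close> and \<open>W\<close> one step apart as seen from \<open>Y\<close>. That the conclusion is an equation,
  and not an estimate up to \<open>\<theta>\<close>, allows it to be used any number of times along a path.
\<close>

lemma rigid_transparent:
  assumes "Y \<in> V" "W \<in> V - {Y}" "X \<in> V - {Y, W}" "10 * \<theta> < rigid W Y X"
  shows "rigid Y X Z = rigid Y W Z"
proof -
  have "6 * \<theta> < d W Y X" using rigid_upper[of W Y X] assms by auto
  then have "step Y X W" using assms by (auto simp: step_def)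
  then show ?thesis using rigid_linked unfolding linked_def by blast
qed

lemma step_image:
  assumes "bij_betw f V V" "\<And>Y X Z. \<lbrakk>Y \<in> V; X \<in> V; Z \<in> V\<rbrakk> \<Longrightarrow> d (f Y) (f X) (f Z) = d Y X Z"
    and "Y \<in> V" "step Y X Z"
  shows "step (f Y) (f X) (f Z)"
  using assms bij_betwE[OF assms(1)] bij_betw_imp_inj_on[OF assms(1)]
  unfolding step_def by (simp add: inj_on_eq_iff)

lemma linked_image:
  assumes "bij_betw f V V" "\<And>Y X Z. \<lbrakk>Y \<in> V; X \<in> V; Z \<in> V\<rbrakk> \<Longrightarrow> d (f Y) (f X) (f Z) = d Y X Z"
    and "Y \<in> V" "linked Y X Z"
  shows "linked (f Y) (f X) (f Z)"
  using assms(4) unfolding linked_def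
proof (induction rule: rtranclp_induct)
  case (step Z W)
  then show ?case using step_image[OF assms(1,2) assms(3) step(2)]
    by (meson rtranclp.rtrancl_into_rtrancl)
qed simp

lemma rigid_image_le:
  assumes "bij_betw f V V" "\<And>Y X Z. \<lbrakk>Y \<in> V; X \<in> V; Z \<in> V\<rbrakk> \<Longrightarrow> d (f Y) (f X) (f Z) = d Y X Z"
    and "Y \<in> V" "X \<in> V - {Y}" "Z \<in> V - {Y}"
  shows "rigid Y X Z \<le> rigid (f Y) (f X) (f Z)"
proof -
  obtain X' Z' where XZ: "linked Y X X'" "linked Y Z Z'" "rigid Y X Z = d Y X' Z'"
    using rigid_attained[OF assms(3,4,5)] by blast
  have "X' \<in> V" "Z' \<in> V" using linked_in XZ assms by blast+
  moreover have "f Y \<in> V" "f X \<in> V - {f Y}" "f Z \<in> V - {f Y}"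
    using assms bij_betwE[OF assms(1)] bij_betw_imp_inj_on[OF assms(1)] by (auto simp: inj_on_eq_iff)
  ultimately show ?thesis
    using XZ assms(2)[of Y X' Z'] assms(3) rigid_ge[of "f Y" "f X" "f Z" "f X'" "f Z'"]
      linked_image[OF assms(1,2,3) XZ(1)] linked_image[OF assms(1,2,3) XZ(2)] by simp
qed

text \<open>
  The passage from \<open>d\<close> to \<open>rigid\<close> involves no choices, so it respects all symmetries of \<open>d\<close>.
\<close>

lemma rigid_image:
  assumes "bij_betw f V V" "\<And>Y X Z. \<lbrakk>Y \<in> V; X \<in> V; Z \<in> V\<rbrakk> \<Longrightarrow> d (f Y) (f X) (f Z) = d Y X Z"
    and "Y \<in> V" "X \<in> V - {Y}" "Z \<in> V - {Y}"
  shows "rigid (f Y) (f X) (f Z) = rigid Y X Z"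
proof (rule antisym)
  let ?g = "the_inv_into V f"
  have g: "bij_betw ?g V V" using assms(1) by (rule bij_betw_the_inv_into)
  have fg: "f (?g X) = X" "?g X \<in> V" if "X \<in> V" for X
    using that assms(1) g f_the_inv_into_f_bij_betw bij_betwE by metis+
  have gf: "?g (f X) = X" if "X \<in> V" for X
    using that assms(1) by (simp add: bij_betw_imp_inj_on the_inv_into_f_f)
  have gd: "d (?g Y) (?g X) (?g Z) = d Y X Z" if "Y \<in> V" "X \<in> V" "Z \<in> V" for X Y Z
    using assms(2)[of "?g Y" "?g X" "?g Z"] fg that by simp
  have "f Y \<in> V" "f X \<in> V - {f Y}" "f Z \<in> V - {f Y}"
    using assms bij_betwE[OF assms(1)] bij_betw_imp_inj_on[OF assms(1)] by (auto simp: inj_on_eq_iff)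
  from rigid_image_le[OF g gd this] show "rigid (f Y) (f X) (f Z) \<le> rigid Y X Z"
    using gf assms by simp
qed (rule rigid_image_le[OF assms])

end

section \<open>The projection complex\<close>

text \<open>
  The strong projection axioms of Bestvina, Bromberg, Fujiwara and Sisto. By \<open>transparent\<close>, an element
  \<open>W\<close> between \<open>Y\<close> and \<open>X\<close> has exactly the same projection to \<open>Y\<close> as \<open>X\<close>.
\<close>

locale rigid_projection_system =
  fixes V :: "'v set" and d :: "'v \<Rightarrow> 'v \<Rightarrow> 'v \<Rightarrow> nat" and \<theta> K :: nat
  assumes d_sym: "d Y X Z = d Y Z X"
    and d_triangle: "\<lbrakk>Y \<in> V; X \<in> V - {Y}; Z \<in> V - {Y}; W \<in> V - {Y}\<rbrakk> \<Longrightarrow> d Y X W \<le> d Y X Z + d Y Z W"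
    and d_refl: "\<lbrakk>Y \<in> V; X \<in> V - {Y}\<rbrakk> \<Longrightarrow> d Y X X \<le> \<theta>"
    and transparent: "\<lbrakk>Y \<in> V; W \<in> V - {Y}; X \<in> V - {Y, W}; \<theta> < d W Y X\<rbrakk> \<Longrightarrow> d Y X Z = d Y W Z"
    and finite_between: "\<lbrakk>X \<in> V; Z \<in> V\<rbrakk> \<Longrightarrow> finite {Y \<in> V - {X, Z}. K < d Y X Z}"
    and K_large: "2 * \<theta> \<le> K"
begin

definition between :: "'v \<Rightarrow> 'v \<Rightarrow> 'v set" where
  "between X Z = {Y \<in> V - {X, Z}. K < d Y X Z}"

definition adj :: "'v \<Rightarrow> 'v \<Rightarrow> bool" where
  "adj X Z \<longleftrightarrow> X \<in> V \<and> Z \<in> V \<and> X \<noteq> Z \<and> between X Z = {}"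

lemma transparent2:
  assumes "Y \<in> V" "W \<in> V - {Y}" "X \<in> V - {Y, W}" "\<theta> < d W Y X"
  shows "d Y X Z = d Y W Z" "d X Y Z = d X W Z"
  using transparent[of Y W X Z] transparent[of X W Y Z] assms d_sym[of W Y X] by auto

lemma between_sym: "between X Z = between Z X"
  by (auto simp: between_def d_sym[of _ X Z])

lemma between_fin: "\<lbrakk>X \<in> V; Z \<in> V\<rbrakk> \<Longrightarrow> finite (between X Z)"
  unfolding between_def by (rule finite_between)

lemma between_self [simp]: "X \<in> V \<Longrightarrow> between X X = {}"
  using d_refl K_large by (force simp: between_def)

lemma between_view:
  assumes "Y \<in> between X Z" "X \<in> V" "Z \<in> V"
  shows "X \<noteq> Z" "d X Z W = d X Y W" "d Z X W = d Z Y W"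
proof -
  show "X \<noteq> Z" using assms by auto
  then show "d X Z W = d X Y W" "d Z X W = d Z Y W"
    using transparent2[of X Y Z W] assms K_large by (auto simp: between_def)
qed

text \<open>
  The elements between \<open>X\<close> and \<open>Z\<close> are linearly ordered. The two alternatives are the two possible
  orders of \<open>Y\<close> and \<open>W\<close> on the way from \<open>X\<close> to \<open>Z\<close>.
\<close>

lemma between_linear:
  assumes "Y \<in> between X Z" "W \<in> between X Z" "Y \<noteq> W" "X \<in> V" "Z \<in> V"
  shows "Y \<in> between X W \<and> W \<in> between Y Z \<or> Y \<in> between W Z \<and> W \<in> between X Y"
proof -
  have *: "Y \<in> between X W \<and> W \<in> between Y Z"
    if YW: "Y \<in> between X Z" "W \<in> between X Z" "Y \<noteq> W" and "\<theta> < d Y X W" "X \<in> V" "Z \<in> V" for X Z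
  proof -
    have 1: "d W X Z = d W Y Z"
      using transparent2(2)[of X Y W Z] that by (auto simp: between_def)
    then have W: "W \<in> between Y Z" using YW by (auto simp: between_def)
    then have "d Y Z X = d Y W X" using between_view(2)[of W Y Z X] YW that by (auto simp: between_def)
    then show ?thesis using YW W d_sym[of Y Z X] d_sym[of Y W X] by (auto simp: between_def)
  qed
  have "d Y X Z \<le> d Y X W + d Y W Z"
    using d_triangle[of Y X W Z] assms by (auto simp: between_def)
  then consider "\<theta> < d Y X W" | "\<theta> < d Y W Z"
    using assms(1) K_large unfolding between_def by fastforce
  then show ?thesis
  proof cases
    case 1
    then show ?thesis using *[of X Z] assms by blast
  next
    case 2
    then show ?thesis using *[of Z X] assms between_sym d_sym[of Y W Z] by metis
  qed
qed

lemma between_antisym: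
  assumes "Y \<in> between X W" "X \<in> V" "W \<in> V"
  shows "W \<notin> between X Y"
proof
  assume "W \<in> between X Y"
  then have "d Y X W = d Y W W" using between_view(3)[of W X Y W] assms by (auto simp: between_def)
  then show False using assms d_refl[of Y W] K_large by (auto simp: between_def)
qed

lemma between_mono:
  assumes "Y \<in> between X Z" "X \<in> V" "Z \<in> V"
  shows "between X Y \<subseteq> between X Z"
proof
  fix W assume W: "W \<in> between X Y"
  then have "W \<noteq> Z" using between_antisym[of Y X Z] assms by auto
  have "d Y X Z = d Y W Z" using between_view(3)[of W X Y Z] W assms by (auto simp: between_def)
  then have "Y \<in> between W Z" using assms W by (auto simp: between_def)
  then have "d W Z X = d W Y X" using between_view(2)[of Y W Z X] W assms by (auto simp: between_def)
  then show "W \<in> between X Z"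
    using W \<open>W \<noteq> Z\<close> d_sym[of W Z X] d_sym[of W Y X] by (auto simp: between_def)
qed

lemma between_mono2:
  assumes "Y \<in> between X Z" "X \<in> V" "Z \<in> V"
  shows "between Y Z \<subseteq> between X Z"
  using between_mono[of Y Z X] assms between_sym by metis

lemma between_disjoint:
  assumes "Y \<in> between X Z" "X \<in> V" "Z \<in> V"
  shows "between X Y \<inter> between Y Z = {}"
proof -
  have False if W: "W \<in> between X Y" "W \<in> between Y Z" for W
  proof -
    have "Y \<in> V" using assms by (auto simp: between_def)
    then have "d Y X Z = d Y W Z" "d Y Z Z = d Y W Z"
      using between_view(3)[of W X Y Z] between_view(2)[of W Y Z Z] W assms by auto
    then show False using d_refl[of Y Z] assms K_large by (auto simp: between_def)
  qed
  then show ?thesis by auto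
qed

lemma between_card:
  assumes "Y \<in> between X Z" "X \<in> V" "Z \<in> V"
  shows "card (between X Y) + 1 + card (between Y Z) \<le> card (between X Z)"
proof -
  have YV: "Y \<in> V" using assms by (auto simp: between_def)
  have "card (between X Y) + card (between Y Z) = card (between X Y \<union> between Y Z)"
    using between_disjoint[OF assms] between_fin assms YV by (simp add: card_Un_disjoint)
  moreover have "card (between X Y \<union> between Y Z) < card (between X Z)"
  proof (rule psubset_card_mono)
    show "finite (between X Z)" using between_fin assms by blast
    have "Y \<notin> between X Y \<union> between Y Z" by (auto simp: between_def)
    then show "between X Y \<union> between Y Z \<subset> between X Z"
      using between_mono[OF assms] between_mono2[OF assms] assms(1) by auto
  qed
  ultimately show ?thesis by linarith
qed

text \<open>
  The elements between \<open>X\<close> and \<open>Z\<close>, taken in their order, form an edge path from \<open>X\<close> to \<open>Z\<close>.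
\<close>

lemma between_path:
  assumes "X \<in> V" "Z \<in> V"
  shows "\<exists>n \<le> card (between X Z) + 1. (adj ^^ n) X Z"
  using assms
proof (induction "card (between X Z)" arbitrary: X Z rule: less_induct)
  case less
  consider "X = Z" | "X \<noteq> Z" "between X Z = {}" | Y where "Y \<in> between X Z" by auto
  then show ?case
  proof cases
    case 1
    then show ?thesis by (intro exI[of _ 0]) auto
  next
    case 2
    then have "adj X Z" using less by (simp add: adj_def)
    then show ?thesis by (intro exI[of _ 1]) auto
  next
    case (3 Y)
    have YV: "Y \<in> V" using 3 by (auto simp: between_def)
    have c: "card (between X Y) + 1 + card (between Y Z) \<le> card (between X Z)"
      using between_card 3 less by blast
    obtain n where n: "n \<le> card (between X Y) + 1" "(adj ^^ n) X Y"
      using less.hyps[of X Y] less.prems YV c by auto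
    obtain m where m: "m \<le> card (between Y Z) + 1" "(adj ^^ m) Y Z"
      using less.hyps[of Y Z] less.prems YV c by auto
    have "(adj ^^ (n + m)) X Z" using n m by (auto simp: relpowp_add)
    then show ?thesis using n m c by (intro exI[of _ "n + m"]) auto
  qed
qed

sublocale connected_graph V adj
proof
  show "x \<in> V \<and> y \<in> V \<and> x \<noteq> y" if "adj x y" for x y using that by (auto simp: adj_def)
  show "adj y x" if "adj x y" for x y using that between_sym by (auto simp: adj_def)
  show "adj\<^sup>*\<^sup>* x y" if "x \<in> V" "y \<in> V" for x y
    using between_path[OF that] relpowp_imp_rtranclp by metis
qed

lemma penultimate:
  assumes "Y \<in> V" "X \<in> V" "2 \<le> gd X Y"
  obtains W where "W \<in> between X Y" "gd W Y = 1"
proof -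
  have ne: "between X Y \<noteq> {}"
    using assms gd_adj[of X Y] by (cases "X = Y") (auto simp: adj_def)
  \<comment> \<open>The last element before \<open>Y\<close> has the most elements between itself and \<open>X\<close>.\<close>
  then obtain U where "U \<in> between X Y" by blast
  moreover have "\<forall>U. U \<in> between X Y \<longrightarrow> card (between X U) < Suc (card (between X Y))"
    using between_card[of _ X Y] assms by fastforce
  ultimately obtain W where W: "W \<in> between X Y" "\<And>U. U \<in> between X Y \<Longrightarrow> card (between X U) \<le> card (between X W)"
    using ex_has_greatest_nat[of "\<lambda>U. U \<in> between X Y" U "\<lambda>U. card (between X U)" "Suc (card (between X Y))"]
    by (metis less_imp_le)
  have WV: "W \<in> V" "W \<noteq> Y" using W by (auto simp: between_def)
  have "between W Y = {}"
  proof (rule ccontr)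
    assume "between W Y \<noteq> {}"
    then obtain U where U: "U \<in> between W Y" by auto
    then have U': "U \<in> between X Y" using between_mono2[OF W(1)] assms by auto
    have "U \<noteq> W" using U by (auto simp: between_def)
    then have "W \<in> between X U"
      using between_linear[OF W(1) U'] between_antisym[of U Y W] U between_sym WV assms by metis
    then have "card (between X W) < card (between X U)"
      using between_card[of W X U] U' assms by (auto simp: between_def)
    then show False using W(2)[OF U'] by linarith
  qed
  then have "adj W Y" using WV assms by (auto simp: adj_def)
  then show ?thesis using that W gd_adj by blast
qed


text \<open>
  The path through the elements between \<open>X\<close> and \<open>Z\<close> cannot skip any distance from \<open>X\<close>. The witness is
  its first element that is at least \<open>t\<close> away from \<open>X\<close>.
\<close>

lemma between_at_distance:
  assumes "X \<in> V" "Z \<in> V" "t \<le> gd X Z"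
  obtains Y where "Y \<in> insert Z (between X Z)" "t \<le> gd X Y" "gd X Y \<le> t + 1"
proof -
  let ?P = "\<lambda>Y. Y \<in> insert Z (between X Z) \<and> t \<le> gd X Y"
  obtain Y where Y: "?P Y" "\<And>U. ?P U \<Longrightarrow> card (between X Y) \<le> card (between X U)"
    using ex_has_least_nat[of ?P Z "\<lambda>U. card (between X U)"] assms by auto
  have YV: "Y \<in> V" using Y assms by (auto simp: between_def)
  have "gd X Y \<le> t + 1"
  proof (cases "2 \<le> gd X Y")
    case True
    then obtain W where W: "W \<in> between X Y" "gd W Y = 1" using penultimate YV assms by metis
    have WV: "W \<in> V" using W by (auto simp: between_def)
    have "card (between X W) < card (between X Y)" using between_card W YV assms by fastforce
    then have "\<not> ?P W" using Y(2)[of W] by linarith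
    moreover have "W \<in> between X Z" using W Y(1) between_mono[of Y X Z] assms by auto
    ultimately have "gd X W < t" by auto
    then show ?thesis using gd_triangle[of X W Y] assms WV YV W by linarith
  qed auto
  then show ?thesis using that Y by blast
qed

text \<open>
  A vertex at distance three or more from \<open>X\<close> does not notice a step from \<open>X\<close> to a neighbour. Between \<open>Y\<close>
  and \<open>X\<close> there are elements \<open>W'\<close> and \<open>W\<close>, in this order. If \<open>X'\<close> were not behind \<open>W'\<close> as well, then \<open>W\<close>
  would lie between \<open>X\<close> and \<open>X'\<close>.
\<close>

lemma far_view:
  assumes "adj X X'" "Y \<in> V" "3 \<le> gd X Y"
  shows "d Y X U = d Y X' U"
proof -
  have XV: "X \<in> V" "X' \<in> V" using adj_in assms by blast+
  have dXY: "3 \<le> gd Y X" using gd_sym XV assms by simp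
  have "2 \<le> gd X' Y" using gd_triangle[of X X' Y] gd_adj[OF assms(1)] XV assms by linarith
  then have X'Y: "X' \<noteq> Y" by auto
  obtain W where W: "W \<in> between Y X" "gd W X = 1" using penultimate[of X Y] XV assms dXY by auto
  have WV: "W \<in> V" using W by (auto simp: between_def)
  have "2 \<le> gd Y W" using gd_triangle[of Y W X] W WV XV assms dXY by linarith
  then obtain W' where W': "W' \<in> between Y W" using penultimate[of W Y] WV assms by metis
  have W'V: "W' \<in> V" "W' \<noteq> Y" "W' \<noteq> W" using W' by (auto simp: between_def)
  have W'X: "W' \<in> between Y X" using between_mono[OF W(1)] W' assms XV by auto
  have Wb: "W \<in> between W' X"
    using between_linear[OF W'X W(1)] between_antisym[of W' Y W] W' W'V assms XV WV by blast
  have noW: "X' = W \<or> d W X X' \<le> K" using assms(1) WV W by (force simp: adj_def between_def)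
  have "X' \<noteq> W'"
  proof
    assume "X' = W'"
    then have "W \<in> between X X'" using Wb between_sym by auto
    then show False using assms(1) by (auto simp: adj_def)
  qed
  have "d W' W X' \<le> \<theta>"
  proof (cases "X' = W")
    case True
    then show ?thesis using d_refl[of W' W] W'V WV by auto
  next
    case False
    show ?thesis
    proof (rule ccontr)
      assume "\<not> ?thesis"
      then have "d W X' X = d W W' X"
        using transparent2(1)[of W W' X' X] W'V WV XV False \<open>X' \<noteq> W'\<close> by auto
      then show False using Wb noW False d_sym[of W X X'] by (auto simp: between_def)
    qed
  qed
  moreover have "d W' Y W \<le> d W' Y X' + d W' X' W"
    using d_triangle[of W' Y X' W] W'V WV XV assms \<open>X' \<noteq> W'\<close> by auto
  ultimately have "\<theta> < d W' Y X'"
    using W' K_large d_sym[of W' W X'] by (auto simp: between_def)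
  then have "d Y X' U = d Y W' U"
    using transparent2(1)[of Y W' X' U] W'V XV assms \<open>X' \<noteq> W'\<close> X'Y by auto
  moreover have "d Y X U = d Y W' U" using between_view(2)[OF W'X] XV assms by auto
  ultimately show ?thesis by simp
qed

text \<open>
  By \<open>far_view\<close> the projection to \<open>Y\<close> stays the same along a path as long as the path keeps away from \<open>Y\<close>.
\<close>

lemma barrier:
  assumes "(adj ^^ n) X Z" "X \<in> V" "Y \<in> V" "d Y X U \<noteq> d Y Z U"
  obtains v m k where "(adj ^^ m) X v" "(adj ^^ k) v Z" "m + k = n" "gd v Y \<le> 2"
proof -
  have "\<exists>v m k. (adj ^^ m) X v \<and> (adj ^^ k) v Z \<and> m + k = n \<and> gd v Y \<le> 2"
    using assms(1,2,4)
  proof (induction n arbitrary: X)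
    case (Suc n)
    show ?case
    proof (cases "gd X Y \<le> 2")
      case True
      then show ?thesis using Suc.prems by (intro exI[of _ X] exI[of _ 0] exI[of _ "Suc n"]) auto
    next
      case False
      obtain X' where X': "adj X X'" "(adj ^^ n) X' Z" using Suc.prems(1) relpowp_Suc_D2 by metis
      then have "d Y X U = d Y X' U" using far_view assms False by auto
      then obtain v m k where v: "(adj ^^ m) X' v" "(adj ^^ k) v Z" "m + k = n" "gd v Y \<le> 2"
        using Suc.IH[OF X'(2)] Suc.prems adj_in X' by auto
      have "(adj ^^ Suc m) X v" using X'(1) v(1) relpowp_Suc_I2 by metis
      then show ?thesis using v by (intro exI[of _ v] exI[of _ "Suc m"] exI[of _ k]) auto
    qed
  qed auto
  then show ?thesis using that by blast
qed

lemma barrier_geodesic: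
  assumes "X \<in> V" "Z \<in> V" "Y \<in> V" "d Y X U \<noteq> d Y Z U"
  obtains v where "v \<in> V" "gd X v + gd v Z = gd X Z" "gd v Y \<le> 2"
proof -
  obtain v m k where v: "(adj ^^ m) X v" "(adj ^^ k) v Z" "m + k = gd X Z" "gd v Y \<le> 2"
    using barrier[OF gd_path assms(1,3,4)] assms by metis
  then have vV: "v \<in> V" using path_in assms by blast
  have "gd X v \<le> m" "gd v Z \<le> k" using v gd_le by blast+
  then show ?thesis using that v vV gd_triangle[of X v Z] assms by force
qed

lemma gate_two_sides:
  assumes "X \<in> V" "Z \<in> V" "p \<in> V" "Y \<in> between X Z"
  obtains v where "v \<in> V" "gd v Y \<le> 2" "gd X v + gd v p = gd X p \<or> gd p v + gd v Z = gd p Z"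
proof -
  have "d Y X Z \<noteq> d Y Z Z"
    using assms d_refl[of Y Z] K_large by (auto simp: between_def)
  then have "d Y X Z \<noteq> d Y p Z \<or> d Y p Z \<noteq> d Y Z Z" by auto
  moreover have "Y \<in> V" using assms by (auto simp: between_def)
  ultimately show ?thesis using barrier_geodesic[of X p Y Z] barrier_geodesic[of p Z Y Z] assms that
    by metis
qed

lemma gate:
  assumes "X \<in> V" "Z \<in> V" "Y \<in> between X Z"
  shows "gd X Y + gd Y Z \<le> gd X Z + 4"
proof -
  have YV: "Y \<in> V" using assms by (auto simp: between_def)
  obtain v where v: "v \<in> V" "gd v Y \<le> 2" "gd X v + gd v Z = gd X Z \<or> gd Z v + gd v Z = gd Z Z"
    using gate_two_sides[OF assms(1,2) assms(2,3)] by metis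
  show ?thesis
  proof (cases "gd X v + gd v Z = gd X Z")
    case True
    then show ?thesis
      using v gd_triangle[of X v Y] gd_triangle[of Y v Z] gd_sym[of v Y] assms YV by linarith
  next
    case False
    then have "gd v Z = 0" using v by auto
    then have "v = Z" using gd_eq_0 v assms by auto
    then show ?thesis
      using v gd_triangle[of X Z Y] gd_sym[of Z Y] assms YV by auto
  qed
qed

text \<open>
  Every vertex of the path through the elements between \<open>X\<close> and \<open>Z\<close> is close to a geodesic from \<open>X\<close> to \<open>p\<close>
  or to one from \<open>p\<close> to \<open>Z\<close>. Where it changes from the first to the second, these two geodesics come
  close to each other. As their concatenation is nearly geodesic, this happens near \<open>p\<close>.
\<close>

lemma near_geodesic_close_to_between:
  assumes "X \<in> V" "Z \<in> V" "p \<in> V" "gd X p + gd p Z \<le> gd X Z + c"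
  obtains s where "s \<in> insert X (insert Z (between X Z))" "gd s p \<le> 7 + c"
proof -
  let ?front = "\<lambda>s. \<exists>v\<in>V. gd v s \<le> 2 \<and> gd X v + gd v p = gd X p"
  let ?back = "\<lambda>s. \<exists>v\<in>V. gd v s \<le> 2 \<and> gd p v + gd v Z = gd p Z"
  let ?P = "\<lambda>s. s \<in> insert Z (between X Z) \<and> ?back s"
  have "?P Z" using assms by (auto intro!: bexI[of _ Z])
  \<comment> \<open>The first element that is close to the second geodesic.\<close>
  then obtain s' where s': "?P s'" "\<And>u. ?P u \<Longrightarrow> card (between X s') \<le> card (between X u)"
    using ex_has_least_nat[of ?P Z "\<lambda>u. card (between X u)"] by auto
  have s'V: "s' \<in> V" using s'(1) assms by (auto simp: between_def)
  have "\<exists>s. s \<in> insert X (insert Z (between X Z)) \<and> ?front s \<and> gd s s' \<le> 1"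
  proof (cases "2 \<le> gd X s'")
    case True
    then obtain s where s: "s \<in> between X s'" "gd s s' = 1" using penultimate s'V assms by metis
    have "s \<in> between X Z" using s s'(1) between_mono[of s' X Z] assms by auto
    moreover have "\<not> ?P s" using s'(2)[of s] between_card[OF s(1)] s'V assms by linarith
    ultimately have "?front s" using gate_two_sides[OF assms(1-3), of s] by blast
    then show ?thesis using s \<open>s \<in> between X Z\<close> by (intro exI[of _ s]) auto
  next
    case False
    then show ?thesis using assms by (intro exI[of _ X]) (auto intro!: bexI[of _ X])
  qed
  then obtain s v where s: "s \<in> insert X (insert Z (between X Z))" "gd s s' \<le> 1"
    and v: "v \<in> V" "gd v s \<le> 2" "gd X v + gd v p = gd X p" by auto
  obtain v' where v': "v' \<in> V" "gd v' s' \<le> 2" "gd p v' + gd v' Z = gd p Z" using s'(1) by auto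
  have sV: "s \<in> V" using s assms by (auto simp: between_def)
  have "gd v v' \<le> gd v s + gd s v'" "gd s v' \<le> gd s s' + gd s' v'" "gd s' v' = gd v' s'"
    using gd_triangle gd_sym v v' sV s'V by blast+
  then have "gd v v' \<le> 5" using v v' s by linarith
  moreover have "gd X Z \<le> gd X v + gd v Z" "gd v Z \<le> gd v v' + gd v' Z"
    using gd_triangle assms v v' by blast+
  ultimately have "gd v p \<le> 5 + c" using v v' assms(4) by linarith
  moreover have "gd s p \<le> gd s v + gd v p" "gd s v = gd v s"
    using gd_triangle gd_sym assms v sV by blast+
  ultimately show ?thesis using that[of s] s v by linarith
qed

text \<open>
  The point \<open>p\<close> is close to some element between \<open>X\<close> and \<open>Z\<close>, and the path from \<open>X\<close> through \<open>W\<close> to \<open>Z\<close> must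
  pass close to this element, too.
\<close>

lemma thin_triangles:
  assumes "X \<in> V" "Z \<in> V" "p \<in> V" "W \<in> V" "gd X p + gd p Z \<le> gd X Z + c"
  shows "gd X p + gd p W \<le> gd X W + (18 + 2 * c) \<or> gd W p + gd p Z \<le> gd W Z + (18 + 2 * c)"
proof -
  obtain s where s: "s \<in> insert X (insert Z (between X Z))" "gd s p \<le> 7 + c"
    using near_geodesic_close_to_between assms by metis
  have sV: "s \<in> V" using s assms by (auto simp: between_def)
  obtain v where v: "v \<in> V" "gd v s \<le> 2" "gd X v + gd v W = gd X W \<or> gd W v + gd v Z = gd W Z"
  proof (cases "s \<in> between X Z")
    case True
    then show ?thesis using gate_two_sides[OF assms(1,2,4)] that by metis
  next
    case False
    then show ?thesis using s that[of X] that[of Z] assms by auto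
  qed
  have "gd v p \<le> 9 + c" "gd p v \<le> 9 + c"
    using gd_triangle[of v s p] gd_sym[of v p] v s sV assms by linarith+
  moreover have "gd X p \<le> gd X v + gd v p" "gd p W \<le> gd p v + gd v W"
    "gd W p \<le> gd W v + gd v p" "gd p Z \<le> gd p v + gd v Z"
    using gd_triangle assms v by blast+
  ultimately show ?thesis using v(3) by linarith
qed

text \<open>
  A step from \<open>X\<close> to a neighbour affects at most the first two elements between \<open>X\<close> and \<open>Z\<close>. If it changed
  the view from \<open>Y\<close>, with \<open>Y1\<close> and \<open>Y2\<close> in front of \<open>Y\<close>, then \<open>Y1\<close> would lie between \<open>X\<close> and its neighbour.
\<close>

lemma between_card_adj:
  assumes "adj X X'" "Z \<in> V"
  shows "card (between X Z) \<le> card (between X' Z) + 2"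
proof -
  have XV: "X \<in> V" "X' \<in> V" using adj_in assms by blast+
  let ?low = "{Y \<in> between X Z. card (between X Y) < 2}"
  have fin: "finite (between X Z)" "finite (between X' Z)" using between_fin XV assms by auto
  have inj: "inj_on (\<lambda>Y. card (between X Y)) (between X Z)"
  proof (rule inj_onI, rule ccontr)
    fix Y W assume YW: "Y \<in> between X Z" "W \<in> between X Z" "card (between X Y) = card (between X W)" "Y \<noteq> W"
    then have "Y \<in> V" "W \<in> V" by (auto simp: between_def)
    then show False
      using between_linear[OF YW(1,2,4)] between_card[of Y X W] between_card[of W X Y] YW XV assms by auto
  qed
  have "card ?low \<le> card {0::nat, 1}"
  proof (rule card_inj_on_le[of "\<lambda>Y. card (between X Y)"])
    show "inj_on (\<lambda>Y. card (between X Y)) ?low" using inj by (rule inj_on_subset) auto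
  qed auto
  moreover have "between X Z - ?low \<subseteq> between X' Z"
  proof
    fix Y assume Y: "Y \<in> between X Z - ?low"
    have YV: "Y \<in> V" "Y \<noteq> Z" using Y by (auto simp: between_def)
    have "\<not> card (between X Y) \<le> Suc 0" using Y by auto
    then obtain U1 U2 where U: "U1 \<in> between X Y" "U2 \<in> between X Y" "U1 \<noteq> U2"
      using between_fin[OF XV(1) YV(1)] by (auto simp: card_le_Suc0_iff_eq)
    obtain Y1 Y2 where Y12: "Y1 \<in> between X Y" "Y2 \<in> between X Y" "Y1 \<in> between X Y2" "Y2 \<in> between Y1 Y"
      using between_linear[OF U XV(1) YV(1)] U between_sym[of U1 Y] between_sym[of U2 Y] between_sym[of Y U2] that
      by (metis between_linear XV(1) YV(1))
    have YV12: "Y1 \<in> V" "Y1 \<noteq> Y" "Y2 \<in> V" "Y2 \<noteq> Y" "Y1 \<noteq> Y2"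
      using Y12 by (auto simp: between_def)
    have ne: "X' \<noteq> Y2" "X' \<noteq> Y" using Y12 assms by (auto simp: adj_def)
    have view: "d Y X Z = d Y Y1 Z" "d Y X Z = d Y Y2 Z"
      using between_view(3)[OF Y12(1)] between_view(3)[OF Y12(2)] XV YV by auto
    have "d Y X' Z = d Y X Z"
    proof (cases "X' = Y1")
      case True
      then show ?thesis using view by simp
    next
      case False
      have small: "d Y1 X X' \<le> K" using assms(1) Y12 YV12 False by (force simp: adj_def between_def)
      have "d Y2 Y1 X' \<le> \<theta>"
      proof (rule ccontr)
        assume "\<not> ?thesis"
        then have "d Y1 X' X = d Y1 Y2 X"
          using transparent2(1)[of Y1 Y2 X' X] YV12 XV ne False by auto
        then show False using small Y12(3) d_sym[of Y1 X' X] d_sym[of Y1 Y2 X] by (auto simp: between_def)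
      qed
      moreover have "d Y2 Y1 Y \<le> d Y2 Y1 X' + d Y2 X' Y"
        using d_triangle[of Y2 Y1 X' Y] YV12 XV YV ne by auto
      ultimately have "\<theta> < d Y2 Y X'" using Y12(4) K_large d_sym[of Y2 Y X'] by (auto simp: between_def)
      then have "d Y X' Z = d Y Y2 Z" using transparent2(1)[of Y Y2 X' Z] YV12 XV YV ne by auto
      then show ?thesis using view by simp
    qed
    then show "Y \<in> between X' Z" using Y YV ne by (auto simp: between_def)
  qed
  then have "card (between X Z - ?low) \<le> card (between X' Z)" using fin card_mono by blast
  moreover have "card (between X Z) \<le> card ?low + card (between X Z - ?low)"
  proof -
    have "between X Z = ?low \<union> (between X Z - ?low)" by blast
    then show ?thesis using card_Un_le[of ?low "between X Z - ?low"] by metis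
  qed
  ultimately show ?thesis by auto
qed

lemma between_card_le:
  assumes "X \<in> V" "Z \<in> V"
  shows "card (between X Z) \<le> 2 * gd X Z"
proof -
  have "(adj ^^ n) X Z \<Longrightarrow> X \<in> V \<Longrightarrow> card (between X Z) \<le> 2 * n" for n X
  proof (induction n arbitrary: X)
    case (Suc n)
    obtain X' where X': "adj X X'" "(adj ^^ n) X' Z" using Suc.prems(1) relpowp_Suc_D2 by metis
    then show ?case using Suc.IH[of X'] between_card_adj[OF X'(1) assms(2)] adj_in by fastforce
  qed auto
  then show ?thesis using gd_path assms by blast
qed

text \<open>
  The elements between \<open>X\<close> and \<open>Z\<close> move away from \<open>X\<close> at a definite speed. Indeed, those in the window
  lie between the first and the last of them, whose distance is at most \<open>l + 4\<close> because both are close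
  to a geodesic that starts at \<open>X\<close>.
\<close>

lemma between_window:
  assumes "X \<in> V" "Z \<in> V"
  shows "card {Y \<in> between X Z. a \<le> gd X Y \<and> gd X Y \<le> a + l} \<le> 2 * l + 10"
proof (cases "{Y \<in> between X Z. a \<le> gd X Y \<and> gd X Y \<le> a + l} = {}")
  case False
  define T where "T = {Y \<in> between X Z. a \<le> gd X Y \<and> gd X Y \<le> a + l}"
  have T: "Y \<in> between X Z" "a \<le> gd X Y" "gd X Y \<le> a + l" if "Y \<in> T" for Y
    using that by (auto simp: T_def)
  let ?r = "\<lambda>Y. card (between X Y)"
  obtain Y0 where Y0: "Y0 \<in> T" using False by (auto simp: T_def)
  obtain Y1 where Y1: "Y1 \<in> T" "\<And>Y. Y \<in> T \<Longrightarrow> ?r Y1 \<le> ?r Y"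
    using ex_has_least_nat[of "\<lambda>Y. Y \<in> T" Y0 ?r] Y0 by metis
  have rZ: "?r Y < ?r Z" if "Y \<in> T" for Y
    using between_card[OF T(1)[OF that] assms] by linarith
  obtain Y2 where Y2: "Y2 \<in> T" "\<And>Y. Y \<in> T \<Longrightarrow> ?r Y \<le> ?r Y2"
    using ex_has_greatest_nat[of "\<lambda>Y. Y \<in> T" Y0 ?r "?r Z"] Y0 rZ by metis
  have V12: "Y1 \<in> V" "Y2 \<in> V" using T(1)[OF Y1(1)] T(1)[OF Y2(1)] unfolding between_def by blast+
  have *: "Y \<in> between X W \<and> W \<in> between Y Z"
    if "Y \<in> between X Z" "W \<in> between X Z" "Y \<noteq> W" "?r Y \<le> ?r W" for Y W
  proof -
    have "W \<notin> between X Y"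
    proof
      assume W: "W \<in> between X Y"
      have "Y \<in> V" using that(1) by (simp add: between_def)
      then show False using between_card[OF W assms(1)] that(4) by linarith
    qed
    then show ?thesis using between_linear[OF that(1-3) assms] by blast
  qed
  have sub: "T \<subseteq> insert Y1 (insert Y2 (between Y1 Y2))"
  proof
    fix Y assume Y: "Y \<in> T"
    show "Y \<in> insert Y1 (insert Y2 (between Y1 Y2))"
    proof (rule ccontr)
      assume n: "Y \<notin> insert Y1 (insert Y2 (between Y1 Y2))"
      have YV: "Y \<in> V" using T(1)[OF Y] by (auto simp: between_def)
      have a: "Y1 \<in> between X Y" "Y \<in> between Y1 Z" using *[OF T(1)[OF Y1(1)] T(1)[OF Y]] Y1(2)[OF Y] n by auto
      have b: "Y \<in> between X Y2" "Y2 \<in> between Y Z" using *[OF T(1)[OF Y] T(1)[OF Y2(1)]] Y2(2)[OF Y] n by auto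
      have "Y1 \<noteq> Y2" using a(1) between_antisym[OF b(1) assms(1) V12(2)] by auto
      then have "Y2 \<in> between Y1 Z" using *[OF T(1)[OF Y1(1)] T(1)[OF Y2(1)]] Y1(2)[OF Y2(1)] \<open>Y1 \<noteq> Y2\<close> by auto
      then have "Y2 \<in> between Y1 Y" using between_linear[of Y Y1 Z Y2] a n V12 assms by blast
      then have "Y2 \<in> between X Y" using between_mono2[OF a(1)] assms YV by blast
      then show False using between_antisym[OF b(1) assms(1) V12(2)] by blast
    qed
  qed
  have "gd Y1 Y2 \<le> l + 4"
  proof (cases "Y1 = Y2")
    case False
    note \<open>Y1 \<noteq> Y2\<close>
    then have "Y1 \<in> between X Y2" using *[OF T(1)[OF Y1(1)] T(1)[OF Y2(1)]] Y1(2)[OF Y2(1)] \<open>Y1 \<noteq> Y2\<close> by auto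
    then have "gd X Y1 + gd Y1 Y2 \<le> gd X Y2 + 4" using gate assms V12 by blast
    then show ?thesis using T(2)[OF Y1(1)] T(3)[OF Y2(1)] by linarith
  qed simp
  then have c: "card (between Y1 Y2) \<le> 2 * l + 8" using between_card_le[OF V12] by linarith
  have "card T \<le> card (insert Y1 (insert Y2 (between Y1 Y2)))"
    using sub between_fin[OF V12] by (intro card_mono) auto
  also have "\<dots> \<le> card (between Y1 Y2) + 2"
    using between_fin[OF V12] by (simp add: card_insert_if)
  finally show ?thesis using c unfolding T_def by linarith
qed (simp only: card.empty le0)

lemma view_from_far:
  assumes "X \<in> V" "X' \<in> V" "Y \<in> V" "gd X X' \<le> \<epsilon>" "\<epsilon> + 3 \<le> gd X Y"
  shows "d Y X U = d Y X' U"
proof (rule ccontr)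
  assume "\<not> ?thesis"
  then obtain v where v: "v \<in> V" "gd X v + gd v X' = gd X X'" "gd v Y \<le> 2"
    using barrier_geodesic assms by metis
  then show False using gd_triangle[of X v Y] assms by linarith
qed

lemma between_stable:
  assumes "X \<in> V" "X' \<in> V" "Z \<in> V" "Z' \<in> V" "Y \<in> between X Z"
    and "gd X X' \<le> \<epsilon>" "gd Z Z' \<le> \<epsilon>" "\<epsilon> + 3 \<le> gd X Y" "\<epsilon> + 3 \<le> gd Z Y"
  shows "Y \<in> between X' Z'"
proof -
  have YV: "Y \<in> V" using assms by (auto simp: between_def)
  have "d Y X Z = d Y X' Z'"
    using view_from_far[OF assms(1,2) YV assms(6,8), of Z] view_from_far[OF assms(3,4) YV assms(7,9), of X']
      d_sym[of Y X' Z] d_sym[of Y X' Z'] by simp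
  moreover have "X' \<noteq> Y" "Z' \<noteq> Y" using assms by auto
  ultimately show ?thesis using assms(5) by (auto simp: between_def)
qed

lemma between_concat:
  assumes "Y \<in> between X W" "W \<in> between Y Z" "X \<in> V" "Z \<in> V"
  shows "Y \<in> between X Z" "W \<in> between X Z"
proof -
  have YW: "Y \<in> V" "W \<in> V" using assms by (auto simp: between_def)
  have "d Y Z X = d Y W X" using between_view(2)[OF assms(2)] YW assms by auto
  moreover have "Y \<noteq> Z" using assms YW by auto
  ultimately show Y: "Y \<in> between X Z" using assms(1) d_sym[of Y Z X] d_sym[of Y W X] by (auto simp: between_def)
  then show "W \<in> between X Z" using between_mono2 assms by blast
qed

section \<open>Rays\<close>

definition ray :: "(nat \<Rightarrow> 'v) \<Rightarrow> bool" where
  "ray x \<longleftrightarrow> range x \<subseteq> V \<and> x 0 \<noteq> x 1 \<and> (\<forall>i. x (Suc i) \<in> between (x i) (x (Suc (Suc i))))"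

text \<open>
  The defining condition of a ray is local, and betweenness concatenates: this is a local-to-global
  principle.
\<close>

lemma ray_between:
  assumes "ray x" "i < j" "j < k"
  shows "x j \<in> between (x i) (x k)"
proof -
  have V: "x n \<in> V" for n using assms by (auto simp: ray_def)
  have s: "x (Suc n) \<in> between (x n) (x (Suc (Suc n)))" for n using assms by (auto simp: ray_def)
  have "\<forall>j. i < j \<and> j < k \<longrightarrow> x j \<in> between (x i) (x k)"
  proof (induction k)
    case (Suc k)
    show ?case
    proof (intro allI impI, elim conjE)
      fix j assume j: "i < j" "j < Suc k"
      obtain k' where k': "k = Suc k'" using j by (cases k) auto
      have k: "x k \<in> between (x i) (x (Suc k))"
      proof (cases "k' = i")
        case True
        then show ?thesis using s k' by auto
      next
        case False
        then have "x k' \<in> between (x i) (x k)" using Suc.IH j k' by auto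
        then show ?thesis using between_concat(2)[of "x k'" "x i" "x k" "x (Suc k)"] s[of k'] V k' by auto
      qed
      show "x j \<in> between (x i) (x (Suc k))"
      proof (cases "j = k")
        case False
        then have "x j \<in> between (x i) (x k)" using Suc.IH j by auto
        then show ?thesis using between_mono[OF k] V by auto
      qed (use k in simp)
    qed
  qed simp
  then show ?thesis using assms by blast
qed

lemma ray_escapes:
  assumes "ray x"
  shows "n \<le> 2 * gd (x 0) (x n) + 1"
proof -
  have V: "x n \<in> V" for n using assms by (auto simp: ray_def)
  have "x ` {0<..<n} \<subseteq> between (x 0) (x n)" using ray_between[OF assms] by auto
  moreover have "inj_on x {0<..<n}"
  proof (rule linorder_inj_onI)
    fix i j :: nat assume "i < j" "i \<in> {0<..<n}"
    then have "x i \<in> between (x 0) (x j)" using ray_between[OF assms, of 0 i j] by auto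
    then show "x i \<noteq> x j" by (auto simp: between_def)
  qed auto
  ultimately have "card {0<..<n} \<le> card (between (x 0) (x n))"
    using between_fin V by (metis card_image card_mono)
  then show ?thesis using between_card_le[of "x 0" "x n"] V by simp
qed

lemma ray_product:
  assumes "ray x" "i \<le> j"
  shows "gd (x 0) (x i) + gd (x i) (x j) \<le> gd (x 0) (x j) + 4"
proof -
  have V: "x n \<in> V" for n using assms by (auto simp: ray_def)
  consider "i = 0" | "i = j" | "0 < i" "i < j" using assms by linarith
  then show ?thesis
  proof cases
    case 3
    then show ?thesis using gate ray_between[OF assms(1) 3] V by blast
  qed auto
qed

lemma rays_diverge:
  assumes "ray x" "ray y" "x 0 = y 0" "K < d (x 0) (x 1) (y 1)" "0 < n" "0 < m"
  shows "gd (x n) (x 0) + gd (x 0) (y m) \<le> gd (x n) (y m) + 4"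
proof -
  have V: "x n \<in> V" "y n \<in> V" for n using assms by (auto simp: ray_def)
  have view: "d (z 0) (z n) U = d (z 0) (z 1) U" "z n \<noteq> z 0" if z: "ray z" "0 < n" for z n U
  proof -
    have zV: "z k \<in> V" for k using z by (auto simp: ray_def)
    show "d (z 0) (z n) U = d (z 0) (z 1) U"
    proof (cases "n = 1")
      case False
      then have "z 1 \<in> between (z 0) (z n)" using ray_between[OF z(1), of 0 1 n] z by auto
      then show ?thesis using between_view(2)[of "z 1" "z 0" "z n" U] zV by auto
    qed simp
    have "z 0 \<noteq> z 1" using z by (simp add: ray_def)
    moreover have "z n \<noteq> z 0" if "n \<noteq> 1"
      using ray_between[OF z(1), of 0 1 n] z between_self[OF zV[of 0]] that by force
    ultimately show "z n \<noteq> z 0" by metis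
  qed
  have "d (x 0) (x n) (y m) = d (x 0) (x 1) (y m)" using view[OF assms(1,5)] by blast
  also have "\<dots> = d (y 0) (y m) (x 1)" using assms(3) d_sym by simp
  also have "\<dots> = d (y 0) (y 1) (x 1)" using view[OF assms(2,6)] by blast
  also have "\<dots> = d (x 0) (x 1) (y 1)" using assms(3) d_sym[of "y 0" "y 1" "x 1"] by simp
  finally have "d (x 0) (x n) (y m) = d (x 0) (x 1) (y 1)" .
  then have "x 0 \<in> between (x n) (y m)"
    using assms view[OF assms(1,5)] view[OF assms(2,6)] V by (auto simp: between_def)
  then show ?thesis using gate V by blast
qed

lemma ray_exists:
  assumes "Y \<in> V" "Z \<in> V - {Y}"
    and extend: "\<And>Y X. \<lbrakk>Y \<in> V; X \<in> V - {Y}\<rbrakk> \<Longrightarrow> \<exists>X'\<in>V - {Y}. K < d Y X X'"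
  obtains x where "ray x" "x 0 = Y" "x 1 = Z"
proof -
  define S where "S = {(a, b). a \<in> V \<and> b \<in> V \<and> a \<noteq> b}"
  have "\<exists>f::nat \<Rightarrow> 'v \<times> 'v. \<forall>n. (f n \<in> S \<and> (n = 0 \<longrightarrow> f n = (Y, Z))) \<and>
      (fst (f (Suc n)) = snd (f n) \<and> K < d (snd (f n)) (fst (f n)) (snd (f (Suc n))))"
  proof (rule dependent_nat_choice)
    show "\<exists>p. p \<in> S \<and> (0 = (0::nat) \<longrightarrow> p = (Y, Z))" using assms by (auto simp: S_def)
    fix p and n :: nat assume "p \<in> S \<and> (n = 0 \<longrightarrow> p = (Y, Z))"
    then obtain a b where ab: "p = (a, b)" "a \<in> V" "b \<in> V" "a \<noteq> b" by (auto simp: S_def)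
    obtain c where "c \<in> V - {b}" "K < d b a c" using extend[of b a] ab by auto
    then show "\<exists>q. (q \<in> S \<and> (Suc n = 0 \<longrightarrow> q = (Y, Z))) \<and> fst q = snd p \<and> K < d (snd p) (fst p) (snd q)"
      using ab by (intro exI[of _ "(b, c)"]) (auto simp: S_def)
  qed
  then obtain f where f: "\<And>n. f n \<in> S" "f 0 = (Y, Z)" "\<And>n. fst (f (Suc n)) = snd (f n)"
    "\<And>n. K < d (snd (f n)) (fst (f n)) (snd (f (Suc n)))" by auto
  have "ray (\<lambda>n. fst (f n))"
    unfolding ray_def
  proof (intro conjI allI)
    show "range (\<lambda>n. fst (f n)) \<subseteq> V" using f(1) by (auto simp: S_def case_prod_unfold)
    show "fst (f 0) \<noteq> fst (f 1)" using f(2) f(3)[of 0] assms by auto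
    show "fst (f (Suc i)) \<in> between (fst (f i)) (fst (f (Suc (Suc i))))" for i
      using f(1)[of i] f(1)[of "Suc i"] f(3)[of i] f(3)[of "Suc i"] f(4)[of i]
      by (auto simp: S_def between_def case_prod_unfold)
  qed
  then show ?thesis using that f(2) f(3)[of 0] by auto
qed

end

section \<open>Geodesics and thin triangles\<close>

lemma geodesic_betweenD:
  assumes "Metric_space S d" "geodesic_between S d A x y" "p \<in> A"
  shows "p \<in> S" "d x p + d p y = d x y"
proof -
  interpret Metric_space S d by fact
  obtain \<gamma> where \<gamma>: "A = \<gamma> ` {0..d x y}" "A \<subseteq> S" "\<gamma> 0 = x" "\<gamma> (d x y) = y"
    "\<And>s t. s \<in> {0..d x y} \<Longrightarrow> t \<in> {0..d x y} \<Longrightarrow> d (\<gamma> s) (\<gamma> t) = \<bar>s - t\<bar>"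
    using assms(2) unfolding geodesic_between_def by blast
  obtain s where s: "s \<in> {0..d x y}" "p = \<gamma> s" using assms(3) \<gamma>(1) by auto
  show "p \<in> S" using assms(3) \<gamma>(2) by auto
  show "d x p + d p y = d x y" using \<gamma>(5)[of 0 s] \<gamma>(5)[of s "d x y"] \<gamma>(3,4) s by auto
qed

lemma geodesic_point_at:
  assumes "geodesic_between S d A x y" "0 \<le> r" "r \<le> d x y"
  obtains q where "q \<in> A" "d x q = r"
proof -
  obtain \<gamma> where \<gamma>: "A = \<gamma> ` {0..d x y}" "\<gamma> 0 = x"
    "\<And>s t. s \<in> {0..d x y} \<Longrightarrow> t \<in> {0..d x y} \<Longrightarrow> d (\<gamma> s) (\<gamma> t) = \<bar>s - t\<bar>"
    using assms(1) unfolding geodesic_between_def by blast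
  show ?thesis using that[of "\<gamma> r"] \<gamma>(3)[of 0 r] \<gamma>(1,2) assms by auto
qed

lemma geodesic_sym:
  assumes "Metric_space S d" "geodesic_between S d A x y"
  shows "geodesic_between S d A y x"
proof -
  interpret Metric_space S d by fact
  obtain \<gamma> where \<gamma>: "A = \<gamma> ` {0..d x y}" "A \<subseteq> S" "\<gamma> 0 = x" "\<gamma> (d x y) = y"
    "\<And>s t. s \<in> {0..d x y} \<Longrightarrow> t \<in> {0..d x y} \<Longrightarrow> d (\<gamma> s) (\<gamma> t) = \<bar>s - t\<bar>"
    using assms(2) unfolding geodesic_between_def by blast
  have L: "d y x = d x y" by (rule commute)
  have "(\<lambda>s. \<gamma> (d x y - s)) ` {0..d x y} = \<gamma> ` ((\<lambda>s. d x y - s) ` {0..d x y})" by (simp only: image_image)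
  also have "(\<lambda>s. d x y - s) ` {0..d x y} = {0..d x y}" by (simp add: image_diff_atLeastAtMost)
  finally have "A = (\<lambda>s. \<gamma> (d x y - s)) ` {0..d x y}" using \<gamma>(1) by simp
  then show ?thesis unfolding geodesic_between_def L
    using \<gamma>(2-5) by (intro exI[of _ "\<lambda>s. \<gamma> (d x y - s)"]) auto
qed

lemma geodesic_refl:
  assumes "Metric_space S d" "x \<in> S"
  shows "\<exists>A. geodesic_between S d A x x"
proof -
  interpret Metric_space S d by fact
  show ?thesis unfolding geodesic_between_def
    using assms(2) by (intro exI[of _ "{x}"] exI[of _ "\<lambda>_. x"]) auto
qed

lemma geodesic_concat:
  assumes "Metric_space S d" "geodesic_between S d A x y" "geodesic_between S d B y z"
    and add: "d x z = d x y + d y z"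
  shows "\<exists>C. geodesic_between S d C x z"
proof -
  interpret Metric_space S d by fact
  obtain \<gamma> where \<gamma>: "A = \<gamma> ` {0..d x y}" "A \<subseteq> S" "\<gamma> 0 = x" "\<gamma> (d x y) = y"
    "\<And>s t. s \<in> {0..d x y} \<Longrightarrow> t \<in> {0..d x y} \<Longrightarrow> d (\<gamma> s) (\<gamma> t) = \<bar>s - t\<bar>"
    using assms(2) unfolding geodesic_between_def by blast
  obtain \<eta> where \<eta>: "B = \<eta> ` {0..d y z}" "B \<subseteq> S" "\<eta> 0 = y" "\<eta> (d y z) = z"
    "\<And>s t. s \<in> {0..d y z} \<Longrightarrow> t \<in> {0..d y z} \<Longrightarrow> d (\<eta> s) (\<eta> t) = \<bar>s - t\<bar>"
    using assms(3) unfolding geodesic_between_def by blast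
  define a where "a = d x y"
  define b where "b = d y z"
  have ab: "0 \<le> a" "0 \<le> b" "d x z = a + b" by (auto simp: a_def b_def add)
  define \<rho> where "\<rho> = (\<lambda>s. if s \<le> a then \<gamma> s else \<eta> (s - a))"
  have \<gamma>S: "\<gamma> s \<in> S" if "0 \<le> s" "s \<le> a" for s using \<gamma>(1,2) that by (auto simp: a_def)
  have \<eta>S: "\<eta> s \<in> S" if "0 \<le> s" "s \<le> b" for s using \<eta>(1,2) that by (auto simp: b_def)
  have S: "x \<in> S" "y \<in> S" "z \<in> S" using \<gamma>S[of 0] \<gamma>S[of a] \<eta>S[of b] ab \<gamma>(3,4) \<eta>(4) by (auto simp: a_def b_def)
  have mixed: "d (\<gamma> s) (\<eta> (t - a)) = t - s" if "0 \<le> s" "s \<le> a" "a < t" "t \<le> a + b" for s t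
  proof (rule antisym)
    have \<gamma>ds: "d (\<gamma> s) y = a - s" "d x (\<gamma> s) = s"
      using \<gamma>(5)[of s a] \<gamma>(5)[of 0 s] \<gamma>(3,4) that ab by (auto simp: a_def)
    have \<eta>ds: "d y (\<eta> (t - a)) = t - a" "d (\<eta> (t - a)) z = a + b - t"
      using \<eta>(5)[of 0 "t - a"] \<eta>(5)[of "t - a" b] \<eta>(3,4) that ab by (auto simp: b_def)
    have m: "\<gamma> s \<in> S" "\<eta> (t - a) \<in> S" using \<gamma>S[of s] \<eta>S[of "t - a"] that by auto
    show "d (\<gamma> s) (\<eta> (t - a)) \<le> t - s"
      using triangle[OF m(1) S(2) m(2)] \<gamma>ds \<eta>ds by linarith
    show "t - s \<le> d (\<gamma> s) (\<eta> (t - a))"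
      using triangle[OF S(1) m(1) S(3)] triangle[OF m S(3)] \<gamma>ds \<eta>ds ab by linarith
  qed
  have "d (\<rho> s) (\<rho> t) = \<bar>s - t\<bar>" if st: "s \<in> {0..a + b}" "t \<in> {0..a + b}" for s t
  proof -
    consider "s \<le> a" "t \<le> a" | "s \<le> a" "a < t" | "a < s" "t \<le> a" | "a < s" "a < t" by linarith
    then show ?thesis
    proof cases
      case 3
      then show ?thesis using mixed[of t s] st commute by (auto simp: \<rho>_def)
    next
      case 4
      then show ?thesis using \<eta>(5)[of "s - a" "t - a"] st by (auto simp: \<rho>_def b_def)
    qed (use \<gamma>(5)[of s t] mixed[of s t] st in \<open>auto simp: \<rho>_def a_def\<close>)
  qed
  moreover have "\<rho> ` {0..a + b} \<subseteq> S" using \<gamma>S \<eta>S by (auto simp: \<rho>_def)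
  moreover have "\<rho> 0 = x" using \<gamma>(3) ab(1) by (simp add: \<rho>_def)
  moreover have "\<rho> (a + b) = z"
  proof (cases "b = 0")
    case True
    then have "y = z" using zero[OF S(2,3)] by (simp add: b_def)
    then show ?thesis using True \<gamma>(4) by (simp add: \<rho>_def a_def)
  next
    case False
    then have "\<not> a + b \<le> a" using ab(2) by linarith
    then show ?thesis using \<eta>(4) by (simp add: \<rho>_def b_def)
  qed
  ultimately show ?thesis
    unfolding geodesic_between_def ab(3) by blast
qed

text \<open>
  The assumption is the four-point condition for quadruples in which \<open>p\<close> lies on a geodesic from \<open>x\<close> to
  \<open>z\<close>. In a geodesic space it suffices for slim triangles: if \<open>p\<close> is nearly on the way from \<open>x\<close> to \<open>w\<close>,
  the point \<open>q\<close> of that side with the same distance from \<open>x\<close> is close to \<open>p\<close>, which follows from a second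
  use of the condition, for \<open>q\<close>.
\<close>

lemma slim_from_thin:
  assumes M: "Metric_space S d" and "0 \<le> c"
    and thin: "\<And>x z w p. \<lbrakk>x \<in> S; z \<in> S; w \<in> S; p \<in> S; d x p + d p z = d x z\<rbrakk> \<Longrightarrow>
      d x p + d p w \<le> d x w + c \<or> d w p + d p z \<le> d w z + c"
  shows "delta_hyperbolic S d (2 * c + 1)"
proof -
  interpret Metric_space S d by fact
  have half: "\<exists>q\<in>B. d p q < 2 * c + 1"
    if B: "geodesic_between S d B x w" and S: "x \<in> S" "w \<in> S" "p \<in> S" and p: "d x p + d p w \<le> d x w + c"
    for B x w p
  proof (cases "d x p \<le> d x w")
    case True
    obtain q where q: "q \<in> B" "d x q = d x p" using geodesic_point_at[OF B _ True] by auto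
    have qS: "q \<in> S" "d x q + d q w = d x w" using geodesic_betweenD[OF M B q(1)] by auto
    have "d x q + d q p \<le> d x p + c \<or> d p q + d q w \<le> d p w + c" using thin[of x w p q] S qS by auto
    then have "d p q \<le> 2 * c" using commute[of p q] q qS p \<open>0 \<le> c\<close> by linarith
    then show ?thesis using q(1) by force
  next
    case False
    obtain q where q: "q \<in> B" "d x q = d x w" using geodesic_point_at[OF B, of "d x w"] by auto
    have "d q w = 0" using geodesic_betweenD[OF M B q(1)] q by auto
    then have "q = w" using geodesic_betweenD[OF M B q(1)] S by simp
    then show ?thesis using q(1) p False \<open>0 \<le> c\<close> by force
  qed
  have side: "\<forall>p\<in>A. \<exists>q\<in>B \<union> C. d p q < 2 * c + 1"
    if g: "x \<in> S" "y \<in> S" "z \<in> S" "geodesic_between S d A x y" "geodesic_between S d B y z" "geodesic_between S d C z x"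
    for A B C x y z
  proof
    fix p assume "p \<in> A"
    then have p: "p \<in> S" "d x p + d p y = d x y" using geodesic_betweenD[OF M] g by auto
    then consider "d x p + d p z \<le> d x z + c" | "d z p + d p y \<le> d z y + c"
      using thin[of x y z p] g by blast
    then show "\<exists>q\<in>B \<union> C. d p q < 2 * c + 1"
    proof cases
      case 1
      then show ?thesis using half[OF geodesic_sym[OF M g(6)]] g p by blast
    next
      case 2
      then have "d y p + d p z \<le> d y z + c"
        using commute[of z p] commute[of y p] commute[of y z] by linarith
      then show ?thesis using half[OF g(5)] g p by blast
    qed
  qed
  show ?thesis
    unfolding delta_hyperbolic_def slim_sides_def
  proof (intro ballI allI impI, elim conjE)
    fix x y z A B C
    assume "x \<in> S" "y \<in> S" "z \<in> S"
      "geodesic_between S d A x y" "geodesic_between S d B y z" "geodesic_between S d C z x"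
    note g = this
    show "(\<forall>p\<in>A. \<exists>q\<in>B \<union> C. d p q < 2 * c + 1) \<and> (\<forall>p\<in>B. \<exists>q\<in>A \<union> C. d p q < 2 * c + 1) \<and>
        (\<forall>p\<in>C. \<exists>q\<in>A \<union> B. d p q < 2 * c + 1)"
      using side[OF g] side[OF g(2,3,1,5,6,4)] side[OF g(3,1,2,6,4,5)] by (simp add: Un_commute)
  qed
qed

section \<open>The geometric realization of a graph\<close>

context connected_graph
begin

text \<open>
  A triple \<open>(x, y, t)\<close> is the point at distance \<open>t\<close> from \<open>x\<close> on the edge from \<open>x\<close> to \<open>y\<close>, and \<open>(x, x, 0)\<close> is the
  vertex \<open>x\<close>. The two orientations of an edge give two separate segments, so that no orientation has
  to be chosen, which could not be done in an equivariant way.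
\<close>

definition points :: "('v \<times> 'v \<times> real) set" where
  "points = {(x, x, 0) | x. x \<in> V} \<union> {(x, y, t) | x y t. adj x y \<and> 0 < t \<and> t < 1}"

definition vertex :: "'v \<Rightarrow> 'v \<times> 'v \<times> real" where
  "vertex x = (x, x, 0)"

text \<open>
  The ends of the edge, together with their distances from the point. A vertex is its own port twice;
  the second one has weight 1 and never shortens a connection.
\<close>

fun ports :: "'v \<times> 'v \<times> real \<Rightarrow> ('v \<times> real) set" where
  "ports (x, y, t) = {(x, t), (y, 1 - t)}"

definition detour :: "'v \<times> 'v \<times> real \<Rightarrow> 'v \<times> 'v \<times> real \<Rightarrow> real" where
  "detour p q = Min ((\<lambda>((u, a), (v, b)). a + real (gd u v) + b) ` (ports p \<times> ports q))"

fun raw_dist :: "'v \<times> 'v \<times> real \<Rightarrow> 'v \<times> 'v \<times> real \<Rightarrow> real" where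
  "raw_dist (x, y, t) (x', y', t') = (if x = x' \<and> y = y' then \<bar>t - t'\<bar> else detour (x, y, t) (x', y', t'))"

lemma ports_finite: "finite (ports p)" "ports p \<noteq> {}"
  by (cases p; simp)+

lemma ports_in:
  assumes "p \<in> points" "(u, a) \<in> ports p"
  shows "u \<in> V" "0 \<le> a" "a \<le> 1"
  using assms adj_in by (auto simp: points_def)

lemma detour_le: "\<lbrakk>(u, a) \<in> ports p; (v, b) \<in> ports q\<rbrakk> \<Longrightarrow> detour p q \<le> a + real (gd u v) + b"
  unfolding detour_def
  by (rule Min_le) (use ports_finite in \<open>simp, force intro: image_eqI[of _ _ "((u, a), (v, b))"]\<close>)

lemma detour_attained:
  obtains u a v b where "(u, a) \<in> ports p" "(v, b) \<in> ports q" "detour p q = a + real (gd u v) + b"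
proof -
  have "detour p q \<in> (\<lambda>((u, a), (v, b)). a + real (gd u v) + b) ` (ports p \<times> ports q)"
    unfolding detour_def by (rule Min_in) (use ports_finite in auto)
  then show ?thesis using that by auto
qed

lemma port_gap:
  assumes "p \<in> points" "(u, a) \<in> ports p" "(v, b) \<in> ports p"
  shows "real (gd u v) \<le> a + b"
proof -
  obtain x y t where p: "p = (x, y, t)" by (metis prod_cases3)
  have "gd x y \<le> 1" "gd y x \<le> 1"
    using assms(1) gd_adj[of x y] gd_adj[OF adj_sym, of x y] by (auto simp: p points_def)
  then show ?thesis using assms by (auto simp: p points_def)
qed

lemma detour_sym_le:
  assumes "p \<in> points" "q \<in> points"
  shows "detour p q \<le> detour q p"
proof -
  obtain u a v b where uv: "(u, a) \<in> ports q" "(v, b) \<in> ports p" "detour q p = a + real (gd u v) + b"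
    using detour_attained by blast
  then show ?thesis
    using detour_le[OF uv(2,1)] gd_sym[of u v] ports_in(1)[OF assms(2) uv(1)] ports_in(1)[OF assms(1) uv(2)]
    by simp
qed

lemma detour_triangle:
  assumes "p \<in> points" "q \<in> points" "r \<in> points"
  shows "detour p r \<le> detour p q + detour q r"
proof -
  obtain u a v b where 1: "(u, a) \<in> ports p" "(v, b) \<in> ports q" "detour p q = a + real (gd u v) + b"
    using detour_attained by blast
  obtain v' b' w c where 2: "(v', b') \<in> ports q" "(w, c) \<in> ports r" "detour q r = b' + real (gd v' w) + c"
    using detour_attained by blast
  have V: "u \<in> V" "v \<in> V" "v' \<in> V" "w \<in> V" using ports_in 1 2 assms by blast+
  have "gd u w \<le> gd u v + (gd v v' + gd v' w)"
    using gd_triangle[of u v w] gd_triangle[of v v' w] V by linarith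
  then have "real (gd u w) \<le> real (gd u v) + (real (gd v v') + real (gd v' w))"
    using of_nat_mono by fastforce
  then show ?thesis
    using detour_le[OF 1(1) 2(2)] 1(3) 2(3) port_gap[OF assms(2) 1(2) 2(1)] by linarith
qed

lemma raw_dist_le_detour:
  assumes "p \<in> points" "q \<in> points"
  shows "raw_dist p q \<le> detour p q"
proof -
  obtain x y t x' y' t' where pq: "p = (x, y, t)" "q = (x', y', t')" by (metis prod_cases3)
  show ?thesis
  proof (cases "x = x' \<and> y = y'")
    case True
    obtain u a v b where uv: "(u, a) \<in> ports p" "(v, b) \<in> ports q" "detour p q = a + real (gd u v) + b"
      using detour_attained by blast
    have "x = y \<and> t = 0 \<and> t' = 0 \<or> gd x y = 1 \<and> gd y x = 1 \<and> 0 < t \<and> t < 1 \<and> 0 < t' \<and> t' < 1"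
      using assms True adj_in[of x x] gd_adj[of x y] gd_adj[OF adj_sym, of x y] by (auto simp: pq points_def)
    then have "\<bar>t - t'\<bar> \<le> a + real (gd u v) + b"
      using uv(1,2) True by (auto simp: pq)
    then show ?thesis using uv True by (simp add: pq)
  next
    case False
    then have "raw_dist p q = detour p q" by (auto simp: pq)
    then show ?thesis by simp
  qed
qed

lemma raw_dist_sym:
  assumes "p \<in> points" "q \<in> points"
  shows "raw_dist p q = raw_dist q p"
proof -
  have "detour p q = detour q p" using detour_sym_le assms by (simp add: antisym)
  moreover obtain x y t x' y' t' where pq: "p = (x, y, t)" "q = (x', y', t')" by (metis prod_cases3)
  have "raw_dist p q = (if x = x' \<and> y = y' then \<bar>t - t'\<bar> else detour p q)"
    "raw_dist q p = (if x = x' \<and> y = y' then \<bar>t - t'\<bar> else detour q p)"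
    by (auto simp: pq abs_minus_commute)
  ultimately show ?thesis by simp
qed

lemma same_edge_shift:
  assumes "(u, a) \<in> ports (x, y, t)"
  obtains b where "(u, b) \<in> ports (x, y, s)" "b \<le> a + \<bar>t - s\<bar>"
proof -
  consider "u = x" "a = t" | "u = y" "a = 1 - t" using assms by auto
  then show ?thesis
  proof cases
    case 1
    show ?thesis by (rule that[of s]) (use 1 in auto)
  next
    case 2
    show ?thesis by (rule that[of "1 - s"]) (use 2 in auto)
  qed
qed

lemma raw_dist_triangle_same_edge:
  assumes "(x, y, t) \<in> points" "(x, y, s) \<in> points" "r \<in> points"
  shows "raw_dist (x, y, s) r \<le> raw_dist (x, y, s) (x, y, t) + raw_dist (x, y, t) r"
proof -
  obtain x' y' t' where r: "r = (x', y', t')" by (metis prod_cases3)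
  show ?thesis
  proof (cases "x = x' \<and> y = y'")
    case False
    obtain u a v b where uv: "(u, a) \<in> ports (x, y, t)" "(v, b) \<in> ports r"
      "detour (x, y, t) r = a + real (gd u v) + b"
      using detour_attained by blast
    obtain c where c: "(u, c) \<in> ports (x, y, s)" "c \<le> a + \<bar>t - s\<bar>" using same_edge_shift uv(1) by blast
    have "detour (x, y, s) r \<le> \<bar>s - t\<bar> + detour (x, y, t) r"
      using detour_le[OF c(1) uv(2)] uv(3) c(2) by linarith
    then show ?thesis using False by (auto simp: r)
  qed (simp add: r)
qed

lemma raw_dist_triangle:
  assumes "p \<in> points" "q \<in> points" "r \<in> points"
  shows "raw_dist p r \<le> raw_dist p q + raw_dist q r"
proof -
  obtain x y t x' y' t' x'' y'' t'' where pqr: "p = (x, y, t)" "q = (x', y', t')" "r = (x'', y'', t'')"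
    by (metis prod_cases3)
  consider "x = x' \<and> y = y'" | "x' = x'' \<and> y' = y''" | "\<not> (x = x' \<and> y = y')" "\<not> (x' = x'' \<and> y' = y'')" by auto
  then show ?thesis
  proof cases
    case 1
    then show ?thesis using raw_dist_triangle_same_edge[of x y t' t r] assms pqr by auto
  next
    case 2
    then show ?thesis using raw_dist_triangle_same_edge[of x' y' t' t'' p] assms pqr raw_dist_sym[of p q] raw_dist_sym[of p r] raw_dist_sym[of q r] by auto
  next
    case 3
    then have "raw_dist p q = detour p q" "raw_dist q r = detour q r" by (auto simp: pqr)
    then show ?thesis using raw_dist_le_detour[OF assms(1,3)] detour_triangle[OF assms] by linarith
  qed
qed

lemma detour_nonneg:
  assumes "p \<in> points" "q \<in> points"
  shows "0 \<le> detour p q"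
proof -
  obtain u a v b where uv: "(u, a) \<in> ports p" "(v, b) \<in> ports q" "detour p q = a + real (gd u v) + b"
    using detour_attained by blast
  then show ?thesis using ports_in(2)[OF assms(1) uv(1)] ports_in(2)[OF assms(2) uv(2)] by simp
qed

lemma raw_dist_nonneg: "\<lbrakk>p \<in> points; q \<in> points\<rbrakk> \<Longrightarrow> 0 \<le> raw_dist p q"
  using detour_nonneg[of p q] by (cases p; cases q) auto

lemma raw_dist_zero:
  assumes "p \<in> points" "q \<in> points" "raw_dist p q = 0"
  shows "p = q"
proof -
  obtain x y t x' y' t' where pq: "p = (x, y, t)" "q = (x', y', t')" by (metis prod_cases3)
  show ?thesis
  proof (cases "x = x' \<and> y = y'")
    case False
    obtain u a v b where uv: "(u, a) \<in> ports p" "(v, b) \<in> ports q" "detour p q = a + real (gd u v) + b"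
      using detour_attained by blast
    have uvp: "u \<in> V" "v \<in> V" "0 \<le> a" "0 \<le> b" using ports_in uv assms by blast+
    have "a + real (gd u v) + b = 0" using assms False uv by (auto simp: pq)
    then have z: "a = 0" "b = 0" "real (gd u v) = 0"
      using uvp by (simp_all add: add_nonneg_eq_0_iff)
    then have "u = v" using gd_eq_0 uvp by auto
    moreover have "p = (u, u, 0)" "q = (v, v, 0)" using uv(1,2) z assms by (auto simp: pq points_def)
    ultimately show ?thesis by simp
  qed (use assms pq in auto)
qed

text \<open>
  \<open>Metric_space\<close> requires symmetry and nonnegativity on the whole type, whence the value 0.
\<close>

definition D :: "'v \<times> 'v \<times> real \<Rightarrow> 'v \<times> 'v \<times> real \<Rightarrow> real" where
  "D p q = (if p \<in> points \<and> q \<in> points then raw_dist p q else 0)"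

lemma D_metric: "Metric_space points D"
proof
  show "0 \<le> D p q" for p q using raw_dist_nonneg[of p q] by (simp add: D_def)
  show "D p q = D q p" for p q using raw_dist_sym[of p q] by (simp add: D_def)
  show "D p q = 0 \<longleftrightarrow> p = q" if "p \<in> points" "q \<in> points" for p q
  proof
    show "p = q" if "D p q = 0" using that raw_dist_zero[OF \<open>p \<in> points\<close> \<open>q \<in> points\<close>] \<open>p \<in> points\<close> \<open>q \<in> points\<close>
      by (simp add: D_def)
    have "raw_dist p p = 0" by (cases p) simp
    then show "D p q = 0" if "p = q" using that by (simp add: D_def)
  qed
  show "D p r \<le> D p q + D q r" if "p \<in> points" "q \<in> points" "r \<in> points" for p q r
    using that raw_dist_triangle[OF that] by (simp add: D_def)
qed

sublocale realization: Metric_space points D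
  by (rule D_metric)

lemma vertex_in [simp]: "vertex x \<in> points \<longleftrightarrow> x \<in> V"
  using adj_in by (auto simp: vertex_def points_def)

lemma D_vertex:
  assumes "x \<in> V" "y \<in> V"
  shows "D (vertex x) (vertex y) = gd x y"
proof (cases "x = y")
  case False
  have "D (vertex x) (vertex y) = detour (vertex x) (vertex y)"
    using assms False vertex_in by (auto simp: D_def vertex_def)
  moreover have "detour (vertex x) (vertex y) \<le> gd x y"
    using detour_le[of x 0 "vertex x" y 0 "vertex y"] by (simp add: vertex_def)
  moreover have "gd x y \<le> detour (vertex x) (vertex y)"
    by (rule detour_attained[of "vertex x" "vertex y"]) (auto simp: vertex_def)
  ultimately show ?thesis by simp
qed (use assms in \<open>auto simp: D_def vertex_def\<close>)

definition edge_point :: "'v \<Rightarrow> 'v \<Rightarrow> real \<Rightarrow> 'v \<times> 'v \<times> real" where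
  "edge_point x y t = (if t = 0 then vertex x else if t = 1 then vertex y else (x, y, t))"

lemma edge_point_in: "\<lbrakk>adj x y; 0 \<le> t; t \<le> 1\<rbrakk> \<Longrightarrow> edge_point x y t \<in> points"
  using adj_in by (auto simp: edge_point_def vertex_def points_def)

lemma D_edge_point:
  assumes "adj x y" "0 \<le> s" "s \<le> t" "t \<le> 1"
  shows "D (edge_point x y s) (edge_point x y t) = t - s"
proof -
  have xy: "x \<in> V" "y \<in> V" "x \<noteq> y" "gd x y = 1" "gd y x = 1"
    using assms(1) adj_in adj_sym gd_adj by blast+
  consider "s = t" | "s = 0" "t = 1" | "0 < s" "s < t" "t < 1" | "s = 0" "0 < t" "t < 1" | "0 < s" "s < 1" "t = 1"
    using assms by fastforce
  then show ?thesis
  proof cases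
    case 1
    then show ?thesis using realization.mdist_zero edge_point_in assms by simp
  next
    case 2
    then show ?thesis using D_vertex xy by (simp add: edge_point_def)
  next
    case 3
    then show ?thesis using edge_point_in[of x y s] edge_point_in[of x y t] assms by (auto simp: D_def edge_point_def)
  next
    case 4
    have e: "D (vertex x) (x, y, t) = detour (vertex x) (x, y, t)"
      using edge_point_in[of x y t] assms xy 4 by (auto simp: D_def edge_point_def vertex_def points_def)
    moreover have "detour (vertex x) (x, y, t) \<le> t"
      using detour_le[of x 0 "vertex x" x t "(x, y, t)"] by (simp add: vertex_def)
    moreover have "t \<le> detour (vertex x) (x, y, t)"
      by (rule detour_attained[of "vertex x" "(x, y, t)"]) (use 4 xy in \<open>auto simp: vertex_def\<close>)
    ultimately show ?thesis using 4 by (simp add: edge_point_def)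
  next
    case 5
    have e: "D (x, y, s) (vertex y) = detour (x, y, s) (vertex y)"
      using edge_point_in[of x y s] assms xy 5 by (auto simp: D_def edge_point_def vertex_def points_def)
    moreover have "detour (x, y, s) (vertex y) \<le> 1 - s"
      using detour_le[of y "1 - s" "(x, y, s)" y 0 "vertex y"] by (simp add: vertex_def)
    moreover have "1 - s \<le> detour (x, y, s) (vertex y)"
      by (rule detour_attained[of "(x, y, s)" "vertex y"]) (use 5 xy in \<open>auto simp: vertex_def\<close>)
    ultimately show ?thesis using 5 by (simp add: edge_point_def)
  qed
qed

lemma edge_geodesic:
  assumes "adj x y" "0 \<le> s" "s \<le> t" "t \<le> 1"
  shows "\<exists>A. geodesic_between points D A (edge_point x y s) (edge_point x y t)"
  unfolding geodesic_between_def D_edge_point[OF assms]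
proof (intro exI[of _ "(\<lambda>r. edge_point x y (s + r)) ` {0..t - s}"] exI[of _ "\<lambda>r. edge_point x y (s + r)"] conjI ballI)
  show "(\<lambda>r. edge_point x y (s + r)) ` {0..t - s} \<subseteq> points" using edge_point_in assms by auto
  fix r r' assume r: "r \<in> {0..t - s}" "r' \<in> {0..t - s}"
  show "D (edge_point x y (s + r)) (edge_point x y (s + r')) = \<bar>r - r'\<bar>"
  proof (cases "r \<le> r'")
    case True
    then show ?thesis using D_edge_point[OF assms(1), of "s + r" "s + r'"] assms r by auto
  next
    case False
    then show ?thesis using D_edge_point[OF assms(1), of "s + r'" "s + r"] assms r realization.commute by auto
  qed
qed auto

lemma vertex_geodesic:
  "\<lbrakk>x \<in> V; y \<in> V; gd x y = n\<rbrakk> \<Longrightarrow> \<exists>A. geodesic_between points D A (vertex x) (vertex y)"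
proof (induction n arbitrary: y)
  case 0
  then have "x = y" using gd_eq_0 by blast
  then show ?case using geodesic_refl[OF D_metric] 0 by simp
next
  case (Suc n)
  obtain z where z: "z \<in> V" "gd x z = n" "gd z y = 1"
    using gd_split[of x y n] Suc.prems by auto
  then have "adj z y" using gd_eq_1 Suc.prems by blast
  then obtain B where B: "geodesic_between points D B (vertex z) (vertex y)"
    using edge_geodesic[of z y 0 1] by (auto simp: edge_point_def)
  obtain A where A: "geodesic_between points D A (vertex x) (vertex z)" using Suc z by blast
  show ?case using geodesic_concat[OF D_metric A B] D_vertex Suc.prems z by simp
qed

lemma port_geodesic:
  assumes "p \<in> points" "(u, a) \<in> ports p"
  shows "\<exists>A. geodesic_between points D A p (vertex u)" "D p (vertex u) \<le> a"
proof -
  consider x where "p = vertex x" "u = x" "x \<in> V" | x y t where "p = (x, y, t)" "adj x y" "0 < t" "t < 1"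
    using assms by (auto simp: points_def vertex_def)
  then have "(\<exists>A. geodesic_between points D A p (vertex u)) \<and> D p (vertex u) \<le> a"
  proof cases
    case 1
    then show ?thesis using geodesic_refl[OF D_metric, of p] ports_in[OF assms] by (simp add: D_vertex)
  next
    case 2
    have p: "p = edge_point x y t" using 2 by (simp add: edge_point_def)
    consider "u = x" "a = t" | "u = y" "a = 1 - t" using assms(2) 2 by auto
    then show ?thesis
    proof cases
      case 1
      obtain A where A: "geodesic_between points D A (vertex x) p"
        using edge_geodesic[OF 2(2), of 0 t] 2 p by (auto simp: edge_point_def)
      have "D (vertex x) p = t" using D_edge_point[OF 2(2), of 0 t] 2 p by (simp add: edge_point_def)
      then show ?thesis using geodesic_sym[OF D_metric A] 1 realization.commute[of p "vertex x"] by auto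
    next
      case b: 2
      then show ?thesis
        using edge_geodesic[OF 2(2), of t 1] D_edge_point[OF 2(2), of t 1] 2 p by (auto simp: edge_point_def)
    qed
  qed
  then show "\<exists>A. geodesic_between points D A p (vertex u)" "D p (vertex u) \<le> a" by blast+
qed

text \<open>
  On a common edge this is a segment. Otherwise a geodesic runs from \<open>p\<close> to a port, then through
  vertices, and from a port to \<open>q\<close>.
\<close>

lemma realization_geodesic:
  assumes "p \<in> points" "q \<in> points"
  shows "\<exists>A. geodesic_between points D A p q"
proof -
  obtain x y t x' y' t' where pq: "p = (x, y, t)" "q = (x', y', t')" by (metis prod_cases3)
  show ?thesis
  proof (cases "x = x' \<and> y = y'")
    case True
    show ?thesis
    proof (cases "p = q")
      case True
      then show ?thesis using geodesic_refl[OF D_metric] assms by blast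
    next
      case False
      then have e: "adj x y" "0 < t" "t < 1" "0 < t'" "t' < 1" using assms pq True adj_in[of x' x'] by (auto simp: points_def)
      then have "p = edge_point x y t" "q = edge_point x y t'" using pq True by (auto simp: edge_point_def)
      moreover have "\<exists>A. geodesic_between points D A (edge_point x y t) (edge_point x y t')"
      proof (cases "t \<le> t'")
        case True
        then show ?thesis using edge_geodesic[OF e(1), of t t'] e by auto
      next
        case False
        then show ?thesis using edge_geodesic[OF e(1), of t' t] geodesic_sym[OF D_metric] e by fastforce
      qed
      ultimately show ?thesis by simp
    qed
  next
    case False
    obtain u a v b where uv: "(u, a) \<in> ports p" "(v, b) \<in> ports q" "detour p q = a + real (gd u v) + b"
      using detour_attained by blast
    have V: "u \<in> V" "v \<in> V" using ports_in uv assms by blast+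
    have sum: "D p q = a + D (vertex u) (vertex v) + b" using False assms uv D_vertex V by (auto simp: D_def pq)
    have "D p q \<le> D p (vertex v) + D (vertex v) q" "D p (vertex v) \<le> D p (vertex u) + D (vertex u) (vertex v)"
      using realization.triangle assms V by auto
    moreover have "D p (vertex u) \<le> a" "D (vertex v) q \<le> b"
      using port_geodesic(2)[OF assms(1) uv(1)] port_geodesic(2)[OF assms(2) uv(2)]
        realization.commute[of q "vertex v"] by auto
    ultimately have e: "D p (vertex v) = D p (vertex u) + D (vertex u) (vertex v)"
      "D p q = D p (vertex v) + D (vertex v) q" using sum by linarith+
    obtain A B where "geodesic_between points D A p (vertex u)" "geodesic_between points D B (vertex u) (vertex v)"
      using port_geodesic(1) uv(1) assms vertex_geodesic V by metis
    then obtain C where C: "geodesic_between points D C p (vertex v)"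
      using geodesic_concat[OF D_metric] e(1) by blast
    obtain A where "geodesic_between points D A (vertex v) q"
      using port_geodesic(1)[OF assms(2) uv(2)] geodesic_sym[OF D_metric] by blast
    then show ?thesis using geodesic_concat[OF D_metric C] e(2) by blast
  qed
qed

lemma near_vertex:
  assumes "p \<in> points"
  obtains v where "v \<in> V" "D p (vertex v) \<le> 1"
proof -
  obtain u a where u: "(u, a) \<in> ports p" using ports_finite(2)[of p] by auto
  show ?thesis using that[of u] port_geodesic(2)[OF assms u] ports_in[OF assms u] by linarith
qed

lemma D_near_vertices:
  assumes "p \<in> points" "q \<in> points" "v \<in> V" "w \<in> V" "D p (vertex v) \<le> 1" "D q (vertex w) \<le> 1"
  shows "D p q \<le> gd v w + 2" "gd v w \<le> D p q + 2"
proof -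
  have "D p q \<le> D p (vertex v) + D (vertex v) q" "D (vertex v) q \<le> D (vertex v) (vertex w) + D (vertex w) q"
    "D (vertex v) (vertex w) \<le> D (vertex v) p + D p (vertex w)" "D p (vertex w) \<le> D p q + D q (vertex w)"
    using realization.triangle assms by auto
  then show "D p q \<le> gd v w + 2" "gd v w \<le> D p q + 2"
    using assms(5,6) D_vertex[OF assms(3,4)] realization.commute[of q "vertex w"] realization.commute[of p "vertex v"]
    by linarith+
qed

text \<open>
  Every point is at distance at most 1 from a vertex. Replacing points by vertices changes each of
  the three distances in an equation by at most 2, which accounts for the constant 6.
\<close>

lemma realization_hyperbolic:
  assumes thin: "\<And>x z p w. \<lbrakk>x \<in> V; z \<in> V; p \<in> V; w \<in> V; gd x p + gd p z \<le> gd x z + 6\<rbrakk> \<Longrightarrow>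
      gd x p + gd p w \<le> gd x w + C \<or> gd w p + gd p z \<le> gd w z + C"
  shows "Gromov_hyperbolic points D"
proof -
  have "delta_hyperbolic points D (2 * (real C + 6) + 1)"
  proof (rule slim_from_thin[OF D_metric])
    fix x z w p assume in': "x \<in> points" "z \<in> points" "w \<in> points" "p \<in> points" and eq: "D x p + D p z = D x z"
    obtain x' z' w' p' where V: "x' \<in> V" "z' \<in> V" "w' \<in> V" "p' \<in> V"
      and n: "D x (vertex x') \<le> 1" "D z (vertex z') \<le> 1" "D w (vertex w') \<le> 1" "D p (vertex p') \<le> 1"
      using near_vertex in' by metis
    note b = D_near_vertices
    have "real (gd x' p') + real (gd p' z') \<le> real (gd x' z') + 6"
      using b(2)[OF in'(1,4) V(1,4) n(1,4)] b(2)[OF in'(4,2) V(4,2) n(4,2)] b(1)[OF in'(1,2) V(1,2) n(1,2)] eq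
      by linarith
    then have "gd x' p' + gd p' z' \<le> gd x' z' + 6" by linarith
    then consider "gd x' p' + gd p' w' \<le> gd x' w' + C" | "gd w' p' + gd p' z' \<le> gd w' z' + C"
      using thin V by blast
    then show "D x p + D p w \<le> D x w + (real C + 6) \<or> D w p + D p z \<le> D w z + (real C + 6)"
    proof cases
      case 1
      then have "real (gd x' p') + real (gd p' w') \<le> real (gd x' w') + real C" by linarith
      then show ?thesis
        using b(1)[OF in'(1,4) V(1,4) n(1,4)] b(1)[OF in'(4,3) V(4,3) n(4,3)] b(2)[OF in'(1,3) V(1,3) n(1,3)]
        by linarith
    next
      case 2
      then have "real (gd w' p') + real (gd p' z') \<le> real (gd w' z') + real C" by linarith
      then show ?thesis
        using b(1)[OF in'(3,4) V(3,4) n(3,4)] b(1)[OF in'(4,2) V(4,2) n(4,2)] b(2)[OF in'(3,2) V(3,2) n(3,2)]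
        by linarith
    qed
  qed simp
  moreover have "geodesic_space points D" unfolding geodesic_space_def using D_metric realization_geodesic by blast
  ultimately show ?thesis unfolding Gromov_hyperbolic_def by (intro conjI exI[of _ "2 * (real C + 6) + 1"]) auto
qed

end

section \<open>Collapsing families in a convergence group\<close>

context convergence_group
begin

abbreviation M :: "'m set" where "M \<equiv> topspace X"

text \<open>
  The convergence \<open>g\<^sub>n \<rightarrow> b\<close> on the complement of \<open>a\<close>, stated for a family instead of a sequence:
  \<open>eventually\<close> becomes \<open>for all but finitely many elements\<close>. In this form passing to an infinite subfamily
  needs no reindexing.
\<close>

definition collapses :: "'g set \<Rightarrow> 'm \<Rightarrow> 'm \<Rightarrow> bool" where
  "collapses F a b \<longleftrightarrow> F \<subseteq> carrier G \<and> infinite F \<and> a \<in> M \<and> b \<in> M \<and>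
     (\<forall>K U. compactin X K \<and> K \<subseteq> M - {a} \<and> openin X U \<and> b \<in> U \<longrightarrow> finite {g \<in> F. \<not> \<phi> g ` K \<subseteq> U})"

lemma collapsesD:
  assumes "collapses F a b"
  shows "F \<subseteq> carrier G" "infinite F" "a \<in> M" "b \<in> M"
  using assms by (auto simp: collapses_def)

lemma collapses_compact:
  assumes "collapses F a b" "compactin X K" "a \<notin> K" "openin X U" "b \<in> U"
  shows "finite {g \<in> F. \<not> \<phi> g ` K \<subseteq> U}"
  using assms compactin_subset_topspace[OF assms(2)] unfolding collapses_def by blast

lemma collapses_point:
  assumes "collapses F a b" "x \<in> M" "x \<noteq> a" "openin X U" "b \<in> U"
  shows "finite {g \<in> F. \<phi> g x \<notin> U}"
  using collapses_compact[OF assms(1), of "{x}" U] assms by simp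

lemma collapses_subset:
  assumes "collapses F a b" "F' \<subseteq> F" "infinite F'"
  shows "collapses F' a b"
proof -
  have "finite {g \<in> F'. \<not> \<phi> g ` K \<subseteq> U}"
    if KU: "compactin X K" "K \<subseteq> M - {a}" "openin X U" "b \<in> U" for K U
  proof (rule finite_subset)
    show "finite {g \<in> F. \<not> \<phi> g ` K \<subseteq> U}"
      by (rule collapses_compact[OF assms(1) KU(1) _ KU(3,4)]) (use KU(2) in blast)
    show "{g \<in> F'. \<not> \<phi> g ` K \<subseteq> U} \<subseteq> {g \<in> F. \<not> \<phi> g ` K \<subseteq> U}" using assms(2) by blast
  qed
  then show ?thesis using assms unfolding collapses_def by blast
qed

lemma infinite_family_collapses:
  assumes "F \<subseteq> carrier G" "infinite F"
  obtains F' a b where "F' \<subseteq> F" "collapses F' a b"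
proof -
  obtain f :: "nat \<Rightarrow> 'g" where f: "inj f" "range f \<subseteq> F"
    using infinite_countable_subset[OF assms(2)] by blast
  then have "range f \<subseteq> carrier G" using assms(1) by blast
  from convergence[OF this f(1)]
  obtain r :: "nat \<Rightarrow> nat" and a b where r: "strict_mono r" "a \<in> M" "b \<in> M"
    and conv: "\<And>K U. compactin X K \<Longrightarrow> K \<subseteq> M - {a} \<Longrightarrow> openin X U \<Longrightarrow> b \<in> U \<Longrightarrow>
      \<exists>N. \<forall>k. r k > N \<longrightarrow> \<phi> (f (r k)) ` K \<subseteq> U"
    by metis
  define F' where "F' = range (\<lambda>k. f (r k))"
  have inj: "inj (\<lambda>k. f (r k))"
    using f(1) strict_mono_eq[OF r(1)] by (auto simp: inj_def)
  have "finite {g \<in> F'. \<not> \<phi> g ` K \<subseteq> U}"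
    if KU: "compactin X K" "K \<subseteq> M - {a}" "openin X U" "b \<in> U" for K U
  proof -
    obtain N where N: "\<And>k. r k > N \<Longrightarrow> \<phi> (f (r k)) ` K \<subseteq> U" using conv[OF KU] by blast
    have "{g \<in> F'. \<not> \<phi> g ` K \<subseteq> U} \<subseteq> (\<lambda>k. f (r k)) ` {..N}"
    proof
      fix g assume g: "g \<in> {g \<in> F'. \<not> \<phi> g ` K \<subseteq> U}"
      then obtain k where k: "g = f (r k)" by (auto simp: F'_def)
      then have "r k \<le> N" using g N[of k] by (metis (no_types, lifting) mem_Collect_eq not_le)
      then have "k \<le> N" using seq_suble[OF r(1), of k] by linarith
      then show "g \<in> (\<lambda>k. f (r k)) ` {..N}" using k by auto
    qed
    then show ?thesis using finite_subset by blast
  qed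
  moreover have "infinite F'" using inj by (auto simp: F'_def finite_image_iff)
  moreover have "F' \<subseteq> F" using f(2) by (auto simp: F'_def)
  ultimately show ?thesis using that[of F' a b] r assms(1) by (auto simp: collapses_def)
qed

lemma cofinite_ex2:
  assumes "infinite F" "finite {g \<in> F. \<not> P g}" "finite {g \<in> F. \<not> Q g}"
  shows "\<exists>g\<in>F. P g \<and> Q g"
proof (rule ccontr)
  assume "\<not> ?thesis"
  then have "F \<subseteq> {g \<in> F. \<not> P g} \<union> {g \<in> F. \<not> Q g}" by auto
  then show False using assms by (meson finite_UnI finite_subset)
qed

lemma cofinite_ex: "infinite F \<Longrightarrow> finite {g \<in> F. \<not> P g} \<Longrightarrow> \<exists>g\<in>F. P g"
  using cofinite_ex2[of F P P] by auto

lemma closed_compact: "closedin X C \<Longrightarrow> compactin X C"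
  using compact closedin_compact_space by blast

lemma hausdorff: "Hausdorff_space X"
  by (rule metrizable_imp_Hausdorff_space[OF metrizable])

lemma separate_points:
  assumes "x \<in> M" "y \<in> M" "x \<noteq> y"
  obtains U V where "openin X U" "openin X V" "x \<in> U" "y \<in> V" "U \<inter> V = {}"
proof -
  have "\<exists>U V. openin X U \<and> openin X V \<and> x \<in> U \<and> y \<in> V \<and> disjnt U V"
    using hausdorff assms unfolding Hausdorff_space_def by blast
  then show ?thesis using that by (auto simp: disjnt_def)
qed

lemma closed_singleton: "x \<in> M \<Longrightarrow> closedin X {x}"
  using hausdorff by (simp add: closedin_Hausdorff_singleton)

lemma open_minus_point: "openin X U \<Longrightarrow> x \<in> M \<Longrightarrow> openin X (U - {x})"
  using closed_singleton openin_diff by blast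

definition closed_nbhd :: "'m \<Rightarrow> 'm set \<Rightarrow> bool" where
  "closed_nbhd x C \<longleftrightarrow> closedin X C \<and> (\<exists>U. openin X U \<and> x \<in> U \<and> U \<subseteq> C)"

lemma closed_nbhd_exists:
  assumes "openin X W" "x \<in> W"
  obtains C where "closed_nbhd x C" "C \<subseteq> W"
proof -
  have "neighbourhood_base_of (closedin X) X"
    using metrizable_imp_regular_space[OF metrizable] by (simp add: neighbourhood_base_of_closedin)
  then have "\<exists>U C. openin X U \<and> closedin X C \<and> x \<in> U \<and> U \<subseteq> C \<and> C \<subseteq> W"
    using assms by (simp add: neighbourhood_base_of)
  then obtain U C where "openin X U" "closedin X C" "x \<in> U" "U \<subseteq> C" "C \<subseteq> W" by auto
  then show ?thesis using that[of C] unfolding closed_nbhd_def by auto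
qed

lemma closed_nbhd_Int:
  assumes "closed_nbhd x C" "closed_nbhd x D"
  shows "closed_nbhd x (C \<inter> D)"
proof -
  obtain U V where "openin X U" "x \<in> U" "U \<subseteq> C" "openin X V" "x \<in> V" "V \<subseteq> D"
    using assms unfolding closed_nbhd_def by auto
  then have "openin X (U \<inter> V)" "x \<in> U \<inter> V" "U \<inter> V \<subseteq> C \<inter> D" by auto
  moreover have "closedin X (C \<inter> D)" using assms closedin_Int unfolding closed_nbhd_def by auto
  ultimately show ?thesis unfolding closed_nbhd_def by auto
qed

lemma closed_nbhdD: "closed_nbhd x C \<Longrightarrow> x \<in> C \<and> closedin X C \<and> C \<subseteq> M"
  unfolding closed_nbhd_def using closedin_subset[of X C] by auto

lemma act_in: "\<lbrakk>g \<in> carrier G; x \<in> M\<rbrakk> \<Longrightarrow> \<phi> g x \<in> M"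
  using element_image by blast

lemma act_mult: "\<lbrakk>g \<in> carrier G; h \<in> carrier G; x \<in> M\<rbrakk> \<Longrightarrow> \<phi> (g \<otimes> h) x = \<phi> g (\<phi> h x)"
  using composition_rule by blast

lemma act_one: "x \<in> M \<Longrightarrow> \<phi> \<one> x = x"
  using fun_cong[OF id_eq_one, of x] by simp

lemma is_group: "group G"
  using group_hom group_hom_def by blast

lemma act_inv: "\<lbrakk>g \<in> carrier G; x \<in> M\<rbrakk> \<Longrightarrow> \<phi> (inv g) (\<phi> g x) = x"
  using orbit_sym_aux by blast

lemma act_inv': "\<lbrakk>g \<in> carrier G; x \<in> M\<rbrakk> \<Longrightarrow> \<phi> g (\<phi> (inv g) x) = x"
  using act_inv[of "inv g" x] group.inv_closed[OF is_group] group.inv_inv[OF is_group] by simp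

lemma act_inj: "\<lbrakk>g \<in> carrier G; x \<in> M; y \<in> M; \<phi> g x = \<phi> g y\<rbrakk> \<Longrightarrow> x = y"
  using inj_onD[OF inj_prop] by blast

lemma act_image_mult: "\<lbrakk>g \<in> carrier G; h \<in> carrier G; A \<subseteq> M\<rbrakk> \<Longrightarrow> \<phi> (g \<otimes> h) ` A = \<phi> g ` \<phi> h ` A"
  unfolding image_image by (rule image_cong) (auto intro: act_mult)

lemma open_preimage: "\<lbrakk>g \<in> carrier G; openin X U\<rbrakk> \<Longrightarrow> openin X {x \<in> M. \<phi> g x \<in> U}"
  using homeomorphism homeomorphic_imp_continuous_map openin_continuous_map_preimage by blast

lemma closed_preimage: "\<lbrakk>g \<in> carrier G; closedin X C\<rbrakk> \<Longrightarrow> closedin X {x \<in> M. \<phi> g x \<in> C}"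
  using homeomorphism homeomorphic_imp_continuous_map closedin_continuous_map_preimage by blast

text \<open>
  If the source and the target of a collapsing family coincide, compose the family with an element
  that moves the target. Such an element exists, for otherwise the group would fix a point.
\<close>

lemma exists_collapse_distinct:
  assumes "\<not> elementary_action G X \<phi>"
  obtains F a b where "collapses F a b" "a \<noteq> b"
proof -
  interpret G: group G by (rule is_group)
  obtain F a b where F: "collapses F a b"
    using infinite_family_collapses[OF subset_refl infinite_group] by blast
  note ab = collapsesD[OF F]
  show ?thesis
  proof (cases "\<exists>f\<in>carrier G. \<phi> f b \<noteq> a")
    case False
    then have fix_a: "\<phi> f b = a" if "f \<in> carrier G" for f using that by blast
    have "b = a" using fix_a[of \<one>] act_one ab by simp
    then have "\<forall>g\<in>carrier G. \<phi> g ` {a} = {a}" using fix_a by auto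
    then have "elementary_action G X \<phi>"
      unfolding elementary_action_def using ab by (intro exI[of _ "{a}"]) auto
    then show ?thesis using assms by contradiction
  next
    case True
    then obtain f where f: "f \<in> carrier G" "\<phi> f b \<noteq> a" by blast
    let ?F = "(\<lambda>g. f \<otimes> g) ` F"
    have "inj_on (\<lambda>g. f \<otimes> g) F" using ab(1) f(1) by (auto intro!: inj_onI simp: subset_iff)
    then have "infinite ?F" using ab(2) by (simp add: finite_image_iff)
    moreover have "finite {g \<in> ?F. \<not> \<phi> g ` K \<subseteq> U}"
      if KU: "compactin X K" "K \<subseteq> M - {a}" "openin X U" "\<phi> f b \<in> U" for K U
    proof -
      have "finite {g \<in> F. \<not> \<phi> g ` K \<subseteq> {x \<in> M. \<phi> f x \<in> U}}"
        using collapses_compact[OF F KU(1) _ open_preimage[OF f(1) KU(3)]] KU ab by auto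
      moreover have "{g \<in> ?F. \<not> \<phi> g ` K \<subseteq> U} \<subseteq> (\<lambda>g. f \<otimes> g) ` {g \<in> F. \<not> \<phi> g ` K \<subseteq> {x \<in> M. \<phi> f x \<in> U}}"
      proof
        fix g assume "g \<in> {g \<in> ?F. \<not> \<phi> g ` K \<subseteq> U}"
        then obtain g' where g': "g = f \<otimes> g'" "g' \<in> F" "\<not> \<phi> (f \<otimes> g') ` K \<subseteq> U" by auto
        then obtain x where "x \<in> K" "\<phi> (f \<otimes> g') x \<notin> U" by auto
        moreover have "\<phi> (f \<otimes> g') x = \<phi> f (\<phi> g' x)"
          using act_mult[of f g' x] f g' ab \<open>x \<in> K\<close> KU by auto
        ultimately show "g \<in> (\<lambda>g. f \<otimes> g) ` {g \<in> F. \<not> \<phi> g ` K \<subseteq> {x \<in> M. \<phi> f x \<in> U}}"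
          using g' by auto
      qed
      ultimately show ?thesis using finite_subset by blast
    qed
    ultimately have "collapses ?F a (\<phi> f b)"
      using ab f act_in unfolding collapses_def by auto
    then show ?thesis using that f by blast
  qed
qed

section \<open>Loxodromic elements\<close>

text \<open>
  The condition \<open>A \<union> B \<noteq> M\<close> leaves a point that no positive power of \<open>h\<close> fixes, so \<open>h\<close> has infinite order.
\<close>

definition contracts :: "'g \<Rightarrow> 'm set \<Rightarrow> 'm set \<Rightarrow> 'm set \<Rightarrow> 'm set \<Rightarrow> bool" where
  "contracts h U A W B \<longleftrightarrow> h \<in> carrier G \<and> openin X U \<and> closedin X A \<and> openin X W \<and> closedin X B \<and>
     U \<noteq> {} \<and> U \<subseteq> A \<and> W \<subseteq> B \<and> A \<inter> B = {} \<and> A \<union> B \<noteq> M \<and> \<phi> h ` (M - U) \<subseteq> W"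

lemma exists_contraction:
  assumes "\<not> elementary_action G X \<phi>"
  obtains h U A W B where "contracts h U A W B" "W \<noteq> {}"
proof -
  obtain F a b where F: "collapses F a b" "a \<noteq> b" using exists_collapse_distinct[OF assms] .
  note ab = collapsesD[OF F(1)]
  have "infinite (M - {a, b})" using infinite_space by simp
  then have "M - {a, b} \<noteq> {}" by (metis finite.emptyI)
  then obtain c where c: "c \<in> M" "c \<noteq> a" "c \<noteq> b" by blast
  obtain Ua Ub where ops: "openin X Ua" "openin X Ub" "a \<in> Ua" "b \<in> Ub" "Ua \<inter> Ub = {}"
    using separate_points[OF ab(3,4) F(2)] .
  obtain A where A: "closed_nbhd a A" "A \<subseteq> Ua - {c}"
    using closed_nbhd_exists[OF open_minus_point[OF ops(1) c(1)], of a] ops c by auto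
  obtain B where B: "closed_nbhd b B" "B \<subseteq> Ub - {c}"
    using closed_nbhd_exists[OF open_minus_point[OF ops(2) c(1)], of b] ops c by auto
  obtain U where U: "openin X U" "a \<in> U" "U \<subseteq> A" using A unfolding closed_nbhd_def by blast
  obtain W where W: "openin X W" "b \<in> W" "W \<subseteq> B" using B unfolding closed_nbhd_def by blast
  have "compactin X (M - U)" using closed_compact U(1) by blast
  then have fin: "finite {g \<in> F. \<not> \<phi> g ` (M - U) \<subseteq> W}" using collapses_compact F(1) U(2) W by blast
  obtain h where h: "h \<in> F" "\<phi> h ` (M - U) \<subseteq> W" using cofinite_ex[OF ab(2) fin] by auto
  have "h \<in> carrier G" "closedin X A" "closedin X B" using h ab A B closed_nbhdD by auto
  moreover have "A \<inter> B = {}" "c \<notin> A \<union> B" using A(2) B(2) ops(5) by auto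
  ultimately have "contracts h U A W B"
    unfolding contracts_def using U W h c by auto
  then show ?thesis using that[of h U A W B] W by auto
qed

lemma contracts_inverse:
  assumes "contracts h U A W B" "W \<noteq> {}"
  shows "contracts (inv h) W B U A"
proof -
  interpret G: group G by (rule is_group)
  have h: "h \<in> carrier G" "\<phi> h ` (M - U) \<subseteq> W" "U \<subseteq> M" using assms openin_subset by (auto simp: contracts_def)
  have "\<phi> (inv h) x \<in> U" if "x \<in> M - W" for x
  proof (rule ccontr)
    assume "\<phi> (inv h) x \<notin> U"
    then have "\<phi> h (\<phi> (inv h) x) \<in> W" using h that act_in[of "inv h" x] by auto
    then show False using act_inv'[of h x] h that by auto
  qed
  then show ?thesis using assms unfolding contracts_def by (auto simp: Int_commute Un_commute)
qed

lemma contracts_powers: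
  assumes "contracts h U A W B" "x \<in> M - U"
  shows "\<phi> (h [^] Suc n) x \<in> W"
proof (induction n)
  interpret G: group G by (rule is_group)
  have h: "h \<in> carrier G" "\<phi> h ` (M - U) \<subseteq> W" using assms by (auto simp: contracts_def)
  case 0
  then show ?case using h assms(2) by auto
next
  interpret G: group G by (rule is_group)
  have h: "h \<in> carrier G" "\<phi> h ` (M - U) \<subseteq> W" "W \<subseteq> M - U"
    using assms openin_subset[of X W] by (auto simp: contracts_def)
  case (Suc n)
  have "h [^] Suc (Suc n) = h \<otimes> h [^] Suc n" using h(1) G.nat_pow_Suc2 by blast
  then have "\<phi> (h [^] Suc (Suc n)) x = \<phi> h (\<phi> (h [^] Suc n) x)"
    using act_mult[of h "h [^] Suc n" x] h assms(2) by simp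
  then show ?case using Suc h by auto
qed

lemma contracts_powers_distinct:
  assumes "contracts h U A W B"
  shows "inj (\<lambda>n::nat. h [^] n)"
proof (rule linorder_injI)
  interpret G: group G by (rule is_group)
  have h: "h \<in> carrier G" using assms by (auto simp: contracts_def)
  fix m n :: nat assume "m < n"
  then obtain k where k: "n = m + Suc k" using less_iff_Suc_add by auto
  show "h [^] m \<noteq> h [^] n"
  proof
    assume "h [^] m = h [^] n"
    moreover have "h [^] m \<otimes> h [^] Suc k = h [^] n"
      using G.nat_pow_mult[OF h, of m "Suc k"] k by (simp del: G.nat_pow_Suc)
    ultimately have "h [^] m \<otimes> h [^] Suc k = h [^] m \<otimes> \<one>" using h by simp
    then have one: "h [^] Suc k = \<one>"
      using h G.Units_l_cancel[of "h [^] m" "h [^] Suc k" \<one>] by (simp del: G.nat_pow_Suc)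
    have "A \<union> B \<subseteq> M" using assms closedin_subset[of X] by (auto simp: contracts_def)
    then obtain c where c: "c \<in> M" "c \<notin> A" "c \<notin> B" using assms by (auto simp: contracts_def)
    have "\<phi> (h [^] Suc k) c \<in> W" using contracts_powers[OF assms, of c k] c assms by (auto simp: contracts_def)
    then show False using one act_one c assms by (auto simp: contracts_def)
  qed
qed

text \<open>
  The target of a collapsing family of powers of \<open>h\<close> is fixed by \<open>h\<close>, because \<open>h\<close> commutes with its powers.
  The source lies in \<open>A\<close>, because otherwise some power would push \<open>A\<close> off itself, while it already moves
  the complement of \<open>U\<close> into \<open>W\<close>: it would not be onto.
\<close>

lemma contraction_limit:
  assumes "contracts h U A W B"
  obtains F a b where "F \<subseteq> range (\<lambda>n::nat. h [^] n)" "collapses F a b" "a \<in> A" "b \<in> B" "\<phi> h b = b"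
proof -
  interpret G: group G by (rule is_group)
  have h: "h \<in> carrier G" "closedin X A" "closedin X B" "U \<subseteq> A" "W \<subseteq> B" "A \<inter> B = {}" "U \<noteq> {}"
    using assms by (auto simp: contracts_def)
  have AM: "A \<subseteq> M" "B \<subseteq> M" using h closedin_subset by blast+
  have "range (\<lambda>n::nat. h [^] n) \<subseteq> carrier G" using h by auto
  moreover have "infinite (range (\<lambda>n::nat. h [^] n))"
    using contracts_powers_distinct[OF assms] by (simp add: finite_image_iff)
  ultimately obtain F0 a b where F0: "F0 \<subseteq> range (\<lambda>n::nat. h [^] n)" "collapses F0 a b"
    using infinite_family_collapses by blast
  \<comment> \<open>The zeroth power would not move points towards \<open>b\<close>.\<close>
  define F where "F = F0 - {\<one>}"
  have F: "collapses F a b"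
    by (rule collapses_subset[OF F0(2)]) (use collapsesD[OF F0(2)] in \<open>auto simp: F_def\<close>)
  note ab = collapsesD[OF F]
  have pos: "\<exists>n. g = h [^] Suc n" if "g \<in> F" for g
  proof -
    have g: "g \<in> F0" "g \<noteq> \<one>" using \<open>g \<in> F\<close> by (auto simp: F_def)
    then obtain n where n: "g = h [^] (n::nat)" using F0(1) by blast
    then show ?thesis using g by (cases n) auto
  qed
  have into: "\<phi> g x \<in> W" if "g \<in> F" "x \<in> M - U" for g x
    using contracts_powers[OF assms that(2)] pos[OF that(1)] by auto
  have commutes: "\<phi> g (\<phi> h x) = \<phi> h (\<phi> g x)" if "g \<in> F" "x \<in> M" for g x
  proof -
    obtain n where n: "g = h [^] Suc n" using pos \<open>g \<in> F\<close> by blast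
    have "g \<otimes> h = h \<otimes> g" unfolding n using h(1) G.nat_pow_Suc2[of h "Suc n"] by simp
    then show ?thesis using act_mult[of g h x] act_mult[of h g x] h ab that by auto
  qed
  have b: "b \<in> B"
  proof (rule ccontr)
    assume nb: "b \<notin> B"
    obtain c where c: "c \<in> M" "c \<notin> A" "c \<notin> B" using assms AM by (auto simp: contracts_def)
    have "\<phi> h ` (M - U) \<subseteq> W" using assms by (simp add: contracts_def)
    then have hc: "\<phi> h c \<in> W" using c h(4) by blast
    then have hcM: "\<phi> h c \<in> M - U" "\<phi> h c \<noteq> c" using h c AM by auto
    then obtain x where x: "x \<in> M - U" "x \<noteq> a" using c h by (cases "c = a") auto
    have op: "openin X (M - B)" using h by blast
    have fin: "finite {g \<in> F. \<phi> g x \<notin> M - B}" using collapses_point[OF F _ x(2) op] x nb ab by auto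
    obtain g where "g \<in> F" "\<phi> g x \<in> M - B" using cofinite_ex[OF ab(2) fin] by auto
    then show False using into[of g x] x h by auto
  qed
  have a: "a \<in> A"
  proof (rule ccontr)
    assume na: "a \<notin> A"
    have op: "openin X (M - A)" using h by blast
    have fin: "finite {g \<in> F. \<not> \<phi> g ` A \<subseteq> M - A}"
      using collapses_compact[OF F closed_compact[OF h(2)] na op] b h(6) AM by blast
    obtain g where g: "g \<in> F" "\<phi> g ` A \<subseteq> M - A" using cofinite_ex[OF ab(2) fin] by auto
    have gG: "g \<in> carrier G" using g ab by auto
    obtain y where y: "y \<in> A" using h by auto
    have "\<phi> (inv g) y \<in> M" using act_in gG y AM by auto
    moreover have "\<phi> g (\<phi> (inv g) y) = y" using act_inv' gG y AM by auto
    ultimately show False using g(2) into[OF g(1), of "\<phi> (inv g) y"] y h by (cases "\<phi> (inv g) y \<in> A") auto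
  qed
  have "\<phi> h b = b"
  proof (rule ccontr)
    assume ne: "\<phi> h b \<noteq> b"
    obtain V V' where V: "openin X V" "openin X V'" "b \<in> V" "\<phi> h b \<in> V'" "V \<inter> V' = {}"
      using separate_points[of b "\<phi> h b"] ne ab act_in h by metis
    have "infinite (M - {a, \<phi> (inv h) a})" using infinite_space by simp
    then have "M - {a, \<phi> (inv h) a} \<noteq> {}" by (metis finite.emptyI)
    then obtain x where x: "x \<in> M" "x \<noteq> a" "x \<noteq> \<phi> (inv h) a" by blast
    have hx: "\<phi> h x \<in> M" "\<phi> h x \<noteq> a" using act_in act_inv x h by auto
    have op: "openin X {y \<in> M. \<phi> h y \<in> V'}" using open_preimage h V by blast
    have "finite {g \<in> F. \<phi> g x \<notin> {y \<in> M. \<phi> h y \<in> V'}}" using collapses_point[OF F x(1,2) op] V ab by auto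
    moreover have "finite {g \<in> F. \<phi> g (\<phi> h x) \<notin> V}" using collapses_point[OF F hx V(1)] V by auto
    ultimately obtain g where "g \<in> F" "\<phi> g x \<in> {y \<in> M. \<phi> h y \<in> V'}" "\<phi> g (\<phi> h x) \<in> V"
      using cofinite_ex2[OF ab(2), of "\<lambda>g. \<phi> g x \<in> {y \<in> M. \<phi> h y \<in> V'}" "\<lambda>g. \<phi> g (\<phi> h x) \<in> V"] by auto
    then show False using commutes[of g x] x V by auto
  qed
  then show ?thesis using that[of F a b] F a b F0(1) by (auto simp: F_def)
qed

definition loxodromic :: "'g \<Rightarrow> 'm \<Rightarrow> 'm \<Rightarrow> bool" where
  "loxodromic h p q \<longleftrightarrow> h \<in> carrier G \<and> p \<in> M \<and> q \<in> M \<and> p \<noteq> q \<and> \<phi> h p = p \<and> \<phi> h q = q \<and>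
     inj (\<lambda>n::nat. h [^] n) \<and>
     (\<exists>F\<subseteq>range (\<lambda>n::nat. h [^] n). collapses F p q) \<and>
     (\<exists>F\<subseteq>range (\<lambda>n::nat. inv h [^] n). collapses F q p)"

lemma fixed_by_powers:
  assumes "h \<in> carrier G" "x \<in> M" "\<phi> h x = x"
  shows "\<phi> (h [^] (n::nat)) x = x"
proof (induction n)
  interpret G: group G by (rule is_group)
  case 0
  then show ?case using act_one assms by simp
next
  interpret G: group G by (rule is_group)
  case (Suc n)
  then show ?case using act_mult[of "h [^] n" h x] assms by simp
qed

text \<open>
  Both \<open>h\<close> and its inverse contract, with targets \<open>q\<close> and \<open>p\<close>. Since \<open>p\<close> is fixed by \<open>h\<close>, it is not attracted
  to \<open>q\<close>, so it must be the source for \<open>h\<close>. In the same way \<open>q\<close> is the source for the inverse.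
\<close>

lemma exists_loxodromic:
  assumes "\<not> elementary_action G X \<phi>"
  obtains h p q where "loxodromic h p q"
proof -
  interpret G: group G by (rule is_group)
  obtain h U A W B where h: "contracts h U A W B" "W \<noteq> {}" using exists_contraction[OF assms] .
  note h' = contracts_inverse[OF h]
  obtain F a q where F: "F \<subseteq> range (\<lambda>n::nat. h [^] n)" "collapses F a q" "a \<in> A" "q \<in> B" "\<phi> h q = q"
    using contraction_limit[OF h(1)] .
  obtain F' b p where F': "F' \<subseteq> range (\<lambda>n::nat. inv h [^] n)" "collapses F' b p" "b \<in> B" "p \<in> A" "\<phi> (inv h) p = p"
    using contraction_limit[OF h'] .
  have hG: "h \<in> carrier G" "A \<inter> B = {}" using h by (auto simp: contracts_def)
  note ab = collapsesD[OF F(2)] collapsesD[OF F'(2)]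
  have hp: "\<phi> h p = p" using act_inv'[of h p] F'(5) hG ab by simp
  have hq: "\<phi> (inv h) q = q" using act_inv[of h q] F(5) hG ab by simp
  have pq: "p \<noteq> q" using F F' hG by auto
  have fixed_is_source: "x = s"
    if E: "collapses E s t" "E \<subseteq> range (\<lambda>n::nat. k [^] n)" "k \<in> carrier G" "x \<in> M" "x \<noteq> t" "\<phi> k x = x" for E s t k x
  proof (rule ccontr)
    assume "x \<noteq> s"
    then have fin: "finite {g \<in> E. \<phi> g x \<notin> M - {x}}"
      using collapses_point[OF E(1,4), of "M - {x}"] E open_minus_point[of M x] collapsesD[OF E(1)] by auto
    obtain g where "g \<in> E" "\<phi> g x \<in> M - {x}" using cofinite_ex[OF collapsesD(2)[OF E(1)] fin] by auto
    then show False using fixed_by_powers[OF E(3,4,6)] E(2) by auto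
  qed
  have "p = a" using fixed_is_source[OF F(2,1) hG(1) _ pq hp] ab by auto
  moreover have "q = b" using fixed_is_source[OF F'(2,1) _ _ pq[symmetric] hq] ab hG by auto
  ultimately have "loxodromic h p q" unfolding loxodromic_def using F F' hG hp ab pq contracts_powers_distinct[OF h(1)] by blast
  then show ?thesis using that by blast
qed

end

section \<open>Annuli that never cross\<close>

context convergence_group
begin

definition crossing :: "'g \<Rightarrow> 'm set \<Rightarrow> 'm set \<Rightarrow> bool" where
  "crossing g P Q \<longleftrightarrow> \<phi> g ` P \<inter> P \<noteq> {} \<and> \<phi> g ` P \<inter> Q \<noteq> {} \<and> \<phi> g ` Q \<inter> P \<noteq> {} \<and> \<phi> g ` Q \<inter> Q \<noteq> {}"

lemma crossing_mono: "crossing g P Q \<Longrightarrow> P \<subseteq> P' \<Longrightarrow> Q \<subseteq> Q' \<Longrightarrow> crossing g P' Q'"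
  unfolding crossing_def by blast

text \<open>
  In a collapsing family almost all elements move that one of the two disjoint sets which avoids the
  source into a small neighbourhood of the target. One of the two sets avoids this neighbourhood.
\<close>

lemma finite_crossing:
  assumes "closedin X P" "closedin X Q" "P \<inter> Q = {}"
  shows "finite {g \<in> carrier G. crossing g P Q}"
proof (rule ccontr)
  assume inf: "infinite {g \<in> carrier G. crossing g P Q}"
  obtain F a b where F: "F \<subseteq> {g \<in> carrier G. crossing g P Q}" "collapses F a b"
    using infinite_family_collapses[OF _ inf] by auto
  obtain A where A: "A = P \<or> A = Q" "a \<notin> A" using assms(3) by auto
  obtain B where B: "B = P \<or> B = Q" "b \<notin> B" using assms(3) by auto
  have cl: "closedin X A" "closedin X B" using A B assms by auto
  have "b \<in> M - B" using B collapsesD[OF F(2)] by auto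
  then have fin: "finite {g \<in> F. \<not> \<phi> g ` A \<subseteq> M - B}"
    using collapses_compact[OF F(2) closed_compact[OF cl(1)] A(2), of "M - B"] cl(2) by auto
  then obtain g where g: "g \<in> F" "\<phi> g ` A \<subseteq> M - B" using cofinite_ex[OF collapsesD(2)[OF F(2)] fin] by auto
  then have "\<phi> g ` A \<inter> B = {}" by auto
  moreover have "crossing g P Q" using F g by auto
  ultimately show False using A(1) B(1) unfolding crossing_def by auto
qed

text \<open>
  The point \<open>\<phi> g p\<close> cannot equal both \<open>p\<close> and \<open>q\<close>.
\<close>

lemma uncross:
  assumes "g \<in> carrier G" "p \<in> M" "q \<in> M" "p \<noteq> q"
  obtains C D where "closed_nbhd p C" "closed_nbhd q D" "\<not> crossing g C D"
proof -
  have full: "closed_nbhd x M" if "x \<in> M" for x using that unfolding closed_nbhd_def by auto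
  show ?thesis
  proof (cases "\<phi> g p = p")
    case False
    obtain U V where UV: "openin X U" "openin X V" "\<phi> g p \<in> U" "p \<in> V" "U \<inter> V = {}"
      using separate_points[OF act_in[OF assms(1,2)] assms(2) False] .
    have "openin X ({x \<in> M. \<phi> g x \<in> U} \<inter> V)" using open_preimage[OF assms(1) UV(1)] UV(2) by auto
    then obtain C where C: "closed_nbhd p C" "C \<subseteq> {x \<in> M. \<phi> g x \<in> U} \<inter> V"
      using closed_nbhd_exists[of "{x \<in> M. \<phi> g x \<in> U} \<inter> V" p] UV assms by auto
    then have "\<phi> g ` C \<inter> C = {}" using UV(5) by auto
    then show ?thesis using that[OF C(1) full[OF assms(3)]] by (auto simp: crossing_def)
  next
    case True
    obtain U V where UV: "openin X U" "openin X V" "\<phi> g p \<in> U" "q \<in> V" "U \<inter> V = {}"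
      using separate_points[of "\<phi> g p" q] assms True by auto
    obtain C where C: "closed_nbhd p C" "C \<subseteq> {x \<in> M. \<phi> g x \<in> U}"
      using closed_nbhd_exists[OF open_preimage[OF assms(1) UV(1)], of p] UV assms by auto
    obtain D where D: "closed_nbhd q D" "D \<subseteq> V" using closed_nbhd_exists[OF UV(2,4)] .
    have "\<phi> g ` C \<inter> D = {}" using UV(5) C(2) D(2) by auto
    then show ?thesis using that[OF C(1) D(1)] by (auto simp: crossing_def)
  qed
qed

text \<open>
  For disjoint neighbourhoods only finitely many elements cross, and each of these stops crossing
  after a further shrinking.
\<close>

lemma noncrossing_nbhds:
  assumes "p \<in> M" "q \<in> M" "p \<noteq> q"
  obtains P Q where "closed_nbhd p P" "closed_nbhd q Q" "P \<inter> Q = {}" "\<And>g. g \<in> carrier G \<Longrightarrow> \<not> crossing g P Q"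
proof -
  obtain U V where UV: "openin X U" "openin X V" "p \<in> U" "q \<in> V" "U \<inter> V = {}"
    using separate_points[OF assms] .
  obtain P1 where P1: "closed_nbhd p P1" "P1 \<subseteq> U" using closed_nbhd_exists[OF UV(1,3)] .
  obtain Q1 where Q1: "closed_nbhd q Q1" "Q1 \<subseteq> V" using closed_nbhd_exists[OF UV(2,4)] .
  have disj: "P1 \<inter> Q1 = {}" using P1 Q1 UV(5) by auto
  have shrink: "\<exists>P Q. closed_nbhd p P \<and> closed_nbhd q Q \<and> P \<subseteq> P1 \<and> Q \<subseteq> Q1 \<and> (\<forall>g\<in>F. \<not> crossing g P Q)"
    if "finite F" "F \<subseteq> carrier G" for F
    using that
  proof (induction F rule: finite_induct)
    case empty
    then show ?case using P1 Q1 by auto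
  next
    case (insert g F)
    then obtain P Q where PQ: "closed_nbhd p P" "closed_nbhd q Q" "P \<subseteq> P1" "Q \<subseteq> Q1" "\<forall>g\<in>F. \<not> crossing g P Q"
      by auto
    obtain C D where CD: "closed_nbhd p C" "closed_nbhd q D" "\<not> crossing g C D"
      using uncross[of g, OF _ assms] insert.prems by auto
    have "\<forall>g'\<in>insert g F. \<not> crossing g' (P \<inter> C) (Q \<inter> D)"
      using PQ(5) CD(3) crossing_mono[of _ "P \<inter> C" "Q \<inter> D" P Q] crossing_mono[of g "P \<inter> C" "Q \<inter> D" C D] by auto
    then show ?case using closed_nbhd_Int PQ CD by (intro exI[of _ "P \<inter> C"] exI[of _ "Q \<inter> D"]) auto
  qed
  have fin: "finite {g \<in> carrier G. crossing g P1 Q1}" using finite_crossing closed_nbhdD P1 Q1 disj by auto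
  obtain P Q where PQ: "closed_nbhd p P" "closed_nbhd q Q" "P \<subseteq> P1" "Q \<subseteq> Q1"
    "\<forall>g\<in>{g \<in> carrier G. crossing g P1 Q1}. \<not> crossing g P Q"
    using shrink[OF fin] by auto
  have "\<not> crossing g P Q" if "g \<in> carrier G" for g
    using PQ(5) crossing_mono[OF _ PQ(3,4), of g] that by auto
  moreover have "P \<inter> Q = {}" using PQ disj by auto
  ultimately show ?thesis using that PQ by auto
qed

end

lemma int_switch:
  fixes R :: "int \<Rightarrow> bool"
  assumes "i < j" "R i" "\<not> R j"
  obtains k where "R k" "\<not> R (k + 1)"
proof -
  have "\<exists>k. R k \<and> \<not> R (k + 1)"
  proof (rule ccontr)
    assume n: "\<not> ?thesis"
    have "R k" if "i \<le> k" for k using that assms(2) n by (induction k rule: int_ge_induct) auto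
    then show False using assms by auto
  qed
  then show ?thesis using that by auto
qed

text \<open>
  The translates of \<open>(P, Q)\<close> are the annuli, and those by elements \<open>g\<close> with \<open>g {p, q} = Y\<close> are the annuli
  around the pair \<open>Y\<close>. The open sets \<open>V\<close> and \<open>W\<close> give some room between \<open>P\<close> and \<open>Q\<close>.
\<close>

locale loxodromic_pair = convergence_group +
  fixes h :: 'a and p q :: 'c and P Q V W :: "'c set"
  assumes lox: "loxodromic h p q"
    and P: "closed_nbhd p P" and Q: "closed_nbhd q Q"
    and V: "openin X V" "P \<subseteq> V" and W: "openin X W" "Q \<subseteq> W" and VW: "V \<inter> W = {}"
    and noncrossing: "\<And>g. g \<in> carrier G \<Longrightarrow> \<not> crossing g P Q"
begin

sublocale group G by (rule is_group)

abbreviation core :: "'c set" where "core \<equiv> {p, q}"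

definition E :: "'a set" where "E = {e \<in> carrier G. \<phi> e ` core = core}"

lemma hpq: "h \<in> carrier G" "p \<in> M" "q \<in> M" "p \<noteq> q" "\<phi> h p = p" "\<phi> h q = q" "inj (\<lambda>n::nat. h [^] n)"
  using lox by (auto simp: loxodromic_def)

lemma PQ: "closedin X P" "closedin X Q" "P \<subseteq> M" "Q \<subseteq> M" "p \<in> P" "q \<in> Q" "P \<inter> Q = {}"
  using closed_nbhdD[OF P] closed_nbhdD[OF Q] V W VW by auto

lemma E_in: "e \<in> E \<Longrightarrow> e \<in> carrier G"
  by (simp add: E_def)

lemma E_core: "e \<in> E \<Longrightarrow> \<phi> e p \<in> core \<and> \<phi> e q \<in> core"
  unfolding E_def by auto

lemma E_mult: "e \<in> E \<Longrightarrow> f \<in> E \<Longrightarrow> e \<otimes> f \<in> E"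
  using act_image_mult[of e f core] hpq by (simp add: E_def)

lemma act_image_inv: "\<lbrakk>g \<in> carrier G; A \<subseteq> M\<rbrakk> \<Longrightarrow> \<phi> (inv g) ` \<phi> g ` A = A"
  using act_inv[of g] by (force simp: image_iff)

lemma act_image_inv': "\<lbrakk>g \<in> carrier G; A \<subseteq> M\<rbrakk> \<Longrightarrow> \<phi> g ` \<phi> (inv g) ` A = A"
  using act_image_inv[of "inv g" A] by simp

lemma E_inv: "e \<in> E \<Longrightarrow> inv e \<in> E"
  using act_image_inv[of e core] hpq by (simp add: E_def)

lemma hpow_in: "h [^] (k::int) \<in> carrier G"
  using hpq by simp

lemma hpow_Suc: "x \<in> M \<Longrightarrow> \<phi> (h [^] (k + 1 :: int)) x = \<phi> (h [^] k) (\<phi> h x)"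
  using act_mult[of "h [^] k" h x] int_pow_mult[of h k 1] hpq by simp

lemma hpow_fix: "\<phi> (h [^] (k::int)) p = p" "\<phi> (h [^] k) q = q"
proof -
  have fix_h: "\<phi> (h [^] (k::int)) x = x" if "x \<in> M" "\<phi> h x = x" for x
  proof (cases "0 \<le> k")
    case True
    then show ?thesis using fixed_by_powers[OF hpq(1) that, of "nat k"] int_pow_int[of G h "nat k"] by simp
  next
    case False
    have "\<phi> (h [^] nat (- k)) x = x" using fixed_by_powers[OF hpq(1) that] .
    then have "\<phi> (inv (h [^] nat (- k))) x = x" using act_inv[of "h [^] nat (- k)" x] hpq that by simp
    moreover have "h [^] k = inv (h [^] nat (- k))" using False by (subst int_pow_def2) (simp only: not_le if_True)
    ultimately show ?thesis by simp
  qed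
  show "\<phi> (h [^] (k::int)) p = p" "\<phi> (h [^] k) q = q" using fix_h hpq by auto
qed

lemma hpow_E: "h [^] (k::int) \<in> E"
  using hpow_fix hpow_in by (simp add: E_def)

lemma attracted:
  assumes "collapses F a b" "F \<subseteq> range (\<lambda>n::nat. k [^] n)" "finite S" "S \<subseteq> M - {a}" "openin X U" "b \<in> U"
  shows "infinite {n. \<forall>x\<in>S. \<phi> (k [^] (n::nat)) x \<in> U}"
proof
  assume "finite {n. \<forall>x\<in>S. \<phi> (k [^] (n::nat)) x \<in> U}"
  then have "finite ((\<lambda>n. k [^] n) ` {n. \<forall>x\<in>S. \<phi> (k [^] (n::nat)) x \<in> U})" by blast
  moreover have "F \<subseteq> (\<lambda>n. k [^] n) ` {n. \<forall>x\<in>S. \<phi> (k [^] (n::nat)) x \<in> U} \<union> (\<Union>x\<in>S. {g \<in> F. \<phi> g x \<notin> U})"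
    using assms(2) by auto
  moreover have "finite (\<Union>x\<in>S. {g \<in> F. \<phi> g x \<notin> U})"
    using collapses_point[OF assms(1) _ _ assms(5,6)] assms(3,4) by auto
  ultimately have "finite F" using finite_subset by blast
  then show False using collapsesD(2)[OF assms(1)] by blast
qed

lemma attracted_q:
  assumes "finite S" "S \<subseteq> M - {p}" "openin X U" "q \<in> U"
  shows "infinite {n. \<forall>x\<in>S. \<phi> (h [^] (n::nat)) x \<in> U}"
proof -
  obtain F where "F \<subseteq> range (\<lambda>n::nat. h [^] n)" "collapses F p q" using lox unfolding loxodromic_def by auto
  then show ?thesis using attracted[of F p q h S U] assms by simp
qed

lemma attracted_p:
  assumes "finite S" "S \<subseteq> M - {q}" "openin X U" "p \<in> U"
  shows "infinite {n. \<forall>x\<in>S. \<phi> (inv h [^] (n::nat)) x \<in> U}"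
proof -
  obtain F where "F \<subseteq> range (\<lambda>n::nat. inv h [^] n)" "collapses F q p" using lox unfolding loxodromic_def by auto
  then show ?thesis using attracted[of F q p "inv h" S U] assms by simp
qed

text \<open>
  The orbit of \<open>x\<close> under the powers of \<open>h\<close> comes from \<open>p\<close> and goes to \<open>q\<close>, so its image leaves \<open>V'\<close> at some
  time \<open>k\<close>.
\<close>

lemma passage:
  assumes "g \<in> carrier G" "openin X V'" "openin X W'" "V' \<inter> W' = {}" "\<phi> g p \<in> V'" "\<phi> g q \<in> W'" "x \<in> M - core"
  obtains k :: int where "\<phi> g (\<phi> (h [^] k) x) \<in> V'" "\<phi> g (\<phi> (h [^] (k + 1)) x) \<notin> V'"
proof -
  let ?A = "{n. \<forall>y\<in>{x}. \<phi> (inv h [^] (n::nat)) y \<in> {y \<in> M. \<phi> g y \<in> V'}}"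
  let ?B = "{n. \<forall>y\<in>{x}. \<phi> (h [^] (n::nat)) y \<in> {y \<in> M. \<phi> g y \<in> W'}}"
  have "infinite ?A" using attracted_p[OF _ _ open_preimage[OF assms(1,2)], of "{x}"] assms hpq by auto
  then obtain n where n: "n \<in> ?A" using infinite_imp_nonempty by auto
  have "infinite ?B" using attracted_q[OF _ _ open_preimage[OF assms(1,3)], of "{x}"] assms hpq by auto
  then have "\<exists>m>0. m \<in> ?B" unfolding infinite_nat_iff_unbounded by (rule spec)
  then obtain m where m: "m \<in> ?B" "0 < m" by blast
  let ?R = "\<lambda>k::int. \<phi> g (\<phi> (h [^] k) x) \<in> V'"
  have "h [^] (- int n) = inv h [^] n" using hpq int_pow_neg[of h "int n"] int_pow_int[of G h n] nat_pow_inv[of h n] by simp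
  then have "?R (- int n)" using n by simp
  moreover have "\<not> ?R (int m)" using m assms(4) by (auto simp: int_pow_int)
  moreover have "- int n < int m" using m by simp
  ultimately show ?thesis using int_switch[of "- int n" "int m" ?R] that by auto
qed

section \<open>Annuli around the core\<close>

text \<open>
  The elements of \<open>E\<close> preserve the core. Hence a collapsing family in \<open>E\<close> has its source and its target
  in the core, and \<open>D\<close> contains neither of them.
\<close>

lemma E_properly_discontinuous:
  assumes "closedin X D" "p \<notin> D" "q \<notin> D"
  shows "finite {e \<in> E. \<phi> e ` D \<inter> D \<noteq> {}}"
proof (rule ccontr)
  assume inf: "infinite {e \<in> E. \<phi> e ` D \<inter> D \<noteq> {}}"
  have sub: "{e \<in> E. \<phi> e ` D \<inter> D \<noteq> {}} \<subseteq> carrier G" using E_in by auto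
  obtain F a b where F: "F \<subseteq> {e \<in> E. \<phi> e ` D \<inter> D \<noteq> {}}" "collapses F a b"
    using infinite_family_collapses[OF sub inf] .
  note ab = collapsesD[OF F(2)]
  have FE: "e \<in> E" if "e \<in> F" for e using F(1) that by auto
  have b: "b \<in> core"
  proof (rule ccontr)
    assume nb: "b \<notin> core"
    obtain x where x: "x \<in> core" "x \<noteq> a" using hpq by auto
    have op: "openin X (M - {p} - {q})" using open_minus_point hpq by auto
    have fin: "finite {e \<in> F. \<phi> e x \<notin> M - {p} - {q}}"
      by (rule collapses_point[OF F(2) _ x(2) op]) (use x nb ab hpq in auto)
    then obtain e where "e \<in> F" "\<phi> e x \<in> M - {p} - {q}" using cofinite_ex[OF ab(2) fin] by auto
    then show False using E_core[OF FE] x by auto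
  qed
  have a: "a \<in> core"
  proof (rule ccontr)
    assume na: "a \<notin> core"
    obtain y where y: "y \<in> core" "y \<noteq> b" using hpq by auto
    have op: "openin X (M - {y})" using open_minus_point[of M y] y hpq by auto
    have "finite {e \<in> F. \<phi> e p \<notin> M - {y}}" "finite {e \<in> F. \<phi> e q \<notin> M - {y}}"
      using collapses_point[OF F(2) _ _ op] na ab y hpq by auto
    then obtain e where e: "e \<in> F" "\<phi> e p \<in> M - {y}" "\<phi> e q \<in> M - {y}" using cofinite_ex2[OF ab(2), of "\<lambda>e. \<phi> e p \<in> M - {y}" "\<lambda>e. \<phi> e q \<in> M - {y}"] by auto
    then have "y \<notin> \<phi> e ` core" by auto
    moreover have "\<phi> e ` core = core" using FE[OF e(1)] by (simp add: E_def)
    ultimately show False using y(1) by blast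
  qed
  have op: "openin X (M - D)" using assms by auto
  have fin: "finite {e \<in> F. \<not> \<phi> e ` D \<subseteq> M - D}"
    by (rule collapses_compact[OF F(2) closed_compact[OF assms(1)] _ op]) (use a b assms hpq in auto)
  then obtain e where e: "e \<in> F" "\<phi> e ` D \<subseteq> M - D" using cofinite_ex[OF ab(2) fin] by auto
  then have "\<phi> e ` D \<inter> D \<noteq> {}" using F(1) by blast
  then show False using e(2) by blast
qed

text \<open>
  Off the core every orbit of the powers of \<open>h\<close> meets the closed set \<open>D\<close> below, at the moment when it
  leaves \<open>V\<close>. So the stabilizer of \<open>c\<close> in \<open>E\<close> is conjugate to a subset of the finite set of elements
  that do not move \<open>D\<close> off itself.
\<close>

lemma transporter_bounded:
  obtains N where "\<And>c w. c \<in> M - core \<Longrightarrow> finite {e \<in> E. \<phi> e c = w} \<and> card {e \<in> E. \<phi> e c = w} \<le> N"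
proof -
  define D where "D = (M - W) \<inter> {x \<in> M. \<phi> h x \<in> M - V}"
  have D: "closedin X D" "p \<notin> D" "q \<notin> D"
    using V W PQ hpq closed_preimage[OF hpq(1), of "M - V"] by (auto simp: D_def)
  let ?T = "{e \<in> E. \<phi> e ` D \<inter> D \<noteq> {}}"
  have fin: "finite ?T" by (rule E_properly_discontinuous[OF D])
  have stab: "finite {e \<in> E. \<phi> e c = c} \<and> card {e \<in> E. \<phi> e c = c} \<le> card ?T" if c: "c \<in> M - core" for c
  proof -
    have one: "\<phi> \<one> p \<in> V" "\<phi> \<one> q \<in> W" using act_one hpq PQ V W by auto
    obtain k :: int where k: "\<phi> \<one> (\<phi> (h [^] k) c) \<in> V" "\<phi> \<one> (\<phi> (h [^] (k + 1)) c) \<notin> V"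
      using passage[OF one_closed V(1) W(1) VW one c] by auto
    let ?f = "h [^] k"
    have fE: "?f \<in> E" "?f \<in> carrier G" using hpow_E hpow_in by auto
    have fcM: "\<phi> ?f c \<in> M" using act_in[OF hpow_in, of c k] c by auto
    have "\<phi> (h [^] (k + 1)) c = \<phi> h (\<phi> ?f c)"
      using act_mult[of h ?f c] int_pow_mult[of h 1 k] hpq c by (simp add: add.commute)
    then have fc: "\<phi> ?f c \<in> D"
      using k act_one fcM act_in[OF hpq(1) fcM] VW by (auto simp: D_def)
    let ?conj = "\<lambda>e. ?f \<otimes> e \<otimes> inv ?f"
    have inj: "inj_on ?conj {e \<in> E. \<phi> e c = c}"
      by (rule inj_onI) (use E_in fE in auto)
    have "?conj ` {e \<in> E. \<phi> e c = c} \<subseteq> ?T"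
    proof
      fix e' assume "e' \<in> ?conj ` {e \<in> E. \<phi> e c = c}"
      then obtain e where e: "e \<in> E" "\<phi> e c = c" "e' = ?conj e" by auto
      have "e' \<in> E" using e fE E_mult E_inv by auto
      moreover have "\<phi> e' (\<phi> ?f c) = \<phi> ?f c"
        using act_mult[of "?f \<otimes> e" "inv ?f" "\<phi> ?f c"] act_mult[of ?f e c] act_inv[of ?f c] fE E_in[OF e(1)] c e fcM
        by auto
      ultimately show "e' \<in> ?T" using fc by (auto simp: disjoint_iff image_iff) 
    qed
    then show ?thesis using inj_on_finite[OF inj _ fin] card_inj_on_le[OF inj _ fin] by auto
  qed
  have "finite {e \<in> E. \<phi> e c = w} \<and> card {e \<in> E. \<phi> e c = w} \<le> card ?T" if c: "c \<in> M - core" for c w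
  proof (cases "{e \<in> E. \<phi> e c = w} = {}")
    case False
    then obtain f where f: "f \<in> E" "\<phi> f c = w" by auto
    let ?t = "\<lambda>e. inv f \<otimes> e"
    have inj: "inj_on ?t {e \<in> E. \<phi> e c = w}"
      by (rule inj_onI) (use E_in f in auto)
    have "?t ` {e \<in> E. \<phi> e c = w} \<subseteq> {e \<in> E. \<phi> e c = c}"
      using act_mult[of "inv f" _ c] act_inv[of f c] f E_in E_mult E_inv c by auto
    then show ?thesis using inj_on_finite[OF inj] card_inj_on_le[OF inj] stab[OF c] by (meson le_trans)
  qed (simp only: finite.emptyI card.empty le0 simp_thms)
  then show ?thesis using that[of "card ?T"] by blast
qed

lemma middle_bounded:
  obtains N where "\<And>z. z \<in> M \<Longrightarrow> finite {e \<in> E. \<phi> (inv e) z \<notin> P \<union> Q} \<and> card {e \<in> E. \<phi> (inv e) z \<notin> P \<union> Q} \<le> N"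
proof -
  obtain Up Uq where U: "openin X Up" "p \<in> Up" "Up \<subseteq> P" "openin X Uq" "q \<in> Uq" "Uq \<subseteq> Q"
    using P Q unfolding closed_nbhd_def by auto
  define D where "D = M - (Up \<union> Uq)"
  have "closedin X D" "p \<notin> D" "q \<notin> D" using U by (auto simp: D_def)
  then have fin: "finite {e \<in> E. \<phi> e ` D \<inter> D \<noteq> {}}" by (rule E_properly_discontinuous)
  have "finite {e \<in> E. \<phi> (inv e) z \<notin> P \<union> Q} \<and> card {e \<in> E. \<phi> (inv e) z \<notin> P \<union> Q} \<le> card {e \<in> E. \<phi> e ` D \<inter> D \<noteq> {}}"
    (is "finite ?Z \<and> card ?Z \<le> card ?T") if z: "z \<in> M" for z
  proof (cases "?Z = {}")
    case False
    then obtain f where f: "f \<in> E" "\<phi> (inv f) z \<notin> P \<union> Q" by auto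
    have inD: "\<phi> (inv e) z \<in> D" if "e \<in> E" "\<phi> (inv e) z \<notin> P \<union> Q" for e
      using that U act_in[of "inv e" z] E_in z by (auto simp: D_def)
    let ?t = "\<lambda>e. inv e \<otimes> f"
    have inj: "inj_on ?t ?Z"
    proof (rule inj_onI)
      fix e e' assume "e \<in> ?Z" "e' \<in> ?Z" "inv e \<otimes> f = inv e' \<otimes> f"
      then have "inv e = inv e'" "e \<in> carrier G" "e' \<in> carrier G" using E_in f by auto
      then show "e = e'" using inv_inv by metis
    qed
    have "?t ` ?Z \<subseteq> ?T"
    proof
      fix e' assume "e' \<in> ?t ` ?Z"
      then obtain e where e: "e \<in> E" "\<phi> (inv e) z \<notin> P \<union> Q" "e' = inv e \<otimes> f" by auto
      have "\<phi> e' (\<phi> (inv f) z) = \<phi> (inv e) z"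
        using act_mult[of "inv e" f "\<phi> (inv f) z"] act_inv'[of f z] act_in[of "inv f" z] E_in e f z by auto
      then have "\<phi> (inv e) z \<in> \<phi> e' ` D" using inD[OF f] by (metis imageI)
      then show "e' \<in> ?T" using inD[OF e(1,2)] e E_mult E_inv f by auto
    qed
    then show ?thesis using inj_on_finite[OF inj _ fin] card_inj_on_le[OF inj _ fin] by auto
  qed (simp only: finite.emptyI card.empty le0 simp_thms)
  then show ?thesis using that[of "card {e \<in> E. \<phi> e ` D \<inter> D \<noteq> {}}"] by blast
qed

text \<open>
  These elements cannot collapse. If the source is \<open>p\<close>, then \<open>\<phi> g q\<close> and \<open>\<phi> g x\<close> have the same limit,
  although they stay in \<open>D\<close> and in \<open>V'\<close>. If it is \<open>q\<close>, then \<open>\<phi> g p\<close> in \<open>C\<close> and \<open>\<phi> g y\<close> outside \<open>V'\<close>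
  have the same limit. Any other source would send \<open>p\<close> and \<open>q\<close> to the same limit.
\<close>

lemma finite_crossing_elements:
  assumes "closedin X C" "closedin X D" "openin X V'" "openin X W'" "C \<subseteq> V'" "D \<subseteq> W'" "V' \<inter> W' = {}"
    and "x \<in> M" "y \<in> M" "x \<noteq> p" "y \<noteq> q"
  shows "finite {g \<in> carrier G. \<phi> g p \<in> C \<and> \<phi> g q \<in> D \<and> \<phi> g x \<in> V' \<and> \<phi> g y \<notin> V'}"
proof (rule ccontr)
  let ?S = "{g \<in> carrier G. \<phi> g p \<in> C \<and> \<phi> g q \<in> D \<and> \<phi> g x \<in> V' \<and> \<phi> g y \<notin> V'}"
  assume inf: "infinite ?S"
  have sub: "?S \<subseteq> carrier G" by auto
  obtain F a b where F: "F \<subseteq> ?S" "collapses F a b" using infinite_family_collapses[OF sub inf] .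
  note ab = collapsesD[OF F(2)]
  have limit: "b \<in> C'" if "z \<in> M" "z \<noteq> a" "closedin X C'" "\<And>g. g \<in> F \<Longrightarrow> \<phi> g z \<in> C'" for z C'
  proof (rule ccontr)
    assume nb: "b \<notin> C'"
    have fin: "finite {g \<in> F. \<phi> g z \<notin> M - C'}"
      by (rule collapses_point[OF F(2) that(1,2)]) (use that nb ab in auto)
    then obtain g where "g \<in> F" "\<phi> g z \<in> M - C'" using cofinite_ex[OF ab(2) fin] by auto
    then show False using that by auto
  qed
  have S: "\<phi> g p \<in> C" "\<phi> g q \<in> D" "\<phi> g x \<in> V'" "\<phi> g y \<notin> V'" if "g \<in> F" for g using F(1) that by auto
  have gM: "\<phi> g z \<in> M" if "g \<in> F" "z \<in> M" for g z using ab that act_in by auto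
  show False
  proof (cases "a = p")
    case True
    then have "b \<in> D" using limit[of q D] S hpq assms by auto
    moreover have "b \<in> M - W'" by (rule limit[of x]) (use S(3) gM assms True in \<open>auto simp: disjoint_iff\<close>)
    ultimately show False using assms by auto
  next
    case False
    then have bC: "b \<in> C" using limit[of p C] S(1) hpq(2) assms(1) by auto
    have "b \<in> D" if "a \<noteq> q" using limit[of q D] S(2) hpq(3) assms(2) that by auto
    then have "a = q" using bC assms(5,6,7) by blast
    then have "b \<in> M - V'" by (intro limit[of y]) (use S gM assms in auto)
    then show False using bC assms by auto
  qed
qed

definition crosses :: "'c set \<Rightarrow> bool" where
  "crosses Z \<longleftrightarrow> Z \<inter> P \<noteq> {} \<and> Z \<inter> Q \<noteq> {}"

text \<open>
  A pair is the image of the core under a whole coset of elements. The representative that makes an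
  auxiliary orbit change sides at time zero belongs to one of two finite sets.
\<close>

lemma finite_crossing_pairs: "finite {Z. (\<exists>g\<in>carrier G. Z = \<phi> g ` core) \<and> crosses Z}"
proof -
  have "infinite (M - core)" using infinite_space by simp
  then have "M - core \<noteq> {}" by (metis finite.emptyI)
  then obtain x where x: "x \<in> M - core" by blast
  let ?S1 = "{g \<in> carrier G. \<phi> g p \<in> P \<and> \<phi> g q \<in> Q \<and> \<phi> g x \<in> V \<and> \<phi> g (\<phi> h x) \<notin> V}"
  let ?S2 = "{g \<in> carrier G. \<phi> g p \<in> Q \<and> \<phi> g q \<in> P \<and> \<phi> g x \<in> W \<and> \<phi> g (\<phi> h x) \<notin> W}"
  have hx: "\<phi> h x \<in> M" "\<phi> h x \<noteq> q" using act_in[OF hpq(1)] act_inj[OF hpq(1), of x q] x hpq by auto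
  have fin: "finite ?S1" "finite ?S2"
    using finite_crossing_elements[OF PQ(1,2) V(1) W(1) V(2) W(2) VW] finite_crossing_elements[OF PQ(2,1) W(1) V(1) W(2) V(2)]
      VW x hx by (auto simp: Int_commute)
  have "{Z. (\<exists>g\<in>carrier G. Z = \<phi> g ` core) \<and> crosses Z} \<subseteq> (\<lambda>g. \<phi> g ` core) ` (?S1 \<union> ?S2)"
  proof
    fix Z assume "Z \<in> {Z. (\<exists>g\<in>carrier G. Z = \<phi> g ` core) \<and> crosses Z}"
    then obtain g where g: "g \<in> carrier G" "Z = \<phi> g ` core" "crosses Z" by auto
    have turn: "\<exists>k. \<phi> (g \<otimes> h [^] (k::int)) x \<in> V' \<and> \<phi> (g \<otimes> h [^] k) (\<phi> h x) \<notin> V' \<and>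
        \<phi> (g \<otimes> h [^] k) p = \<phi> g p \<and> \<phi> (g \<otimes> h [^] k) q = \<phi> g q \<and> \<phi> (g \<otimes> h [^] k) ` core = Z"
      if VW': "openin X V'" "openin X W'" "V' \<inter> W' = {}" "\<phi> g p \<in> V'" "\<phi> g q \<in> W'" for V' W'
    proof -
      obtain k :: int where k: "\<phi> g (\<phi> (h [^] k) x) \<in> V'" "\<phi> g (\<phi> (h [^] (k + 1)) x) \<notin> V'"
        using passage[OF g(1) VW' x] by auto
      have "\<phi> (g \<otimes> h [^] k) y = \<phi> g (\<phi> (h [^] k) y)" if "y \<in> M" for y
        using act_mult[OF g(1) hpow_in that] .
      then show ?thesis using k hpow_Suc[of x k] x hx hpow_fix hpq g(2) by (intro exI[of _ k]) auto
    qed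
    have "\<phi> g p \<in> P \<and> \<phi> g q \<in> Q \<or> \<phi> g p \<in> Q \<and> \<phi> g q \<in> P"
      using g PQ(7) by (auto simp: crosses_def)
    then have "\<exists>f\<in>?S1 \<union> ?S2. Z = \<phi> f ` core"
    proof
      assume a: "\<phi> g p \<in> P \<and> \<phi> g q \<in> Q"
      then have "\<phi> g p \<in> V" "\<phi> g q \<in> W" using V W by auto
      from turn[OF V(1) W(1) _ this] obtain k :: int where "\<phi> (g \<otimes> h [^] k) x \<in> V" "\<phi> (g \<otimes> h [^] k) (\<phi> h x) \<notin> V"
        "\<phi> (g \<otimes> h [^] k) p = \<phi> g p" "\<phi> (g \<otimes> h [^] k) q = \<phi> g q" "\<phi> (g \<otimes> h [^] k) ` core = Z"
        using VW by blast
      then show ?thesis using a g hpow_in by (intro bexI[of _ "g \<otimes> h [^] k"]) auto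
    next
      assume a: "\<phi> g p \<in> Q \<and> \<phi> g q \<in> P"
      then have "\<phi> g p \<in> W" "\<phi> g q \<in> V" using V W by auto
      from turn[OF W(1) V(1) _ this] obtain k :: int where "\<phi> (g \<otimes> h [^] k) x \<in> W" "\<phi> (g \<otimes> h [^] k) (\<phi> h x) \<notin> W"
        "\<phi> (g \<otimes> h [^] k) p = \<phi> g p" "\<phi> (g \<otimes> h [^] k) q = \<phi> g q" "\<phi> (g \<otimes> h [^] k) ` core = Z"
        using VW by blast
      then show ?thesis using a g hpow_in by (intro bexI[of _ "g \<otimes> h [^] k"]) auto
    qed
    then show "Z \<in> (\<lambda>g. \<phi> g ` core) ` (?S1 \<union> ?S2)" by auto
  qed
  then show ?thesis using fin finite_subset by blast
qed


section \<open>Counting the annuli that separate two pairs\<close>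

definition pairs :: "'c set set" where "pairs = {\<phi> g ` core | g. g \<in> carrier G}"

lemma core_pair: "core \<in> pairs"
  using act_one hpq by (auto simp: pairs_def intro!: exI[of _ \<one>])

lemma pair_image: "\<lbrakk>g \<in> carrier G; Z \<in> pairs\<rbrakk> \<Longrightarrow> \<phi> g ` Z \<in> pairs"
proof -
  assume g: "g \<in> carrier G" "Z \<in> pairs"
  then obtain f where f: "f \<in> carrier G" "Z = \<phi> f ` core" unfolding pairs_def by blast
  then have "\<phi> g ` Z = \<phi> (g \<otimes> f) ` core" using act_image_mult[of g f core] g hpq by simp
  then show ?thesis using g f m_closed unfolding pairs_def by blast
qed

lemma pair_points:
  assumes "Z \<in> pairs"
  obtains z z' where "Z = {z, z'}" "z \<noteq> z'" "z \<in> M" "z' \<in> M"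
proof -
  obtain g where g: "g \<in> carrier G" "Z = \<phi> g ` core" using assms by (auto simp: pairs_def)
  have "\<phi> g p \<noteq> \<phi> g q" using act_inj[OF g(1), of p q] hpq by auto
  then show ?thesis using that[of "\<phi> g p" "\<phi> g q"] g act_in hpq by auto
qed

lemma pair_subset: "Z \<in> pairs \<Longrightarrow> Z \<subseteq> M"
  by (erule pair_points) auto

lemma pair_point_outside:
  assumes "Z \<in> pairs" "Z \<noteq> core"
  obtains z where "z \<in> Z" "z \<in> M - core"
proof -
  obtain z z' where z: "Z = {z, z'}" "z \<noteq> z'" "z \<in> M" "z' \<in> M" using pair_points[OF assms(1)] .
  then have "\<not> Z \<subseteq> core" using assms(2) hpq by auto
  then show ?thesis using that z by auto
qed

lemma pair_avoids:
  assumes "Z \<in> pairs"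
  obtains z where "z \<in> Z" "z \<noteq> a" "z \<in> M"
  using pair_points[OF assms] by (metis insertI1 insertI2)

definition sided :: "'a \<Rightarrow> 'c set \<Rightarrow> bool" where
  "sided g Z \<longleftrightarrow> \<phi> (inv g) ` Z \<subseteq> P \<or> \<phi> (inv g) ` Z \<subseteq> Q"

definition separates :: "'a \<Rightarrow> 'c set \<Rightarrow> 'c set \<Rightarrow> bool" where
  "separates g Y Z \<longleftrightarrow> \<phi> (inv g) ` Y \<subseteq> P \<and> \<phi> (inv g) ` Z \<subseteq> Q \<or> \<phi> (inv g) ` Y \<subseteq> Q \<and> \<phi> (inv g) ` Z \<subseteq> P"

lemma pair_transporter_bounded:
  obtains N where "\<And>Y Z. \<lbrakk>Z \<in> pairs; Z \<noteq> core; Y \<in> pairs\<rbrakk> \<Longrightarrow> finite {e \<in> E. \<phi> e ` Z = Y} \<and> card {e \<in> E. \<phi> e ` Z = Y} \<le> N"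
proof -
  obtain N where N: "\<And>c w. c \<in> M - core \<Longrightarrow> finite {e \<in> E. \<phi> e c = w} \<and> card {e \<in> E. \<phi> e c = w} \<le> N"
    using transporter_bounded by blast
  have "finite {e \<in> E. \<phi> e ` Z = Y} \<and> card {e \<in> E. \<phi> e ` Z = Y} \<le> 2 * N"
    if ZY: "Z \<in> pairs" "Z \<noteq> core" "Y \<in> pairs" for Y Z
  proof -
    obtain z where z: "z \<in> Z" "z \<in> M - core" using pair_point_outside[OF ZY(1,2)] .
    obtain y y' where y: "Y = {y, y'}" using pair_points[OF ZY(3)] by metis
    let ?A = "{e \<in> E. \<phi> e z = y}" and ?B = "{e \<in> E. \<phi> e z = y'}"
    have sub: "{e \<in> E. \<phi> e ` Z = Y} \<subseteq> ?A \<union> ?B" using z(1) y by auto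
    have fin: "finite (?A \<union> ?B)" using N[OF z(2)] by blast
    have "card {e \<in> E. \<phi> e ` Z = Y} \<le> card ?A + card ?B"
      using card_mono[OF fin sub] card_Un_le[of ?A ?B] by linarith
    then show ?thesis using finite_subset[OF sub fin] N[OF z(2), of y] N[OF z(2), of y'] by linarith
  qed
  then show ?thesis using that by blast
qed

text \<open>
  If \<open>Z\<close> is on no side of an annulus around the core, then either one of its two points is in the middle
  of the annulus, or \<open>Z\<close> crosses the annulus. In the latter case the element of \<open>E\<close> carries one of
  finitely many crossing pairs to \<open>Z\<close>. In each of these cases the number of annuli is bounded independently of \<open>Z\<close>.
\<close>

lemma unsided_bounded:
  obtains N where "\<And>Z. \<lbrakk>Z \<in> pairs; Z \<noteq> core\<rbrakk> \<Longrightarrow> finite {e \<in> E. \<not> sided e Z} \<and> card {e \<in> E. \<not> sided e Z} \<le> N"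
proof -
  obtain N1 where N1: "\<And>z. z \<in> M \<Longrightarrow> finite {e \<in> E. \<phi> (inv e) z \<notin> P \<union> Q} \<and> card {e \<in> E. \<phi> (inv e) z \<notin> P \<union> Q} \<le> N1"
    using middle_bounded by blast
  obtain N2 where N2: "\<And>Y Z. \<lbrakk>Z \<in> pairs; Z \<noteq> core; Y \<in> pairs\<rbrakk> \<Longrightarrow> finite {e \<in> E. \<phi> e ` Z = Y} \<and> card {e \<in> E. \<phi> e ` Z = Y} \<le> N2"
    using pair_transporter_bounded by blast
  define C where "C = {Z \<in> pairs. Z \<noteq> core \<and> crosses Z}"
  have "C \<subseteq> {Z. (\<exists>g\<in>carrier G. Z = \<phi> g ` core) \<and> crosses Z}" by (auto simp: C_def pairs_def)
  then have finC: "finite C" using finite_crossing_pairs finite_subset by blast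
  have "finite {e \<in> E. \<not> sided e Z} \<and> card {e \<in> E. \<not> sided e Z} \<le> N1 + N1 + card C * N2"
    if Z: "Z \<in> pairs" "Z \<noteq> core" for Z
  proof -
    obtain z z' where z: "Z = {z, z'}" "z \<in> M" "z' \<in> M" using pair_points[OF Z(1)] .
    let ?A = "{e \<in> E. \<phi> (inv e) z \<notin> P \<union> Q}" and ?B = "{e \<in> E. \<phi> (inv e) z' \<notin> P \<union> Q}"
    let ?C = "\<lambda>Y. {e \<in> E. \<phi> e ` Y = Z}"
    have C: "finite (?C Y) \<and> card (?C Y) \<le> N2" if "Y \<in> C" for Y
      using N2[of Y Z] that Z by (auto simp: C_def)
    have sub: "{e \<in> E. \<not> sided e Z} \<subseteq> ?A \<union> ?B \<union> (\<Union>Y\<in>C. ?C Y)"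
    proof
      fix e assume "e \<in> {e \<in> E. \<not> sided e Z}"
      then have e: "e \<in> E" "e \<in> carrier G" "\<not> sided e Z" using E_in by auto
      show "e \<in> ?A \<union> ?B \<union> (\<Union>Y\<in>C. ?C Y)"
      proof (rule ccontr)
        assume n: "e \<notin> ?A \<union> ?B \<union> (\<Union>Y\<in>C. ?C Y)"
        let ?Y = "\<phi> (inv e) ` Z"
        have eY: "\<phi> e ` ?Y = Z" using act_image_inv'[OF e(2) pair_subset[OF Z(1)]] .
        have "?Y \<noteq> core" using eY e(1) Z(2) by (auto simp: E_def)
        moreover have "?Y \<in> pairs" using pair_image e(2) Z(1) by auto
        moreover have "\<phi> (inv e) z \<in> P \<union> Q" "\<phi> (inv e) z' \<in> P \<union> Q" using n e(1) by auto
        then have "crosses ?Y" using e(3) z(1) unfolding sided_def crosses_def by auto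
        ultimately have "?Y \<in> C" by (simp add: C_def)
        then show False using n e(1) eY by blast
      qed
    qed
    have fin: "finite (?A \<union> ?B \<union> (\<Union>Y\<in>C. ?C Y))" using N1[OF z(2)] N1[OF z(3)] finC C by auto
    have "card (\<Union>Y\<in>C. ?C Y) \<le> (\<Sum>Y\<in>C. card (?C Y))" by (rule card_UN_le[OF finC])
    also have "\<dots> \<le> card C * N2" using sum_bounded_above[of C "\<lambda>Y. card (?C Y)" N2] C by simp
    finally have u: "card (\<Union>Y\<in>C. ?C Y) \<le> card C * N2" .
    have "card {e \<in> E. \<not> sided e Z} \<le> card (?A \<union> ?B \<union> (\<Union>Y\<in>C. ?C Y))" by (rule card_mono[OF fin sub])
    also have "\<dots> \<le> card ?A + card ?B + card (\<Union>Y\<in>C. ?C Y)"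
      using card_Un_le[of "?A \<union> ?B" "\<Union>Y\<in>C. ?C Y"] card_Un_le[of ?A ?B] by linarith
    finally have "card {e \<in> E. \<not> sided e Z} \<le> N1 + N1 + card C * N2"
      using u N1[OF z(2)] N1[OF z(3)] by linarith
    then show ?thesis using finite_subset[OF sub fin] by blast
  qed
  then show ?thesis using that by blast
qed

text \<open>
  Two different pairs are disjoint. If \<open>Z\<close> contained \<open>p\<close>, then its other point would be attracted to \<open>q\<close>
  by infinitely many powers of \<open>h\<close>, and \<open>Z\<close> would be on no side of infinitely many annuli around the
  core. For \<open>q\<close> the roles are exchanged.
\<close>

lemma pair_disjoint_core:
  assumes "Z \<in> pairs" "Z \<noteq> core"
  shows "p \<notin> Z" "q \<notin> Z"
proof -
  obtain N where "finite {e \<in> E. \<not> sided e Z}" using unsided_bounded assms by blast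
  obtain x where x: "x \<in> Z" "x \<in> M - core" using pair_point_outside[OF assms] .
  obtain Up Uq where U: "openin X Up" "p \<in> Up" "Up \<subseteq> P" "openin X Uq" "q \<in> Uq" "Uq \<subseteq> Q"
    using P Q unfolding closed_nbhd_def by auto
  have fin: "finite {e \<in> E. \<not> sided e Z}" by fact
  have inj: "inj (\<lambda>n::nat. inv (h [^] n))"
  proof (rule injI)
    fix m n :: nat assume "inv (h [^] m) = inv (h [^] n)"
    then have "h [^] m = h [^] n" using hpq(1) by (metis inv_inv nat_pow_closed)
    then show "m = n" using hpq(7) by (simp add: inj_eq)
  qed
  have powE: "h [^] (n::nat) \<in> E" "inv (h [^] n) \<in> E" for n
    using hpow_E[of "int n"] E_inv[of "h [^] n"] by (auto simp: int_pow_int)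
  have fixed: "\<phi> (h [^] (n::nat)) p = p" "\<phi> (inv (h [^] n)) q = q" for n
    using hpow_fix(1)[of "int n"] hpow_fix(2)[of "int n"] act_inv[of "h [^] n" q] hpq by (auto simp: int_pow_int)
  show "p \<notin> Z"
  proof
    assume p: "p \<in> Z"
    let ?S = "{n. \<forall>y\<in>{x}. \<phi> (h [^] (n::nat)) y \<in> Uq}"
    have "infinite ?S" by (rule attracted_q) (use x U in auto)
    then have "infinite ((\<lambda>n. inv (h [^] n)) ` ?S)" using inj by (meson finite_imageD inj_on_subset subset_UNIV)
    moreover have "(\<lambda>n. inv (h [^] n)) ` ?S \<subseteq> {e \<in> E. \<not> sided e Z}"
    proof
      fix e assume "e \<in> (\<lambda>n. inv (h [^] n)) ` ?S"
      then obtain n :: nat where n: "e = inv (h [^] n)" "\<phi> (h [^] n) x \<in> Q" using U by auto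
      have "inv e = h [^] n" using n hpq by simp
      moreover have "p \<in> \<phi> (h [^] n) ` Z" using fixed(1)[of n] p by (metis imageI)
      moreover have "\<phi> (h [^] n) x \<in> \<phi> (h [^] n) ` Z" using x(1) by blast
      ultimately have "\<not> sided e Z" using n(2) PQ(5,7) unfolding sided_def by auto
      then show "e \<in> {e \<in> E. \<not> sided e Z}" using powE n by auto
    qed
    ultimately show False using fin finite_subset by blast
  qed
  show "q \<notin> Z"
  proof
    assume q: "q \<in> Z"
    let ?S = "{n. \<forall>y\<in>{x}. \<phi> (inv h [^] (n::nat)) y \<in> Up}"
    have "infinite ?S" by (rule attracted_p) (use x U in auto)
    then have "infinite ((\<lambda>n. h [^] n) ` ?S)" using hpq(7) by (meson finite_imageD inj_on_subset subset_UNIV)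
    moreover have "(\<lambda>n. h [^] n) ` ?S \<subseteq> {e \<in> E. \<not> sided e Z}"
    proof
      fix e assume "e \<in> (\<lambda>n. h [^] n) ` ?S"
      then obtain n :: nat where n: "e = h [^] n" "\<phi> (inv h [^] n) x \<in> P" using U by auto
      have "inv e = inv h [^] n" using n hpq nat_pow_inv[of h n] by simp
      moreover have "q \<in> \<phi> (inv h [^] n) ` Z" using fixed(2)[of n] q nat_pow_inv[of h n] hpq(1) by (metis imageI)
      moreover have "\<phi> (inv h [^] n) x \<in> \<phi> (inv h [^] n) ` Z" using x(1) by blast
      ultimately have "\<not> sided e Z" using n(2) PQ(6,7) unfolding sided_def by auto
      then show "e \<in> {e \<in> E. \<not> sided e Z}" using powE n by auto
    qed
    ultimately show False using fin finite_subset by blast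
  qed
qed

lemma separates_sym: "separates g Y Z = separates g Z Y"
  unfolding separates_def by auto

text \<open>
  Both pairs contain a point different from the source of a collapsing family of inverses of such
  elements. These two points are moved to the same limit, but \<open>P\<close> and \<open>Q\<close> are disjoint.
\<close>

lemma finite_separating:
  assumes "Y \<in> pairs" "Z \<in> pairs"
  shows "finite {g \<in> carrier G. separates g Y Z}"
proof (rule ccontr)
  let ?S = "{g \<in> carrier G. separates g Y Z}"
  assume inf: "infinite ?S"
  have "inj_on (\<lambda>g. inv g) ?S" using inv_inv by (intro inj_onI) (metis (no_types, lifting) mem_Collect_eq)
  then have inf': "infinite ((\<lambda>g. inv g) ` ?S)" using inf finite_imageD by blast
  have sub: "(\<lambda>g. inv g) ` ?S \<subseteq> carrier G" by auto
  obtain F a b where F: "F \<subseteq> (\<lambda>g. inv g) ` ?S" "collapses F a b" using infinite_family_collapses[OF sub inf'] .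
  note ab = collapsesD[OF F(2)]
  obtain y where y: "y \<in> Y" "y \<noteq> a" "y \<in> M" using pair_avoids[OF assms(1)] .
  obtain z where z: "z \<in> Z" "z \<noteq> a" "z \<in> M" using pair_avoids[OF assms(2)] .
  obtain B where B: "B = P \<or> B = Q" "b \<notin> B" using PQ(7) by auto
  have op: "openin X (M - B)" "b \<in> M - B" using B PQ(1,2) ab(4) by auto
  have "\<exists>f\<in>F. \<phi> f y \<in> M - B \<and> \<phi> f z \<in> M - B"
    by (rule cofinite_ex2[OF ab(2) collapses_point[OF F(2) y(3,2) op] collapses_point[OF F(2) z(3,2) op]])
  then obtain f where f: "f \<in> F" "\<phi> f y \<notin> B" "\<phi> f z \<notin> B" by auto
  then obtain g where g: "f = inv g" "separates g Y Z" using F(1) by auto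
  show False using g f y(1) z(1) B(1) unfolding separates_def by auto
qed

text \<open>
  First choose many annuli \<open>h\<^sup>n(P, Q)\<close> that have \<open>Z\<close> on the side of \<open>p\<close>. They are finitely many, so a high
  power of \<open>h\<close> carries \<open>Z\<close> to the side of \<open>q\<close> of all of them.
\<close>

lemma separation_unbounded:
  assumes "Z \<in> pairs" "Z \<noteq> core"
  obtains e where "e \<in> E" "N < card {f \<in> E. separates f Z (\<phi> e ` Z)}"
proof -
  obtain Up Uq where U: "openin X Up" "p \<in> Up" "Up \<subseteq> P" "openin X Uq" "q \<in> Uq" "Uq \<subseteq> Q"
    using P Q unfolding closed_nbhd_def by auto
  have Z: "finite Z" "Z \<subseteq> M - {p}" "Z \<subseteq> M - {q}"
    using pair_points[OF assms(1)] pair_disjoint_core[OF assms] pair_subset[OF assms(1)] by (auto elim: finite_subset)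
  let ?S = "{n. \<forall>y\<in>Z. \<phi> (inv h [^] (n::nat)) y \<in> Up}"
  have "infinite ?S" by (rule attracted_p[OF Z(1,3) U(1,2)])
  then obtain T where T: "finite T" "card T = Suc N" "T \<subseteq> ?S" using infinite_arbitrarily_large by blast
  have powE: "h [^] (n::nat) \<in> E" "h [^] n \<in> carrier G" "inv (h [^] n) = inv h [^] n" for n
    using hpow_E[of "int n"] hpq nat_pow_inv by (auto simp: int_pow_int)
  define U' where "U' = M \<inter> (\<Inter>n\<in>T. {y \<in> M. \<phi> (inv h [^] n) y \<in> Uq})"
  have "openin X {y \<in> M. \<phi> (inv h [^] n) y \<in> Uq}" for n :: nat by (rule open_preimage) (use U hpq in auto)
  then have "openin X U'" unfolding U'_def using T(1) by (intro openin_Int_Inter) auto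
  moreover have "\<phi> (inv h [^] n) q = q" for n :: nat
    using act_inv[of "h [^] n" q] hpow_fix(2)[of "int n"] powE hpq by (auto simp: int_pow_int)
  then have "q \<in> U'" using U hpq by (auto simp: U'_def)
  ultimately have "infinite {n. \<forall>x\<in>Z. \<phi> (h [^] (n::nat)) x \<in> U'}" by (rule attracted_q[OF Z(1,2)])
  then have "{n. \<forall>x\<in>Z. \<phi> (h [^] (n::nat)) x \<in> U'} \<noteq> {}" by (metis finite.emptyI)
  then obtain m :: nat where m: "\<And>x. x \<in> Z \<Longrightarrow> \<phi> (h [^] m) x \<in> U'" by auto
  have "(\<lambda>n. h [^] n) ` T \<subseteq> {f \<in> E. separates f Z (\<phi> (h [^] m) ` Z)}"
  proof
    fix f assume "f \<in> (\<lambda>n. h [^] n) ` T"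
    then obtain n where n: "n \<in> T" "f = h [^] n" by auto
    have "\<phi> (inv h [^] n) ` Z \<subseteq> P" using n T(3) U by auto
    moreover have "\<phi> (inv h [^] n) ` \<phi> (h [^] m) ` Z \<subseteq> Q" using m n(1) U by (auto simp: U'_def)
    ultimately show "f \<in> {f \<in> E. separates f Z (\<phi> (h [^] m) ` Z)}"
      using n powE unfolding separates_def by auto
  qed
  moreover have "finite {f \<in> E. separates f Z (\<phi> (h [^] m) ` Z)}"
    using finite_separating[OF assms(1) pair_image[OF powE(2) assms(1)], of m]
    by (rule rev_finite_subset) (use E_in in auto)
  ultimately have "card ((\<lambda>n. h [^] n) ` T) \<le> card {f \<in> E. separates f Z (\<phi> (h [^] m) ` Z)}"
    by (rule card_mono[rotated])
  moreover have "card ((\<lambda>n. h [^] n) ` T) = Suc N"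
    using T(2) card_image[OF inj_on_subset[OF hpq(7) subset_UNIV], of T] by simp
  ultimately show ?thesis using that[of "h [^] m"] powE by auto
qed

text \<open>
  Transport the two annuli by the inverse of \<open>f\<close>. The two points of \<open>A\<close> are the core, and one annulus has
  them on different sides and the other one on the same side; similarly for \<open>B\<close>. This accounts for
  three of the four intersections, and \<open>Y\<close> accounts for the fourth. So the annuli cross.
\<close>

lemma separation_behrstock:
  assumes "f \<in> carrier G" "g \<in> carrier G" "Y \<in> pairs" "\<phi> f ` core = A" "\<phi> g ` core = B"
    and "separates f Y B" "separates g Y A"
  shows False
proof -
  have fB: "\<phi> (inv f) ` B = \<phi> (inv f \<otimes> g) ` core" using act_image_mult[of "inv f" g core] assms hpq by auto
  have fA: "\<phi> (inv f) ` A = core" using act_image_inv[of f core] assms hpq by auto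
  have AM: "A \<subseteq> M" using assms(1,4) act_in hpq by auto
  have gM: "\<phi> g (\<phi> (inv g) z) = z" if "z \<in> M" for z using act_inv'[OF assms(2) that] .
  have tr: "\<phi> (inv f) z = \<phi> (inv f \<otimes> g) (\<phi> (inv g) z)" if "z \<in> M" for z
    using act_mult[of "inv f" g "\<phi> (inv g) z"] gM[OF that] act_in[of "inv g" z] assms(1,2) that by auto
  obtain y where y: "y \<in> Y" "y \<in> M" using pair_points[OF assms(3)] by (metis insertI1)
  have core_fg: "\<exists>z\<in>A. \<phi> (inv f) z = c" if "c \<in> core" for c using fA that by (metis imageE)
  let ?k = "inv f \<otimes> g"
  have A: "\<phi> ?k ` S \<inter> P \<noteq> {} \<and> \<phi> ?k ` S \<inter> Q \<noteq> {}" if "\<phi> (inv g) ` A \<subseteq> S" for S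
  proof -
    obtain zp zq where z: "zp \<in> A" "\<phi> (inv f) zp = p" "zq \<in> A" "\<phi> (inv f) zq = q"
      using core_fg[of p] core_fg[of q] by auto
    have "\<phi> ?k (\<phi> (inv g) zp) = p" "\<phi> ?k (\<phi> (inv g) zq) = q" using tr[of zp] tr[of zq] z AM by auto
    moreover have "\<phi> (inv g) zp \<in> S" "\<phi> (inv g) zq \<in> S" using that z by auto
    ultimately have "p \<in> \<phi> ?k ` S" "q \<in> \<phi> ?k ` S" using imageI[of _ S "\<phi> ?k"] by fastforce+
    then show ?thesis using PQ(5,6) by blast
  qed
  have B: "\<phi> ?k ` P \<inter> S \<noteq> {} \<and> \<phi> ?k ` Q \<inter> S \<noteq> {}" if "\<phi> (inv f) ` B \<subseteq> S" for S
  proof -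
    have "\<phi> ?k p \<in> S" "\<phi> ?k q \<in> S" using that unfolding fB by auto
    then show ?thesis using PQ(5,6) by blast
  qed
  have Y: "\<phi> ?k ` S \<inter> T \<noteq> {}" if "\<phi> (inv g) ` Y \<subseteq> S" "\<phi> (inv f) ` Y \<subseteq> T" for S T
  proof -
    have "\<phi> (inv g) y \<in> S" "\<phi> ?k (\<phi> (inv g) y) \<in> T" using that y(1) tr[OF y(2)] by auto
    then show ?thesis by blast
  qed
  have "crossing ?k P Q"
    using assms(6,7) unfolding separates_def
  proof (elim disjE conjE, goal_cases)
    case 1
    then show ?case using A[OF 1(4)] B[OF 1(2)] Y[OF 1(3,1)] unfolding crossing_def by simp
  next
    case 2
    then show ?case using A[OF 2(4)] B[OF 2(2)] Y[OF 2(3,1)] unfolding crossing_def by simp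
  next
    case 3
    then show ?case using A[OF 3(4)] B[OF 3(2)] Y[OF 3(3,1)] unfolding crossing_def by simp
  next
    case 4
    then show ?case using A[OF 4(4)] B[OF 4(2)] Y[OF 4(3,1)] unfolding crossing_def by simp
  qed
  then show False using noncrossing assms(1,2) by auto
qed

end

section \<open>Recognizing acylindrically hyperbolic groups\<close>

lemma group_actionI:
  assumes "group G"
    and ext: "\<And>g. g \<in> carrier G \<Longrightarrow> \<psi> g \<in> extensional S"
    and into: "\<And>g x. \<lbrakk>g \<in> carrier G; x \<in> S\<rbrakk> \<Longrightarrow> \<psi> g x \<in> S"
    and one: "\<And>x. x \<in> S \<Longrightarrow> \<psi> \<one>\<^bsub>G\<^esub> x = x"
    and mult: "\<And>g h x. \<lbrakk>g \<in> carrier G; h \<in> carrier G; x \<in> S\<rbrakk> \<Longrightarrow> \<psi> (g \<otimes>\<^bsub>G\<^esub> h) x = \<psi> g (\<psi> h x)"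
  shows "group_action G S \<psi>"
proof -
  interpret group G by fact
  have bij: "\<psi> g \<in> Bij S" if g: "g \<in> carrier G" for g
  proof -
    have "\<psi> (inv\<^bsub>G\<^esub> g) (\<psi> g x) = x" "\<psi> g (\<psi> (inv\<^bsub>G\<^esub> g) x) = x" if "x \<in> S" for x
      using mult[of "inv\<^bsub>G\<^esub> g" g x] mult[of g "inv\<^bsub>G\<^esub> g" x] one[OF that] g that by auto
    then have "bij_betw (\<psi> g) S S"
      by (intro bij_betwI[of _ _ _ "\<psi> (inv\<^bsub>G\<^esub> g)"]) (use into g in auto)
    then show ?thesis using ext[OF g] by (simp add: Bij_def)
  qed
  have "\<psi> (g \<otimes>\<^bsub>G\<^esub> h) = compose S (\<psi> g) (\<psi> h)" if "g \<in> carrier G" "h \<in> carrier G" for g h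
    by (rule extensionalityI[of _ S]) (use ext mult that in \<open>auto simp: compose_def\<close>)
  then have "\<psi> \<in> hom G (BijGroup S)"
    using bij by (auto simp: hom_def BijGroup_def)
  then show ?thesis
    using group_BijGroup[of S] is_group by (auto intro!: group_action.intro group_hom.intro group_hom_axioms.intro)
qed

text \<open>
  The space may have any type, provided that it embeds into the type \<open>'g \<times> real\<close> of the definition, and
  the limit points are given by sequences that are pairwise not equivalent.
\<close>

lemma acylindrically_hyperbolicI:
  fixes G :: "('g, 'b) monoid_scheme" and S :: "'s set" and \<iota> :: "'s \<Rightarrow> 'g \<times> real"
  assumes inj: "inj_on \<iota> S"
    and hyp: "Gromov_hyperbolic S d"
    and iso: "isometric_action G S d \<psi>"
    and acyl: "acylindrical G S d \<psi>"
    and e: "e \<in> S"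
    and seqs: "\<And>i::nat. i < 3 \<Longrightarrow> converges_to_infinity S d e (s i)" "\<And>i. i < 3 \<Longrightarrow> range (s i) \<subseteq> orbit G \<psi> e"
    and apart: "\<And>i j. \<lbrakk>i < 3; j < 3; i \<noteq> j\<rbrakk> \<Longrightarrow>
      \<not> filterlim (\<lambda>n. Gromov_product d e (s i n) (s j n)) at_top sequentially"
  shows "acylindrically_hyperbolic G"
proof -
  define S' where "S' = \<iota> ` S"
  define k where "k = the_inv_into S \<iota>"
  define d' where "d' = (\<lambda>a b. d (k a) (k b))"
  define \<psi>' where "\<psi>' = (\<lambda>g. \<lambda>a\<in>S'. \<iota> (\<psi> g (k a)))"
  have k\<iota>: "k (\<iota> x) = x" if "x \<in> S" for x using the_inv_into_f_f[OF inj that] by (simp add: k_def)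
  have \<iota>k: "\<iota> (k a) = a" "k a \<in> S" if "a \<in> S'" for a using that k\<iota> by (auto simp: S'_def)
  have geo: "geodesic_space S d" and "\<exists>\<delta>\<ge>0. delta_hyperbolic S d \<delta>" using hyp by (auto simp: Gromov_hyperbolic_def)
  then obtain \<delta> where \<delta>: "0 \<le> \<delta>" "delta_hyperbolic S d \<delta>" by blast
  have M: "Metric_space S d" using geo by (simp add: geodesic_space_def)
  interpret Metric_space S d by (rule M)
  have act: "group_action G S \<psi>" using iso by (simp add: isometric_action_def)
  interpret act: group_action G S \<psi> by (rule act)
  have M': "Metric_space S' d'"
  proof
    show "d' a b = 0 \<longleftrightarrow> a = b" if "a \<in> S'" "b \<in> S'" for a b
      using \<iota>k[OF that(1)] \<iota>k[OF that(2)] zero[of "k a" "k b"] unfolding d'_def by metis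
    show "d' a c \<le> d' a b + d' b c" if "a \<in> S'" "b \<in> S'" "c \<in> S'" for a b c
      using triangle \<iota>k that unfolding d'_def by blast
  qed (auto simp: d'_def commute)
  have pull: "geodesic_between S d (k ` A) (k x) (k y)" if g: "geodesic_between S' d' A x y" for A x y
  proof -
    obtain \<gamma> where \<gamma>: "A = \<gamma> ` {0..d' x y}" "A \<subseteq> S'" "\<gamma> 0 = x" "\<gamma> (d' x y) = y"
      "\<forall>s\<in>{0..d' x y}. \<forall>t\<in>{0..d' x y}. d' (\<gamma> s) (\<gamma> t) = \<bar>s - t\<bar>"
      using g unfolding geodesic_between_def by blast
    show ?thesis unfolding geodesic_between_def
    proof (intro exI[of _ "k \<circ> \<gamma>"] conjI)
      show "k ` A = (k \<circ> \<gamma>) ` {0..d (k x) (k y)}" using \<gamma>(1) by (simp add: d'_def image_comp)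
      show "k ` A \<subseteq> S" using \<gamma>(2) \<iota>k by auto
      show "\<forall>s\<in>{0..d (k x) (k y)}. \<forall>t\<in>{0..d (k x) (k y)}. d ((k \<circ> \<gamma>) s) ((k \<circ> \<gamma>) t) = \<bar>s - t\<bar>"
        using \<gamma>(5) by (simp add: d'_def)
      show "(k \<circ> \<gamma>) 0 = k x" "(k \<circ> \<gamma>) (d (k x) (k y)) = k y" using \<gamma>(3,4) by (simp_all add: d'_def)
    qed
  qed
  have push: "\<exists>A. geodesic_between S' d' A x y" if xy: "x \<in> S'" "y \<in> S'" for x y
  proof -
    obtain A where "geodesic_between S d A (k x) (k y)" using geo \<iota>k(2)[OF xy(1)] \<iota>k(2)[OF xy(2)] unfolding geodesic_space_def by blast
    then obtain \<gamma> where \<gamma>: "A = \<gamma> ` {0..d (k x) (k y)}" "A \<subseteq> S" "\<gamma> 0 = k x" "\<gamma> (d (k x) (k y)) = k y"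
      "\<forall>s\<in>{0..d (k x) (k y)}. \<forall>t\<in>{0..d (k x) (k y)}. d (\<gamma> s) (\<gamma> t) = \<bar>s - t\<bar>"
      unfolding geodesic_between_def by blast
    have \<gamma>S: "\<gamma> s \<in> S" if "s \<in> {0..d' x y}" for s using \<gamma>(1,2) that by (auto simp: d'_def)
    show ?thesis unfolding geodesic_between_def
    proof (intro exI[of _ "(\<iota> \<circ> \<gamma>) ` {0..d' x y}"] exI[of _ "\<iota> \<circ> \<gamma>"] conjI)
      show "(\<iota> \<circ> \<gamma>) ` {0..d' x y} \<subseteq> S'" using \<gamma>S by (auto simp: S'_def)
      show "\<forall>s\<in>{0..d' x y}. \<forall>t\<in>{0..d' x y}. d' ((\<iota> \<circ> \<gamma>) s) ((\<iota> \<circ> \<gamma>) t) = \<bar>s - t\<bar>"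
        using \<gamma>(5) \<gamma>S k\<iota> by (simp add: d'_def)
      show "(\<iota> \<circ> \<gamma>) 0 = x" "(\<iota> \<circ> \<gamma>) (d' x y) = y" using \<gamma>(3,4) \<iota>k xy by (simp_all add: d'_def)
    qed simp
  qed
  have hyp': "Gromov_hyperbolic S' d'"
  proof -
    have slim: "\<exists>q\<in>B \<union> C. d' p q < \<delta>" if "\<forall>p\<in>k ` A. \<exists>q\<in>k ` B \<union> k ` C. d p q < \<delta>" "p \<in> A" for A B C p
      using that by (fastforce simp: d'_def)
    have "delta_hyperbolic S' d' \<delta>"
      unfolding delta_hyperbolic_def
    proof (intro ballI allI impI, elim conjE)
      fix x y z A B C assume xyz: "x \<in> S'" "y \<in> S'" "z \<in> S'"
        and g: "geodesic_between S' d' A x y" "geodesic_between S' d' B y z" "geodesic_between S' d' C z x"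
      have "slim_sides d \<delta> (k ` A) (k ` B) (k ` C)"
        using \<delta>(2) pull[OF g(1)] pull[OF g(2)] pull[OF g(3)] \<iota>k xyz unfolding delta_hyperbolic_def by blast
      then show "slim_sides d' \<delta> A B C"
        unfolding slim_sides_def using slim[of A B C] slim[of B A C] slim[of C A B] by blast
    qed
    then show ?thesis using M' push \<delta>(1) unfolding Gromov_hyperbolic_def geodesic_space_def by blast
  qed
  have \<psi>S: "\<psi> g x \<in> S" if "g \<in> carrier G" "x \<in> S" for g x using act.element_image that by blast
  have k\<psi>: "k (\<psi>' g a) = \<psi> g (k a)" if "g \<in> carrier G" "a \<in> S'" for g a
    using that k\<iota> \<psi>S \<iota>k by (simp add: \<psi>'_def)
  have "group_action G S' \<psi>'"
  proof (rule group_actionI)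
    show "group G" using act.group_hom group_hom_def by blast
    then interpret group G .
    show "\<psi>' g \<in> extensional S'" for g by (simp add: \<psi>'_def)
    show "\<psi>' g a \<in> S'" if "g \<in> carrier G" "a \<in> S'" for g a using that \<psi>S \<iota>k by (simp add: \<psi>'_def S'_def)
    show "\<psi>' \<one>\<^bsub>G\<^esub> a = a" if "a \<in> S'" for a
      using that \<iota>k fun_cong[OF act.id_eq_one, of "k a"] by (simp add: \<psi>'_def)
    show "\<psi>' (g \<otimes>\<^bsub>G\<^esub> h) a = \<psi>' g (\<psi>' h a)" if "g \<in> carrier G" "h \<in> carrier G" "a \<in> S'" for g h a
      using that \<iota>k k\<iota> \<psi>S act.composition_rule[of "k a" g h] by (simp add: \<psi>'_def S'_def)
  qed
  then have iso': "isometric_action G S' d' \<psi>'"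
    using iso k\<psi> \<iota>k(2) by (simp add: isometric_action_def d'_def)
  have acyl': "acylindrical G S' d' \<psi>'"
    unfolding acylindrical_def
  proof (intro allI impI)
    fix \<epsilon> :: real assume "0 < \<epsilon>"
    then obtain R N where RN: "0 < R" "(0::nat) < N" and fin: "\<And>x y. \<lbrakk>x \<in> S; y \<in> S; R \<le> d x y\<rbrakk> \<Longrightarrow>
        finite {g \<in> carrier G. d x (\<psi> g x) \<le> \<epsilon> \<and> d y (\<psi> g y) \<le> \<epsilon>} \<and>
        card {g \<in> carrier G. d x (\<psi> g x) \<le> \<epsilon> \<and> d y (\<psi> g y) \<le> \<epsilon>} \<le> N"
      using acyl unfolding acylindrical_def by meson
    have "{g \<in> carrier G. d' x (\<psi>' g x) \<le> \<epsilon> \<and> d' y (\<psi>' g y) \<le> \<epsilon>} =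
        {g \<in> carrier G. d (k x) (\<psi> g (k x)) \<le> \<epsilon> \<and> d (k y) (\<psi> g (k y)) \<le> \<epsilon>}" if "x \<in> S'" "y \<in> S'" for x y
      using k\<psi>[OF _ that(1)] k\<psi>[OF _ that(2)] by (auto simp: d'_def)
    then show "\<exists>R>0. \<exists>N::nat. N > 0 \<and> (\<forall>x\<in>S'. \<forall>y\<in>S'. d' x y \<ge> R \<longrightarrow>
           finite {g \<in> carrier G. d' x (\<psi>' g x) \<le> \<epsilon> \<and> d' y (\<psi>' g y) \<le> \<epsilon>} \<and>
           card {g \<in> carrier G. d' x (\<psi>' g x) \<le> \<epsilon> \<and> d' y (\<psi>' g y) \<le> \<epsilon>} \<le> N)"
      using RN fin[OF \<iota>k(2) \<iota>k(2)]
      by (intro exI[of _ R] conjI exI[of _ N] ballI impI) (simp_all add: d'_def)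
  qed
  define \<sigma> where "\<sigma> = (\<lambda>i n. \<iota> (s i n))"
  have e': "\<iota> e \<in> S'" using e by (simp add: S'_def)
  have sS: "s i n \<in> S" if "i < 3" for i n using seqs(1)[OF that] by (auto simp: converges_to_infinity_def)
  have prod: "Gromov_product d' (\<iota> e) (\<sigma> i n) (\<sigma> j m) = Gromov_product d e (s i n) (s j m)" if "i < 3" "j < 3" for i j n m
    using k\<iota> e sS that by (simp add: Gromov_product_def d'_def \<sigma>_def)
  have conv: "converges_to_infinity S' d' (\<iota> e) (\<sigma> i)" if "i < 3" for i
    using seqs(1)[OF that] prod[OF that that] sS[OF that] by (auto simp: converges_to_infinity_def \<sigma>_def S'_def)
  define \<xi> where "\<xi> i = Gromov_equivalence S' d' (\<iota> e) `` {\<sigma> i}" for i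
  have self: "\<sigma> i \<in> \<xi> i" if "i < 3" for i
  proof -
    have "filterlim (\<lambda>(m, n). Gromov_product d' (\<iota> e) (\<sigma> i m) (\<sigma> i n)) at_top (sequentially \<times>\<^sub>F sequentially)"
      using conv[OF that] by (simp add: converges_to_infinity_def)
    moreover have "filterlim (\<lambda>n. (n, n)) (sequentially \<times>\<^sub>F sequentially) sequentially"
      by (intro filterlim_Pair filterlim_ident)
    ultimately have "filterlim (\<lambda>n. Gromov_product d' (\<iota> e) (\<sigma> i n) (\<sigma> i n)) at_top sequentially"
      using filterlim_compose[of "\<lambda>(m, n). Gromov_product d' (\<iota> e) (\<sigma> i m) (\<sigma> i n)"] by fastforce
    then show ?thesis using conv[OF that] by (simp add: \<xi>_def Gromov_equivalence_def)
  qed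
  have limit: "\<xi> i \<in> limit_set G S' d' (\<iota> e) \<psi>'" if i3: "i < 3" for i
  proof -
    have "\<xi> i \<in> Gromov_boundary S' d' (\<iota> e)"
      using conv[OF i3] unfolding Gromov_boundary_def \<xi>_def by (auto intro: quotientI)
    moreover have "range (\<sigma> i) \<subseteq> orbit G \<psi>' (\<iota> e)"
    proof
      fix a assume "a \<in> range (\<sigma> i)"
      then obtain n where n: "a = \<iota> (s i n)" unfolding \<sigma>_def by blast
      obtain g where "g \<in> carrier G" "s i n = \<psi> g e" using seqs(2)[OF i3] unfolding orbit_def by blast
      then have "g \<in> carrier G" "a = \<psi>' g (\<iota> e)" using n k\<iota>[OF e] e' by (simp_all add: \<psi>'_def)
      then show "a \<in> orbit G \<psi>' (\<iota> e)" unfolding orbit_def by blast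
    qed
    ultimately show ?thesis using self[OF i3] e' unfolding limit_set_def by blast
  qed
  have distinct: "\<xi> i \<noteq> \<xi> j" if ij: "i < 3" "j < 3" "i \<noteq> j" for i j
  proof
    assume "\<xi> i = \<xi> j"
    then have "(\<sigma> i, \<sigma> j) \<in> Gromov_equivalence S' d' (\<iota> e)" using self[OF ij(2)] by (auto simp: \<xi>_def)
    then show False using apart[OF ij] prod[OF ij(1,2)] by (simp add: Gromov_equivalence_def)
  qed
  have "non_elementary G S' d' (\<iota> e) \<psi>'"
    unfolding non_elementary_def
    using limit[of 0] limit[of 1] limit[of 2] distinct[of 0 1] distinct[of 0 2] distinct[of 1 2]
    by (intro exI[of _ "\<xi> 0"] exI[of _ "\<xi> 1"] exI[of _ "\<xi> 2"]) simp
  then show ?thesis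
    unfolding acylindrically_hyperbolic_def using hyp' iso' acyl' e' by blast
qed

section \<open>Groups acting on rigid projection systems\<close>

lemma injective_pairing:
  assumes "infinite (UNIV :: 'g set)"
  obtains j :: "'g \<times> 'g \<Rightarrow> 'g" where "inj j"
proof -
  have "(card_of ((UNIV :: 'g set) \<times> (UNIV :: 'g set)), card_of (UNIV :: 'g set)) \<in> ordIso"
    by (rule card_of_Times_same_infinite) fact
  then obtain j :: "'g \<times> 'g \<Rightarrow> 'g" where "bij_betw j (UNIV \<times> UNIV) UNIV"
    using card_of_ordIso by blast
  then show ?thesis using that[of j] by (simp add: bij_betw_def)
qed

locale acting_projection_system = rigid_projection_system V d \<theta> K + group_action G V \<rho>
  for V :: "'v set" and d :: "'v \<Rightarrow> 'v \<Rightarrow> 'v \<Rightarrow> nat" and \<theta> K :: nat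
    and G :: "('g, 'b) monoid_scheme" and \<rho> :: "'g \<Rightarrow> 'v \<Rightarrow> 'v" +
  fixes B :: nat and o1 o2 :: 'v
  assumes equivariant: "\<lbrakk>g \<in> carrier G; Y \<in> V; X \<in> V - {Y}; Z \<in> V - {Y}\<rbrakk> \<Longrightarrow> d (\<rho> g Y) (\<rho> g X) (\<rho> g Z) = d Y X Z"
    and stabilizers: "\<lbrakk>X \<in> V; Y \<in> V; X \<noteq> Y\<rbrakk> \<Longrightarrow>
      finite {g \<in> carrier G. \<rho> g X = X \<and> \<rho> g Y = Y} \<and> card {g \<in> carrier G. \<rho> g X = X \<and> \<rho> g Y = Y} \<le> B"
    and unbounded: "\<lbrakk>Y \<in> V; X \<in> V - {Y}\<rbrakk> \<Longrightarrow> \<exists>X'\<in>V - {Y}. n < d Y X X'"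
    and transitive: "X \<in> V \<Longrightarrow> \<exists>g\<in>carrier G. \<rho> g o1 = X"
    and base: "o1 \<in> V" "o2 \<in> V" "o1 \<noteq> o2"
    and infinite_carrier: "infinite (carrier G)"
begin

lemma is_group: "group G"
  using group_hom group_hom_def by blast

lemma act_in: "\<lbrakk>g \<in> carrier G; X \<in> V\<rbrakk> \<Longrightarrow> \<rho> g X \<in> V"
  using element_image by blast

lemma act_eq: "\<lbrakk>g \<in> carrier G; X \<in> V; Y \<in> V\<rbrakk> \<Longrightarrow> \<rho> g X = \<rho> g Y \<longleftrightarrow> X = Y"
  using inj_onD[OF inj_prop] by blast

lemma act_inv: "\<lbrakk>g \<in> carrier G; X \<in> V\<rbrakk> \<Longrightarrow> \<rho> (inv\<^bsub>G\<^esub> g) (\<rho> g X) = X"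
  using orbit_sym_aux by blast

lemma act_inv': "\<lbrakk>g \<in> carrier G; X \<in> V\<rbrakk> \<Longrightarrow> \<rho> g (\<rho> (inv\<^bsub>G\<^esub> g) X) = X"
  using act_inv[of "inv\<^bsub>G\<^esub> g" X] group.inv_closed[OF is_group] group.inv_inv[OF is_group] by simp

lemma between_act:
  assumes "g \<in> carrier G" "X \<in> V" "Z \<in> V" "Y \<in> between X Z"
  shows "\<rho> g Y \<in> between (\<rho> g X) (\<rho> g Z)"
  using assms act_in[OF assms(1)] act_eq[OF assms(1)] equivariant[OF assms(1), of Y X Z] by (auto simp: between_def)

lemma adj_act:
  assumes "g \<in> carrier G" "adj X Z"
  shows "adj (\<rho> g X) (\<rho> g Z)"
proof -
  have XZ: "X \<in> V" "Z \<in> V" "X \<noteq> Z" "between X Z = {}" using assms(2) by (auto simp: adj_def)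
  have g: "inv\<^bsub>G\<^esub> g \<in> carrier G" using group.inv_closed[OF is_group assms(1)] .
  have "Y \<notin> between (\<rho> g X) (\<rho> g Z)" for Y
    using between_act[OF g, of "\<rho> g X" "\<rho> g Z" Y] act_in[OF assms(1)] act_inv[OF assms(1)] XZ by auto
  then show ?thesis using act_in[OF assms(1)] act_eq[OF assms(1)] XZ by (auto simp: adj_def)
qed

lemma gd_act_le:
  assumes "g \<in> carrier G" "X \<in> V" "Z \<in> V"
  shows "gd (\<rho> g X) (\<rho> g Z) \<le> gd X Z"
proof -
  have "(adj ^^ n) X Y \<Longrightarrow> (adj ^^ n) (\<rho> g X) (\<rho> g Y)" for n Y
  proof (induction n arbitrary: Y)
    case (Suc n)
    then obtain U where "(adj ^^ n) X U" "adj U Y" by auto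
    then show ?case using Suc.IH adj_act[OF assms(1)] by (metis relpowp_Suc_I)
  qed auto
  then show ?thesis using gd_path[OF assms(2,3)] gd_le by blast
qed

lemma gd_act:
  assumes "g \<in> carrier G" "X \<in> V" "Z \<in> V"
  shows "gd (\<rho> g X) (\<rho> g Z) = gd X Z"
  using gd_act_le[OF assms] gd_act_le[OF group.inv_closed[OF is_group assms(1)] act_in[OF assms(1,2)] act_in[OF assms(1,3)]]
    act_inv[OF assms(1,2)] act_inv[OF assms(1,3)] by simp

text \<open>
  Choose two elements \<open>Y1\<close> and \<open>Y2\<close> between \<open>X\<close> and \<open>Z\<close>, so far from both that they do not notice the motion of
  the ends. The inverse of an element \<open>g\<close> of \<open>S\<close> then carries them to elements between \<open>X\<close> and \<open>Z\<close> at a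
  controlled distance from \<open>X\<close>, for which there are boundedly many possibilities. Elements with the same
  images of \<open>Y1\<close> and \<open>Y2\<close> differ by an element that fixes both.
\<close>

lemma few_elements_moving_two_vertices_little:
  assumes "X \<in> V" "Z \<in> V" "2 * \<epsilon> + 10 \<le> gd X Z"
  defines "S \<equiv> {g \<in> carrier G. gd X (\<rho> g X) \<le> \<epsilon> \<and> gd Z (\<rho> g Z) \<le> \<epsilon>}"
  shows "finite S \<and> card S \<le> (4 * \<epsilon> + 22) * (4 * \<epsilon> + 22) * B"
proof -
  interpret G: group G by (rule is_group)
  have far: "\<epsilon> + 3 \<le> gd X Z" "\<epsilon> + 5 \<le> gd X Z" using assms(3) by linarith+
  obtain Y1 where Y1: "Y1 \<in> insert Z (between X Z)" "\<epsilon> + 3 \<le> gd X Y1" "gd X Y1 \<le> \<epsilon> + 3 + 1"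
    using between_at_distance[OF assms(1,2) far(1)] .
  obtain Y2 where Y2: "Y2 \<in> insert Z (between X Z)" "\<epsilon> + 5 \<le> gd X Y2" "gd X Y2 \<le> \<epsilon> + 5 + 1"
    using between_at_distance[OF assms(1,2) far(2)] .
  have b: "Y1 \<in> between X Z" "Y2 \<in> between X Z" "Y1 \<noteq> Y2" using Y1 Y2 assms(3) by auto
  have YV: "Y1 \<in> V" "Y2 \<in> V" using b by (auto simp: between_def)
  define T where "T = {Y \<in> between X Z. 0 \<le> gd X Y \<and> gd X Y \<le> 0 + (2 * \<epsilon> + 6)}"
  have T: "finite T" "card T \<le> 4 * \<epsilon> + 22"
    using between_fin[OF assms(1,2)] between_window[OF assms(1,2), of 0 "2 * \<epsilon> + 6"] by (auto simp: T_def)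
  have moved: "\<rho> (inv\<^bsub>G\<^esub> g) Y \<in> T"
    if g: "g \<in> S" and Y: "Y \<in> between X Z" "\<epsilon> + 3 \<le> gd X Y" "gd X Y \<le> \<epsilon> + 6" for g Y
  proof -
    have gG: "g \<in> carrier G" "gd X (\<rho> g X) \<le> \<epsilon>" "gd Z (\<rho> g Z) \<le> \<epsilon>" using g by (auto simp: S_def)
    have Yv: "Y \<in> V" using Y by (auto simp: between_def)
    have gV: "\<rho> g X \<in> V" "\<rho> g Z \<in> V" "\<rho> (inv\<^bsub>G\<^esub> g) Y \<in> V" using act_in gG assms Yv by auto
    have "\<epsilon> + 3 \<le> gd Z Y"
      using gd_triangle[of X Y Z] gd_sym[of Y Z] assms Yv Y by linarith
    then have "Y \<in> between (\<rho> g X) (\<rho> g Z)"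
      using between_stable[OF assms(1) gV(1) assms(2) gV(2) Y(1) gG(2,3) Y(2)] by blast
    then have "\<rho> (inv\<^bsub>G\<^esub> g) Y \<in> between X Z"
      using between_act[of "inv\<^bsub>G\<^esub> g" "\<rho> g X" "\<rho> g Z" Y] gV gG act_inv assms by auto
    moreover have "gd X (\<rho> (inv\<^bsub>G\<^esub> g) Y) = gd (\<rho> g X) Y"
      using gd_act[OF gG(1) assms(1) gV(3)] act_inv'[OF gG(1) Yv] by simp
    moreover have "gd (\<rho> g X) Y \<le> gd (\<rho> g X) X + gd X Y" "gd (\<rho> g X) X = gd X (\<rho> g X)"
      using gd_triangle gd_sym gV assms Yv by blast+
    ultimately show ?thesis using gG Y by (simp add: T_def)
  qed
  let ?f = "\<lambda>c. {g \<in> S. \<rho> (inv\<^bsub>G\<^esub> g) Y1 = fst c \<and> \<rho> (inv\<^bsub>G\<^esub> g) Y2 = snd c}"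
  have fibre: "finite (?f c) \<and> card (?f c) \<le> B" for c
  proof (cases "?f c = {}")
    case False
    then obtain f where f: "f \<in> S" "\<rho> (inv\<^bsub>G\<^esub> f) Y1 = fst c" "\<rho> (inv\<^bsub>G\<^esub> f) Y2 = snd c" by auto
    have fG: "f \<in> carrier G" using f by (auto simp: S_def)
    let ?t = "\<lambda>g. g \<otimes>\<^bsub>G\<^esub> inv\<^bsub>G\<^esub> f" and ?stab = "{g \<in> carrier G. \<rho> g Y1 = Y1 \<and> \<rho> g Y2 = Y2}"
    have inj: "inj_on ?t (?f c)" by (rule inj_onI) (use fG in \<open>auto simp: S_def\<close>)
    have "?t ` ?f c \<subseteq> ?stab"
    proof
      fix k assume "k \<in> ?t ` ?f c"
      then obtain g where g: "g \<in> ?f c" "k = g \<otimes>\<^bsub>G\<^esub> inv\<^bsub>G\<^esub> f" by blast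
      then have gG: "g \<in> carrier G" by (auto simp: S_def)
      have "\<rho> k Y = Y" if "Y \<in> V" "\<rho> (inv\<^bsub>G\<^esub> g) Y = \<rho> (inv\<^bsub>G\<^esub> f) Y" for Y
        using composition_rule[of Y g "inv\<^bsub>G\<^esub> f"] act_inv'[OF gG that(1)] that gG fG g(2) by simp
      then show "k \<in> ?stab" using g f YV gG fG by auto
    qed
    moreover have "finite ?stab \<and> card ?stab \<le> B" using stabilizers[OF YV b(3)] .
    ultimately show ?thesis using inj_on_finite[OF inj] card_inj_on_le[OF inj] by (meson le_trans)
  qed (simp only: finite.emptyI card.empty le0 simp_thms)
  have sub: "S \<subseteq> (\<Union>c\<in>T \<times> T. ?f c)"
  proof
    fix g assume g: "g \<in> S"
    have "(\<rho> (inv\<^bsub>G\<^esub> g) Y1, \<rho> (inv\<^bsub>G\<^esub> g) Y2) \<in> T \<times> T"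
      using moved[OF g b(1)] moved[OF g b(2)] Y1 Y2 by auto
    then show "g \<in> (\<Union>c\<in>T \<times> T. ?f c)" using g by force
  qed
  have fin: "finite (\<Union>c\<in>T \<times> T. ?f c)" using T fibre by blast
  have "card S \<le> card (\<Union>c\<in>T \<times> T. ?f c)" by (rule card_mono[OF fin sub])
  also have "\<dots> \<le> (\<Sum>c\<in>T \<times> T. card (?f c))" by (rule card_UN_le) (use T in blast)
  also have "\<dots> \<le> card (T \<times> T) * B" using sum_bounded_above[of "T \<times> T" "\<lambda>c. card (?f c)" B] fibre by simp
  also have "\<dots> = card T * card T * B" by (simp add: card_cartesian_product)
  also have "\<dots> \<le> (4 * \<epsilon> + 22) * (4 * \<epsilon> + 22) * B" using T(2) by (intro mult_mono) auto
  finally show ?thesis using finite_subset[OF sub fin] by blast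
qed

definition act_points :: "'g \<Rightarrow> 'v \<times> 'v \<times> real \<Rightarrow> 'v \<times> 'v \<times> real" where
  "act_points g = (\<lambda>(x, y, t)\<in>points. (\<rho> g x, \<rho> g y, t))"

lemma act_points_vertex: "X \<in> V \<Longrightarrow> act_points g (vertex X) = vertex (\<rho> g X)"
  using vertex_in[of X] by (simp add: act_points_def vertex_def)

lemma act_points_eq: "(x, y, t) \<in> points \<Longrightarrow> act_points g (x, y, t) = (\<rho> g x, \<rho> g y, t)"
  by (simp add: act_points_def)

lemma points_V: "(x, y, t) \<in> points \<Longrightarrow> x \<in> V \<and> y \<in> V"
  using adj_in by (auto simp: points_def)

lemma act_points_in: "\<lbrakk>g \<in> carrier G; p \<in> points\<rbrakk> \<Longrightarrow> act_points g p \<in> points"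
  using adj_act[of g] act_in[of g] by (cases p) (auto simp: act_points_eq points_def)

lemma act_points_action: "group_action G points act_points"
proof (rule group_actionI[OF is_group])
  interpret G: group G by (rule is_group)
  show "act_points g \<in> extensional points" for g by (simp add: act_points_def)
  show "act_points g p \<in> points" if "g \<in> carrier G" "p \<in> points" for g p using act_points_in that .
  have one: "\<rho> \<one>\<^bsub>G\<^esub> X = X" if "X \<in> V" for X using fun_cong[OF id_eq_one, of X] that by simp
  show "act_points \<one>\<^bsub>G\<^esub> p = p" if "p \<in> points" for p
  proof -
    obtain x y t where p: "p = (x, y, t)" by (metis prod_cases3)
    then show ?thesis using that act_points_eq[of x y t] points_V[of x y t] one by simp
  qed
  show "act_points (g \<otimes>\<^bsub>G\<^esub> h) p = act_points g (act_points h p)"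
    if "g \<in> carrier G" "h \<in> carrier G" "p \<in> points" for g h p
  proof -
    obtain x y t where p: "p = (x, y, t)" by (metis prod_cases3)
    have "(\<rho> h x, \<rho> h y, t) \<in> points" using act_points_in[OF that(2,3)] act_points_eq[of x y t h] that(3) p by simp
    then show ?thesis
      using that act_points_eq[of x y t] act_points_eq[of "\<rho> h x" "\<rho> h y" t] points_V[of x y t] composition_rule p by simp
  qed
qed

lemma act_points_isometric:
  assumes "g \<in> carrier G" "p \<in> points" "q \<in> points"
  shows "D (act_points g p) (act_points g q) = D p q"
proof -
  obtain x y t x' y' t' where pq: "p = (x, y, t)" "q = (x', y', t')" by (metis prod_cases3)
  have V: "x \<in> V" "y \<in> V" "x' \<in> V" "y' \<in> V" using points_V assms pq by blast+
  have e: "act_points g p = (\<rho> g x, \<rho> g y, t)" "act_points g q = (\<rho> g x', \<rho> g y', t')"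
    using act_points_eq assms pq by auto
  have "detour (\<rho> g x, \<rho> g y, t) (\<rho> g x', \<rho> g y', t') = detour (x, y, t) (x', y', t')"
    using gd_act[OF assms(1)] V by (simp add: detour_def insert_Times_insert)
  then have "raw_dist (act_points g p) (act_points g q) = raw_dist p q"
    using act_eq[OF assms(1)] V e pq by simp
  then show ?thesis using assms act_points_in by (simp add: D_def)
qed

lemma act_points_acylindrical: "acylindrical G points D act_points"
  unfolding acylindrical_def
proof (intro allI impI)
  fix \<epsilon> :: real assume "0 < \<epsilon>"
  define n where "n = nat \<lceil>\<epsilon>\<rceil> + 2"
  have n: "\<epsilon> + 2 \<le> real n" unfolding n_def by linarith
  define R where "R = real (2 * n + 10) + 2"
  define N where "N = (4 * n + 22) * (4 * n + 22) * B + 1"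
  have "finite {g \<in> carrier G. D p (act_points g p) \<le> \<epsilon> \<and> D q (act_points g q) \<le> \<epsilon>} \<and>
      card {g \<in> carrier G. D p (act_points g p) \<le> \<epsilon> \<and> D q (act_points g q) \<le> \<epsilon>} \<le> N"
    if pq: "p \<in> points" "q \<in> points" "R \<le> D p q" for p q
  proof -
    obtain X where X: "X \<in> V" "D p (vertex X) \<le> 1" using near_vertex[OF pq(1)] .
    obtain Z where Z: "Z \<in> V" "D q (vertex Z) \<le> 1" using near_vertex[OF pq(2)] .
    let ?S = "{g \<in> carrier G. gd X (\<rho> g X) \<le> n \<and> gd Z (\<rho> g Z) \<le> n}"
    have "2 * n + 10 \<le> gd X Z"
      using D_near_vertices(1)[OF pq(1,2) X(1) Z(1) X(2) Z(2)] pq(3) unfolding R_def by linarith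
    then have S: "finite ?S" "card ?S \<le> (4 * n + 22) * (4 * n + 22) * B"
      using few_elements_moving_two_vertices_little[OF X(1) Z(1)] by blast+
    have close: "gd Y (\<rho> g Y) \<le> n"
      if "g \<in> carrier G" "r \<in> points" "Y \<in> V" "D r (vertex Y) \<le> 1" "D r (act_points g r) \<le> \<epsilon>" for g r Y
    proof -
      have "D (act_points g r) (vertex (\<rho> g Y)) = D r (vertex Y)"
        using act_points_isometric[OF that(1,2), of "vertex Y"] act_points_vertex that by simp
      then have "gd Y (\<rho> g Y) \<le> D r (act_points g r) + 2"
        using D_near_vertices(2)[of r "act_points g r" Y "\<rho> g Y"] act_points_in act_in that by simp
      then show ?thesis using n that(5) by linarith
    qed
    have sub: "{g \<in> carrier G. D p (act_points g p) \<le> \<epsilon> \<and> D q (act_points g q) \<le> \<epsilon>} \<subseteq> ?S"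
      using close[OF _ pq(1) X] close[OF _ pq(2) Z] by auto
    then show ?thesis using S card_mono[OF S(1) sub] finite_subset by (auto simp: N_def)
  qed
  moreover have "0 < R" "0 < N" by (auto simp: R_def N_def)
  ultimately show "\<exists>R>0. \<exists>N::nat. N > 0 \<and> (\<forall>x\<in>points. \<forall>y\<in>points. D x y \<ge> R \<longrightarrow>
      finite {g \<in> carrier G. D x (act_points g x) \<le> \<epsilon> \<and> D y (act_points g y) \<le> \<epsilon>} \<and>
      card {g \<in> carrier G. D x (act_points g x) \<le> \<epsilon> \<and> D y (act_points g y) \<le> \<epsilon>} \<le> N)" by blast
qed

lemma ray_converges:
  assumes "ray x"
  shows "converges_to_infinity points D (vertex (x 0)) (\<lambda>n. vertex (x n))"
proof -
  have V: "x n \<in> V" for n using assms by (auto simp: ray_def)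
  have large: "real (min i j) / 2 - 3 \<le> Gromov_product D (vertex (x 0)) (vertex (x i)) (vertex (x j))" for i j
  proof -
    have *: "real i / 2 - 3 \<le> (real (gd (x i) (x 0)) + real (gd (x j) (x 0)) - real (gd (x i) (x j))) / 2" if "i \<le> j" for i j
    proof -
      have "real (gd (x 0) (x i)) + real (gd (x i) (x j)) \<le> real (gd (x 0) (x j)) + 4"
        using ray_product[OF assms that] by linarith
      moreover have "real i \<le> 2 * real (gd (x 0) (x i)) + 1" using ray_escapes[OF assms, of i] by linarith
      ultimately show ?thesis
        unfolding gd_sym[OF V V, of i 0] gd_sym[OF V V, of j 0] by (simp add: field_simps)
    qed
    show ?thesis
    proof (cases "i \<le> j")
      case True
      then show ?thesis using *[of i j] D_vertex V by (simp add: Gromov_product_def)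
    next
      case False
      then show ?thesis using *[of j i] D_vertex V gd_sym[OF V V, of i j] by (simp add: Gromov_product_def)
    qed
  qed
  have "filterlim (\<lambda>(i, j). Gromov_product D (vertex (x 0)) (vertex (x i)) (vertex (x j))) at_top (sequentially \<times>\<^sub>F sequentially)"
    unfolding filterlim_at_top
  proof
    fix C :: real
    define N where "N = nat \<lceil>2 * C + 6\<rceil>"
    have "C \<le> Gromov_product D (vertex (x 0)) (vertex (x i)) (vertex (x j))" if "N \<le> i" "N \<le> j" for i j
    proof -
      have "2 * C + 6 \<le> real (min i j)" using that unfolding N_def by linarith
      then show ?thesis using large[of i j] by linarith
    qed
    then show "\<forall>\<^sub>F p in sequentially \<times>\<^sub>F sequentially.
        C \<le> (case p of (i, j) \<Rightarrow> Gromov_product D (vertex (x 0)) (vertex (x i)) (vertex (x j)))"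
      unfolding eventually_prod_sequentially by auto
  qed
  then show ?thesis using V unfolding converges_to_infinity_def by auto
qed

lemma rays_not_equivalent:
  assumes "ray x" "ray y" "x 0 = y 0" "K < d (x 0) (x 1) (y 1)"
  shows "\<not> filterlim (\<lambda>n. Gromov_product D (vertex (x 0)) (vertex (x n)) (vertex (y n))) at_top sequentially"
proof
  assume "filterlim (\<lambda>n. Gromov_product D (vertex (x 0)) (vertex (x n)) (vertex (y n))) at_top sequentially"
  then have "\<forall>\<^sub>F n in sequentially. 3 \<le> Gromov_product D (vertex (x 0)) (vertex (x n)) (vertex (y n))"
    unfolding filterlim_at_top by blast
  then obtain N where N: "\<And>n. N \<le> n \<Longrightarrow> 3 \<le> Gromov_product D (vertex (x 0)) (vertex (x n)) (vertex (y n))"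
    unfolding eventually_sequentially by blast
  have V: "x n \<in> V" "y n \<in> V" for n using assms by (auto simp: ray_def)
  have "gd (x (Suc N)) (x 0) + gd (x 0) (y (Suc N)) \<le> gd (x (Suc N)) (y (Suc N)) + 4"
    using rays_diverge[OF assms, of "Suc N" "Suc N"] by simp
  moreover have "gd (x 0) (y (Suc N)) = gd (y (Suc N)) (x 0)" using gd_sym V by blast
  ultimately show False using N[of "Suc N"] D_vertex V by (simp add: Gromov_product_def)
qed

theorem acylindrically_hyperbolic: "acylindrically_hyperbolic G"
proof -
  have ext: "\<exists>X'\<in>V - {Y}. K < d Y X X'" if "Y \<in> V" "X \<in> V - {Y}" for X Y using unbounded[OF that] .
  obtain z1 where z1: "z1 \<in> V - {o1}" "K < d o1 o2 z1" using unbounded[of o1 o2 K] base by auto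
  \<comment> \<open>So far out that it is far from \<open>z1\<close> as well, by the triangle inequality.\<close>
  obtain z2 where z2: "z2 \<in> V - {o1}" "K + d o1 o2 z1 < d o1 o2 z2"
    using unbounded[of o1 o2 "K + d o1 o2 z1"] base by auto
  have "d o1 o2 z2 \<le> d o1 o2 z1 + d o1 z1 z2" using d_triangle[of o1 o2 z1 z2] base z1 z2 by auto
  then have z12: "K < d o1 z1 z2" using z2 by linarith
  have o2: "o2 \<in> V - {o1}" using base by auto
  obtain x0 where x0: "ray x0" "x0 0 = o1" "x0 1 = o2" using ray_exists[OF base(1) o2 ext] .
  obtain x1 where x1: "ray x1" "x1 0 = o1" "x1 1 = z1" using ray_exists[OF base(1) z1(1) ext] .
  obtain x2 where x2: "ray x2" "x2 0 = o1" "x2 1 = z2" using ray_exists[OF base(1) z2(1) ext] .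
  define x where "x i = (if i = 0 then x0 else if i = 1 then x1 else x2)" for i :: nat
  have x: "ray (x i)" "x i 0 = o1" for i using x0 x1 x2 by (auto simp: x_def)
  have apart: "K < d o1 (x i 1) (x j 1)" if "i < 3" "j < 3" "i \<noteq> j" for i j
  proof -
    have "i = 0 \<or> i = 1 \<or> i = 2" "j = 0 \<or> j = 1 \<or> j = 2" using that by auto
    then show ?thesis
      using that(3) z1(2) z2(2) z12 d_sym[of o1 o2] d_sym[of o1 z1 z2] x0 x1 x2 by (auto simp: x_def)
  qed
  have V: "x i n \<in> V" for i n using x(1)[of i] unfolding ray_def by blast
  have inf: "infinite (UNIV :: 'g set)" by (rule infinite_super[OF subset_UNIV infinite_carrier])
  obtain j :: "'g \<times> 'g \<Rightarrow> 'g" where j: "inj j" using injective_pairing[OF inf] .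
  define c where "c X = (SOME g. g \<in> carrier G \<and> \<rho> g o1 = X)" for X
  have c: "\<rho> (c X) o1 = X" if "X \<in> V" for X
    using someI_ex[of "\<lambda>g. g \<in> carrier G \<and> \<rho> g o1 = X"] transitive[OF that] by (auto simp: c_def)
  have inj: "inj_on (\<lambda>(x, y, t :: real). (j (c x, c y), t)) points"
  proof (rule inj_onI)
    fix p q assume p: "p \<in> points" and q: "q \<in> points"
      and eq: "(case p of (x, y, t) \<Rightarrow> (j (c x, c y), t)) = (case q of (x, y, t) \<Rightarrow> (j (c x, c y), t))"
    obtain a b t a' b' t' where pq: "p = (a, b, t)" "q = (a', b', t')" by (metis prod_cases3)
    have "j (c a, c b) = j (c a', c b')" and t: "t = t'" using eq by (simp_all add: pq)
    then have cc: "c a = c a'" "c b = c b'" using injD[OF j] by blast+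
    have abV: "a \<in> V" "b \<in> V" "a' \<in> V" "b' \<in> V" 
      using points_V[of a b t] points_V[of a' b' t'] p q pq by simp_all
    have "\<rho> (c a) o1 = \<rho> (c a') o1" "\<rho> (c b) o1 = \<rho> (c b') o1" using cc by simp_all
    then have "a = a'" "b = b'" unfolding c[OF abV(1)] c[OF abV(2)] c[OF abV(3)] c[OF abV(4)] .
    then show "p = q" using t pq by simp
  qed
  show ?thesis
  proof (rule acylindrically_hyperbolicI[OF inj])
    show "Gromov_hyperbolic points D"
      by (rule realization_hyperbolic[of "18 + 2 * 6"]) (use thin_triangles in blast)
    show "isometric_action G points D act_points"
      using act_points_action act_points_isometric by (simp add: isometric_action_def)
    show "acylindrical G points D act_points" by (rule act_points_acylindrical)
    show "vertex o1 \<in> points" using base by simp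
    show "converges_to_infinity points D (vertex o1) (\<lambda>n. vertex (x i n))" for i
      using ray_converges[OF x(1)[of i]] x(2) by simp
    show "range (\<lambda>n. vertex (x i n)) \<subseteq> orbit G act_points (vertex o1)" for i
    proof
      fix p assume "p \<in> range (\<lambda>n. vertex (x i n))"
      then obtain n where n: "p = vertex (x i n)" by auto
      obtain g where g: "g \<in> carrier G" "\<rho> g o1 = x i n" using transitive[OF V] by blast
      then have "p = act_points g (vertex o1)" using n act_points_vertex[OF base(1), of g] by simp
      then show "p \<in> orbit G act_points (vertex o1)" using g(1) unfolding orbit_def by blast
    qed
    show "\<not> filterlim (\<lambda>n. Gromov_product D (vertex o1) (vertex (x i n)) (vertex (x j n))) at_top sequentially"
      if "i < 3" "j < 3" "i \<noteq> j" for i j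
      using rays_not_equivalent[OF x(1)[of i] x(1)[of j]] apart[OF that] x(2) by simp
  qed
qed

end

section \<open>The pairs of a convergence group form a projection system\<close>

context loxodromic_pair
begin

definition unsided_bound :: "nat \<Rightarrow> bool" where
  "unsided_bound N \<longleftrightarrow> (\<forall>Z\<in>pairs - {core}. finite {e \<in> E. \<not> sided e Z} \<and> card {e \<in> E. \<not> sided e Z} \<le> N)"

definition gap :: nat where
  "gap = (SOME N. unsided_bound N)"

lemma gap:
  assumes "Z \<in> pairs" "Z \<noteq> core"
  shows "finite {e \<in> E. \<not> sided e Z}" "card {e \<in> E. \<not> sided e Z} \<le> gap"
proof -
  obtain N where N: "\<And>Z. \<lbrakk>Z \<in> pairs; Z \<noteq> core\<rbrakk> \<Longrightarrow> finite {e \<in> E. \<not> sided e Z} \<and> card {e \<in> E. \<not> sided e Z} \<le> N"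
    using unsided_bounded by blast
  then have "unsided_bound N" unfolding unsided_bound_def by simp
  then have "unsided_bound gap" unfolding gap_def by (rule someI)
  then show "finite {e \<in> E. \<not> sided e Z}" "card {e \<in> E. \<not> sided e Z} \<le> gap"
    using assms unfolding unsided_bound_def by simp_all
qed

definition annuli :: "'c set \<Rightarrow> 'c set \<Rightarrow> 'c set \<Rightarrow> 'a set" where
  "annuli Y A B = {g \<in> carrier G. \<phi> g ` core = Y \<and> separates g A B}"

text \<open>
  An annulus that separates \<open>A\<close> from \<open>C\<close> separates \<open>B\<close> from one of them, unless \<open>B\<close> is on no side of it. There
  are at most \<open>gap\<close> annuli of the last kind. Adding this constant to the count turns the approximate
  triangle inequality into an exact one.
\<close>

definition proj :: "'c set \<Rightarrow> 'c set \<Rightarrow> 'c set \<Rightarrow> nat" where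
  "proj Y A B = gap + card (annuli Y A B)"

lemma annuli_finite: "\<lbrakk>A \<in> pairs; B \<in> pairs\<rbrakk> \<Longrightarrow> finite (annuli Y A B)"
  by (rule finite_subset[OF _ finite_separating[of A B]]) (auto simp: annuli_def)

lemma inv_act_image:
  assumes "f \<in> carrier G" "g \<in> carrier G" "A \<subseteq> M"
  shows "\<phi> (inv (f \<otimes> g)) ` \<phi> f ` A = \<phi> (inv g) ` A"
proof -
  have "\<phi> f ` A \<subseteq> M" using act_in assms by auto
  then have "\<phi> (inv (f \<otimes> g)) ` \<phi> f ` A = \<phi> (inv g) ` \<phi> (inv f) ` \<phi> f ` A"
    using act_image_mult[of "inv g" "inv f" "\<phi> f ` A"] assms by (simp add: inv_mult_group)
  then show ?thesis using act_image_inv[OF assms(1,3)] by simp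
qed

lemma act_image_eq:
  assumes "f \<in> carrier G" "A \<subseteq> M" "B \<subseteq> M"
  shows "\<phi> f ` A = \<phi> f ` B \<longleftrightarrow> A = B"
  using act_image_inv[OF assms(1,2)] act_image_inv[OF assms(1,3)] by metis

lemma annuli_translate:
  assumes "f \<in> carrier G" "Y \<subseteq> M" "A \<subseteq> M" "B \<subseteq> M"
  shows "bij_betw (\<lambda>g. f \<otimes> g) (annuli Y A B) (annuli (\<phi> f ` Y) (\<phi> f ` A) (\<phi> f ` B))"
proof (rule bij_betwI[where g = "\<lambda>g. inv f \<otimes> g"])
  have core: "\<phi> (f \<otimes> g) ` core = \<phi> f ` \<phi> g ` core" "\<phi> g ` core \<subseteq> M" if "g \<in> carrier G" for g
    using act_image_mult[OF assms(1) that, of core] act_in that hpq by auto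
  have sep: "separates (f \<otimes> g) (\<phi> f ` A) (\<phi> f ` B) \<longleftrightarrow> separates g A B" if "g \<in> carrier G" for g
    using inv_act_image[OF assms(1) that] assms(3,4) by (simp add: separates_def)
  have mem: "f \<otimes> g \<in> annuli (\<phi> f ` Y) (\<phi> f ` A) (\<phi> f ` B) \<longleftrightarrow> g \<in> annuli Y A B" if "g \<in> carrier G" for g
    using core[OF that] sep[OF that] act_image_eq[OF assms(1) core(2)[OF that] assms(2)] that assms(1)
    by (simp add: annuli_def)
  have carrier: "g \<in> carrier G" if "g \<in> annuli Y' A' B'" for g Y' A' B' using that by (simp add: annuli_def)
  show "(\<lambda>g. f \<otimes> g) \<in> annuli Y A B \<rightarrow> annuli (\<phi> f ` Y) (\<phi> f ` A) (\<phi> f ` B)" using mem carrier by auto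
  show "(\<lambda>g. inv f \<otimes> g) \<in> annuli (\<phi> f ` Y) (\<phi> f ` A) (\<phi> f ` B) \<rightarrow> annuli Y A B"
  proof
    fix g assume g: "g \<in> annuli (\<phi> f ` Y) (\<phi> f ` A) (\<phi> f ` B)"
    then have "f \<otimes> (inv f \<otimes> g) = g" using carrier[OF g] assms(1) by (simp add: m_assoc[symmetric])
    then show "inv f \<otimes> g \<in> annuli Y A B" using mem[of "inv f \<otimes> g"] g carrier[OF g] assms(1) by simp
  qed
  show "inv f \<otimes> (f \<otimes> g) = g" if "g \<in> annuli Y A B" for g
    using carrier[OF that] assms(1) by (simp add: m_assoc[symmetric])
  show "f \<otimes> (inv f \<otimes> g) = g" if "g \<in> annuli (\<phi> f ` Y) (\<phi> f ` A) (\<phi> f ` B)" for g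
    using carrier[OF that] assms(1) by (simp add: m_assoc[symmetric])
qed

lemma proj_translate:
  "\<lbrakk>f \<in> carrier G; Y \<subseteq> M; A \<subseteq> M; B \<subseteq> M\<rbrakk> \<Longrightarrow> proj (\<phi> f ` Y) (\<phi> f ` A) (\<phi> f ` B) = proj Y A B"
  using bij_betw_same_card[OF annuli_translate] by (simp add: proj_def)

lemma proj_triangle:
  assumes "Y \<in> pairs" "A \<in> pairs" "B \<in> pairs" "C \<in> pairs" "B \<noteq> Y"
  shows "proj Y A C \<le> proj Y A B + proj Y B C"
proof -
  obtain f where f: "f \<in> carrier G" "Y = \<phi> f ` core" using assms(1) by (auto simp: pairs_def)
  let ?U = "{g \<in> carrier G. \<phi> g ` core = Y \<and> \<not> sided g B}"
  let ?Z = "\<phi> (inv f) ` B"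
  have BM: "B \<subseteq> M" using pair_subset assms by blast
  have Z: "?Z \<in> pairs" "?Z \<noteq> core"
    using pair_image[of "inv f" B] act_image_inv'[OF f(1) BM] f assms by auto
  have inj: "inj_on (\<lambda>g. inv f \<otimes> g) ?U" by (rule inj_onI) (use f in auto)
  have "(\<lambda>g. inv f \<otimes> g) ` ?U \<subseteq> {e \<in> E. \<not> sided e ?Z}"
  proof
    fix e assume "e \<in> (\<lambda>g. inv f \<otimes> g) ` ?U"
    then obtain g where g: "g \<in> carrier G" "\<phi> g ` core = Y" "\<not> sided g B" "e = inv f \<otimes> g" by auto
    have coreM: "core \<subseteq> M" using hpq by blast
    have "\<phi> e ` core = \<phi> (inv f) ` \<phi> g ` core"
      unfolding g(4) by (rule act_image_mult) (use g(1) f(1) coreM in auto)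
    also have "\<dots> = \<phi> (inv f) ` \<phi> f ` core" by (simp only: g(2) f(2))
    also have "\<dots> = core" by (rule act_image_inv[OF f(1) coreM])
    finally have "e \<in> E" unfolding E_def using f(1) g(1,4) by blast
    moreover have "\<phi> (inv e) ` ?Z = \<phi> (inv g) ` B"
      using inv_act_image[of "inv f" g B] g f BM by simp
    then have "\<not> sided e ?Z" using g(3) by (simp add: sided_def)
    ultimately show "e \<in> {e \<in> E. \<not> sided e ?Z}" by simp
  qed
  then have U: "finite ?U" "card ?U \<le> gap"
    using inj_on_finite[OF inj _ gap(1)[OF Z]] card_inj_on_le[OF inj _ gap(1)[OF Z]] gap(2)[OF Z] by auto
  have "annuli Y A C \<subseteq> annuli Y A B \<union> annuli Y B C \<union> ?U"
    unfolding annuli_def separates_def sided_def by blast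
  then have "card (annuli Y A C) \<le> card (annuli Y A B \<union> annuli Y B C \<union> ?U)"
    using U annuli_finite assms by (intro card_mono) auto
  also have "\<dots> \<le> card (annuli Y A B) + card (annuli Y B C) + card ?U"
    using card_Un_le[of "annuli Y A B \<union> annuli Y B C" ?U] card_Un_le[of "annuli Y A B" "annuli Y B C"] by linarith
  finally show ?thesis using U by (simp add: proj_def)
qed

lemma large_proj: "gap < proj Y A B \<Longrightarrow> \<exists>g. g \<in> annuli Y A B"
  unfolding proj_def by (metis add.right_neutral all_not_in_conv card.empty less_irrefl)

lemma pairs_projection_system: "projection_system pairs proj gap"
proof
  show "proj Y A B = proj Y B A" for Y A B using separates_sym by (simp add: proj_def annuli_def)
  show "proj Y A C \<le> proj Y A B + proj Y B C"
    if "Y \<in> pairs" "A \<in> pairs - {Y}" "B \<in> pairs - {Y}" "C \<in> pairs - {Y}" for Y A B C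
    using proj_triangle that by auto
  show "proj Y A A \<le> gap" if "Y \<in> pairs" "A \<in> pairs - {Y}" for Y A
  proof -
    have "A \<in> pairs" using that by blast
    then obtain a where "a \<in> A" by (rule pair_avoids)
    then have "annuli Y A A = {}" using PQ(7) unfolding annuli_def separates_def by blast
    then show ?thesis by (simp add: proj_def)
  qed
  show "proj B A Y \<le> gap" if YAB: "Y \<in> pairs" "A \<in> pairs - {Y}" "B \<in> pairs - {A, Y}" "gap < proj Y A B" for Y A B
  proof (rule ccontr)
    assume "\<not> proj B A Y \<le> gap"
    then obtain g where g: "g \<in> annuli B A Y" using large_proj[of B A Y] by auto
    obtain f where f: "f \<in> annuli Y A B" using large_proj[OF YAB(4)] by auto
    show False
      using separation_behrstock[of f g A Y B] f g YAB unfolding annuli_def by blast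
  qed
  show "finite {Y \<in> pairs - {A, B}. gap < proj Y A B}" if "A \<in> pairs" "B \<in> pairs" for A B
  proof (rule finite_subset)
    show "{Y \<in> pairs - {A, B}. gap < proj Y A B} \<subseteq> (\<lambda>g. \<phi> g ` core) ` {g \<in> carrier G. separates g A B}"
      using large_proj unfolding annuli_def by blast
    show "finite ((\<lambda>g. \<phi> g ` core) ` {g \<in> carrier G. separates g A B})" using finite_separating[OF that] by blast
  qed
qed

sublocale pr: projection_system pairs proj gap
  by (rule pairs_projection_system)

lemma pairs_rigid_system: "rigid_projection_system pairs pr.rigid (10 * gap) (20 * gap)"
proof
  show "pr.rigid Y A B = pr.rigid Y B A" for Y A B by (rule pr.rigid_sym)
  show "pr.rigid Y A C \<le> pr.rigid Y A B + pr.rigid Y B C"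
    if "Y \<in> pairs" "A \<in> pairs - {Y}" "B \<in> pairs - {Y}" "C \<in> pairs - {Y}" for Y A B C
    using pr.rigid_triangle[OF that] .
  show "pr.rigid Y A A \<le> 10 * gap" if "Y \<in> pairs" "A \<in> pairs - {Y}" for Y A
    using pr.rigid_upper[OF that(1,2,2)] pr.d_refl[OF that] by linarith
  show "pr.rigid Y X Z = pr.rigid Y W' Z"
    if "Y \<in> pairs" "W' \<in> pairs - {Y}" "X \<in> pairs - {Y, W'}" "10 * gap < pr.rigid W' Y X" for Y W' X Z
    using pr.rigid_transparent[OF that] .
  show "finite {Y \<in> pairs - {A, B}. 20 * gap < pr.rigid Y A B}" if "A \<in> pairs" "B \<in> pairs" for A B
  proof (rule finite_subset[OF _ pr.finite_large[OF that]])
    show "{Y \<in> pairs - {A, B}. 20 * gap < pr.rigid Y A B} \<subseteq> {Y \<in> pairs - {A, B}. gap < proj Y A B}"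
    proof
      fix Y assume Y: "Y \<in> {Y \<in> pairs - {A, B}. 20 * gap < pr.rigid Y A B}"
      then have "pr.rigid Y A B \<le> proj Y A B + 4 * gap" using pr.rigid_upper[of Y A B] that by auto
      then show "Y \<in> {Y \<in> pairs - {A, B}. gap < proj Y A B}" using Y by auto
    qed
  qed
qed simp

definition act_pairs :: "'a \<Rightarrow> 'c set \<Rightarrow> 'c set" where
  "act_pairs g = (\<lambda>Z\<in>pairs. \<phi> g ` Z)"

lemma act_pairs_eq: "Z \<in> pairs \<Longrightarrow> act_pairs g Z = \<phi> g ` Z"
  by (simp add: act_pairs_def)

lemma act_pairs_action: "group_action G pairs act_pairs"
proof (rule group_actionI)
  show "group G" by (rule is_group)
  show "act_pairs g \<in> extensional pairs" for g by (simp add: act_pairs_def)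
  show "act_pairs g Z \<in> pairs" if "g \<in> carrier G" "Z \<in> pairs" for g Z
    using that pair_image by (simp add: act_pairs_eq)
  show "act_pairs \<one> Z = Z" if "Z \<in> pairs" for Z
    using that act_one pair_subset[OF that] by (force simp: act_pairs_eq)
  show "act_pairs (g \<otimes> k) Z = act_pairs g (act_pairs k Z)"
    if "g \<in> carrier G" "k \<in> carrier G" "Z \<in> pairs" for g k Z
    using that pair_image act_image_mult pair_subset by (simp add: act_pairs_eq)
qed

lemma two_pairs_stabilizer_bounded:
  obtains N where "\<And>Y Z. \<lbrakk>Y \<in> pairs; Z \<in> pairs; Y \<noteq> Z\<rbrakk> \<Longrightarrow>
    finite {g \<in> carrier G. \<phi> g ` Y = Y \<and> \<phi> g ` Z = Z} \<and> card {g \<in> carrier G. \<phi> g ` Y = Y \<and> \<phi> g ` Z = Z} \<le> N"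
proof -
  obtain N where N: "\<And>Y Z. \<lbrakk>Z \<in> pairs; Z \<noteq> core; Y \<in> pairs\<rbrakk> \<Longrightarrow>
      finite {e \<in> E. \<phi> e ` Z = Y} \<and> card {e \<in> E. \<phi> e ` Z = Y} \<le> N"
    using pair_transporter_bounded by blast
  have "finite {g \<in> carrier G. \<phi> g ` Y = Y \<and> \<phi> g ` Z = Z} \<and> card {g \<in> carrier G. \<phi> g ` Y = Y \<and> \<phi> g ` Z = Z} \<le> N"
    (is "finite ?S \<and> card ?S \<le> N") if YZ: "Y \<in> pairs" "Z \<in> pairs" "Y \<noteq> Z" for Y Z
  proof -
    obtain f where f: "f \<in> carrier G" "Y = \<phi> f ` core" using YZ(1) by (auto simp: pairs_def)
    let ?C = "\<phi> (inv f) ` Z"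
    have sub: "Y \<subseteq> M" "Z \<subseteq> M" using pair_subset YZ by auto
    have C: "?C \<in> pairs" "?C \<noteq> core"
      using pair_image[of "inv f" Z] act_image_inv'[OF f(1) sub(2)] f YZ by auto
    let ?t = "\<lambda>g. inv f \<otimes> g \<otimes> f"
    have inj: "inj_on ?t ?S" by (rule inj_onI) (use f in auto)
    have "?t ` ?S \<subseteq> {e \<in> E. \<phi> e ` ?C = ?C}"
    proof
      fix e assume "e \<in> ?t ` ?S"
      then obtain g where g: "g \<in> carrier G" "\<phi> g ` Y = Y" "\<phi> g ` Z = Z" "e = inv f \<otimes> g \<otimes> f" by auto
      have e: "\<phi> e ` A = \<phi> (inv f) ` \<phi> g ` \<phi> f ` A" if "A \<subseteq> M" for A
      proof -
        have "\<phi> f ` A \<subseteq> M" using act_in f(1) that by auto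
        then show ?thesis
          using act_image_mult[of "inv f \<otimes> g" f A] act_image_mult[of "inv f" g "\<phi> f ` A"] f g that by simp
      qed
      have coreM: "core \<subseteq> M" using hpq by blast
      have "\<phi> e ` core = \<phi> (inv f) ` \<phi> g ` Y" using e[OF coreM] by (simp only: f(2))
      also have "\<dots> = \<phi> (inv f) ` \<phi> f ` core" unfolding g(2) by (simp only: f(2))
      also have "\<dots> = core" by (rule act_image_inv[OF f(1) coreM])
      finally have "\<phi> e ` core = core" .
      moreover have "?C \<subseteq> M" using pair_subset C by blast
      then have "\<phi> e ` ?C = ?C" using e[of ?C] act_image_inv'[OF f(1) sub(2)] g(3) by simp
      moreover have "e \<in> carrier G" using f(1) g(1,4) by simp
      ultimately show "e \<in> {e \<in> E. \<phi> e ` ?C = ?C}" unfolding E_def by blast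
    qed
    then show ?thesis
      using N[OF C C(1)] inj_on_finite[OF inj] card_inj_on_le[OF inj] by (meson le_trans)
  qed
  then show ?thesis using that by blast
qed

lemma proj_unbounded:
  assumes "Y \<in> pairs" "A \<in> pairs" "A \<noteq> Y"
  shows "\<exists>A'\<in>pairs - {Y}. n < proj Y A A'"
proof -
  obtain f where f: "f \<in> carrier G" "Y = \<phi> f ` core" using assms(1) by (auto simp: pairs_def)
  let ?Z = "\<phi> (inv f) ` A"
  have AM: "A \<subseteq> M" using pair_subset assms by blast
  have Z: "?Z \<in> pairs" "?Z \<noteq> core"
    using pair_image[of "inv f" A] act_image_inv'[OF f(1) AM] f assms by auto
  obtain e where e: "e \<in> E" "n < card {k \<in> E. separates k ?Z (\<phi> e ` ?Z)}" using separation_unbounded[OF Z] .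
  have eG: "e \<in> carrier G" "\<phi> e ` core = core" using e by (auto simp: E_def)
  have eZ: "\<phi> e ` ?Z \<in> pairs" "\<phi> e ` ?Z \<noteq> core"
    using pair_image[OF eG(1) Z(1)] act_image_eq[OF eG(1) pair_subset[OF Z(1)], of core] Z eG hpq by auto
  let ?A = "\<phi> f ` \<phi> e ` ?Z"
  have "{k \<in> E. separates k ?Z (\<phi> e ` ?Z)} = annuli core ?Z (\<phi> e ` ?Z)" by (auto simp: annuli_def E_def)
  then have "n < proj core ?Z (\<phi> e ` ?Z)" using e by (simp add: proj_def)
  also have "\<dots> = proj (\<phi> f ` core) (\<phi> f ` ?Z) ?A"
    by (rule proj_translate[symmetric, OF f(1)]) (use pair_subset[OF Z(1)] pair_subset[OF eZ(1)] hpq in auto)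
  also have "\<dots> = proj Y A ?A" by (simp only: act_image_inv'[OF f(1) AM] f(2))
  finally have "n < proj Y A ?A" .
  moreover have "?A \<in> pairs" using pair_image f eZ by blast
  moreover have "?A \<noteq> Y" using act_image_eq[OF f(1) pair_subset[OF eZ(1)], of core] eZ f hpq by auto
  ultimately show ?thesis by blast
qed

lemma acylindrically_hyperbolic_if_moved:
  assumes "g \<in> carrier G" "\<phi> g ` core \<noteq> core"
  shows "acylindrically_hyperbolic G"
proof -
  obtain N where N: "\<And>Y Z. \<lbrakk>Y \<in> pairs; Z \<in> pairs; Y \<noteq> Z\<rbrakk> \<Longrightarrow>
    finite {g \<in> carrier G. \<phi> g ` Y = Y \<and> \<phi> g ` Z = Z} \<and> card {g \<in> carrier G. \<phi> g ` Y = Y \<and> \<phi> g ` Z = Z} \<le> N"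
    using two_pairs_stabilizer_bounded by blast
  interpret acting_projection_system pairs pr.rigid "10 * gap" "20 * gap" G act_pairs N core "\<phi> g ` core"
  proof (intro acting_projection_system.intro pairs_rigid_system act_pairs_action acting_projection_system_axioms.intro)
    show "pr.rigid (act_pairs k Y) (act_pairs k A) (act_pairs k B) = pr.rigid Y A B"
      if k: "k \<in> carrier G" and Y: "Y \<in> pairs" "A \<in> pairs - {Y}" "B \<in> pairs - {Y}" for k Y A B
    proof (rule pr.rigid_image[OF _ _ Y])
      interpret act: group_action G pairs act_pairs by (rule act_pairs_action)
      show "bij_betw (act_pairs k) pairs pairs" using act.bij_prop0[OF k] by (simp add: Bij_def)
      show "proj (act_pairs k Y) (act_pairs k A) (act_pairs k B) = proj Y A B"
        if "Y \<in> pairs" "A \<in> pairs" "B \<in> pairs" for Y A B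
        using proj_translate[OF k] pair_subset that by (simp add: act_pairs_eq)
    qed
    show "finite {g \<in> carrier G. act_pairs g Y = Y \<and> act_pairs g Z = Z} \<and>
        card {g \<in> carrier G. act_pairs g Y = Y \<and> act_pairs g Z = Z} \<le> N"
      if "Y \<in> pairs" "Z \<in> pairs" "Y \<noteq> Z" for Y Z
      using N[OF that] that by (simp add: act_pairs_eq)
    show "\<exists>X'\<in>pairs - {Y}. n < pr.rigid Y A X'" if A: "Y \<in> pairs" "A \<in> pairs - {Y}" for Y A n
    proof -
      obtain X' where X': "X' \<in> pairs - {Y}" "n < proj Y A X'" using proj_unbounded[of Y A n] A by auto
      then have "n < pr.rigid Y A X'"
        using pr.rigid_ge[OF A X'(1) pr.linked_refl pr.linked_refl] by linarith
      then show ?thesis using X'(1) by blast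
    qed
    show "\<exists>k\<in>carrier G. act_pairs k core = Z" if "Z \<in> pairs" for Z
      using that act_pairs_eq[OF core_pair] by (auto simp: pairs_def)
    show "core \<in> pairs" by (rule core_pair)
    show "\<phi> g ` core \<in> pairs" using assms(1) by (auto simp: pairs_def)
    show "core \<noteq> \<phi> g ` core" using assms(2) by blast
    show "infinite (carrier G)" by (rule infinite_group)
  qed
  show ?thesis by (rule acylindrically_hyperbolic)
qed

end

theorem corollary1p3:
  fixes G :: "('g, 'b) monoid_scheme"
    and X :: "'m topology"
    and \<phi> :: "'g \<Rightarrow> 'm \<Rightarrow> 'm"
  assumes "convergence_group G X \<phi>"
    and "\<not> elementary_action G X \<phi>"
  shows "acylindrically_hyperbolic G"
proof -
  interpret convergence_group G X \<phi> by fact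
  obtain h p q where h: "loxodromic h p q" using exists_loxodromic[OF assms(2)] .
  have pq: "p \<in> M" "q \<in> M" "p \<noteq> q" using h by (auto simp: loxodromic_def)
  obtain P Q where P: "closed_nbhd p P" and Q: "closed_nbhd q Q" and disj: "P \<inter> Q = {}"
    and nc: "\<And>g. g \<in> carrier G \<Longrightarrow> \<not> crossing g P Q"
    using noncrossing_nbhds[OF pq] by blast
  have "normal_space X" by (rule metrizable_imp_normal_space[OF metrizable])
  then obtain V W where V: "openin X V" "P \<subseteq> V" and W: "openin X W" "Q \<subseteq> W" and VW: "V \<inter> W = {}"
    using closed_nbhdD[OF P] closed_nbhdD[OF Q] disj unfolding normal_space_def disjnt_def by meson
  interpret loxodromic_pair G X \<phi> h p q P Q V W
    by unfold_locales (fact h P Q V W VW nc)+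
  have "\<exists>g\<in>carrier G. \<phi> g ` {p, q} \<noteq> {p, q}"
  proof (rule ccontr)
    assume "\<not> ?thesis"
    then have "elementary_action G X \<phi>"
      unfolding elementary_action_def using pq by (intro exI[of _ "{p, q}"]) auto
    then show False using assms(2) by contradiction
  qed
  then show ?thesis using acylindrically_hyperbolic_if_moved by blast
qed

end
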